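(* For arbitrary real constants $a_{ij}^k,b_{ij}^k$ ($k=1,2$, $i,j\ge 0$, $0\le i+j\le 3$) and a real parameter $\varepsilon$, consider the discontinuous piecewise polynomial planar differential system with switching line $y=0$ $$(\dot x,\dot y)=\begin{cases}\bigl(-y(x^2+1)+\varepsilon P_1(x,y),\; x(x^2+1)+\varepsilon Q_1(x,y)\bigr), & y>0,\\ \bigl(-y(x^2+1)+\varepsilon P_2(x,y),\; x(x^2+1)+\varepsilon Q_2(x,y)\bigr), & y<0,\end{cases}$$ where $P_k(x,y)=\sum_{i+j=0}^{3}a_{ij}^k x^i y^j$ and $Q_k(x,y)=\sum_{i+j=0}^{3}b_{ij}^k x^i y^j$. Suppose that the average function of first order $f$ associated to this system is non-zero. Then for $|\varepsilon|>0$ sufficiently small the sharp upper bound of the number of limit cycles of this system is $6$.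
   Context: A limit cycle is an isolated periodic orbit. For $\varepsilon=0$ the system is $(\dot x,\dot y)=(-y(x^2+1),x(x^2+1))$, which has a period annulus surrounding the origin. In polar coordinates $x=r\cos\theta$, $y=r\sin\theta$, taking $\theta$ as independent variable, the system becomes $\frac{dr}{d\theta}=\varepsilon F(\theta,r)+\varepsilon^2R(\theta,r,\varepsilon)$ with $$F(\theta,r)=\frac{\cos\theta\,P_k(r\cos\theta,r\sin\theta)+\sin\theta\,Q_k(r\cos\theta,r\sin\theta)}{r^2\cos^2\theta+1},$$ where $k=1$ for $\theta\in(0,\pi)$ and $k=2$ for $\theta\in(\pi,2\pi)$. The average function of first order is $f(r)=\int_0^{2\pi}F(\theta,r)\,d\theta$, $r\in(0,+\infty)$; "non-zero" means not identically zero.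
   Formalization: Only limit cycles staying in a compact part r1 ≤ |(x,y)| ≤ r2 of the period annulus are counted, with the smallness of ε depending on the coefficients, r1 and r2; counting all limit cycles in the plane, the bound 6 fails, since a further one can shrink to the origin as ε → 0. *)

theory Defs
  imports "HOL-Analysis.Analysis"
begin

text \<open>The polynomial with coefficients \<open>c i j\<close>, \<open>i + j \<le> 3\<close>; other values of \<open>c\<close> are ignored.\<close>

definition cubic :: "(nat \<Rightarrow> nat \<Rightarrow> real) \<Rightarrow> real \<Rightarrow> real \<Rightarrow> real" where
  "cubic c x y = (\<Sum>i\<le>3. \<Sum>j\<le>3 - i. c i j * x ^ i * y ^ j)"

text \<open>Throughout, \<open>a k i j\<close> and \<open>b k i j\<close> with \<open>k = 1, 2\<close> are the coefficients of
  \<open>P\<^sub>k\<close> and \<open>Q\<^sub>k\<close>; \<open>k = 1\<close> belongs to \<open>y > 0\<close> and \<open>k = 2\<close> to \<open>y < 0\<close>.\<close>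

type_synonym coeffs = "nat \<Rightarrow> nat \<Rightarrow> nat \<Rightarrow> real"

definition vfield :: "coeffs \<Rightarrow> coeffs \<Rightarrow> real \<Rightarrow> nat \<Rightarrow> real \<times> real \<Rightarrow> real \<times> real" where
  "vfield a b \<epsilon> k = (\<lambda>(x, y).
     (- y * (x\<^sup>2 + 1) + \<epsilon> * cubic (a k) x y,
        x * (x\<^sup>2 + 1) + \<epsilon> * cubic (b k) x y))"

text \<open>On the switching line \<open>y = 0\<close> the discontinuous system is understood in the sense of
  Filippov: the admissible velocities are the convex combinations of the two one-sided fields.\<close>

definition filippov_field :: "coeffs \<Rightarrow> coeffs \<Rightarrow> real \<Rightarrow> real \<times> real \<Rightarrow> (real \<times> real) set" where
  "filippov_field a b \<epsilon> p =
     (if snd p > 0 then {vfield a b \<epsilon> 1 p}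
      else if snd p < 0 then {vfield a b \<epsilon> 2 p}
      else closed_segment (vfield a b \<epsilon> 1 p) (vfield a b \<epsilon> 2 p))"

text \<open>Solutions of \<open>\<gamma>' \<in> Z(\<gamma>)\<close>: (locally) absolutely continuous curves satisfying the inclusion
  almost everywhere, written as indefinite Lebesgue integrals of a selection \<open>v\<close>.  As the values of
  \<open>Z\<close> are nonempty, \<open>v\<close> can be changed on a null set so that \<open>v t \<in> Z (\<gamma> t)\<close> for every \<open>t\<close>.\<close>

definition inclusion_solution ::
    "(real \<times> real \<Rightarrow> (real \<times> real) set) \<Rightarrow> (real \<Rightarrow> real \<times> real) \<Rightarrow> bool" where
  "inclusion_solution Z \<gamma> \<longleftrightarrow>
     (\<exists>v. (\<forall>t. v t \<in> Z (\<gamma> t)) \<and>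
          (\<forall>s t. s \<le> t \<longrightarrow> v absolutely_integrable_on {s..t} \<and>
                           (v has_integral (\<gamma> t - \<gamma> s)) {s..t}))"

definition periodic_orbit ::
    "(real \<times> real \<Rightarrow> (real \<times> real) set) \<Rightarrow> (real \<times> real) set \<Rightarrow> bool" where
  "periodic_orbit Z C \<longleftrightarrow>
     (\<exists>\<gamma> T. T > 0 \<and> inclusion_solution Z \<gamma> \<and> (\<forall>t. \<gamma> (t + T) = \<gamma> t) \<and>
            (\<exists>t. \<gamma> t \<noteq> \<gamma> 0) \<and> C = range \<gamma>)"

definition limit_cycle ::
    "(real \<times> real \<Rightarrow> (real \<times> real) set) \<Rightarrow> (real \<times> real) set \<Rightarrow> bool" where
  "limit_cycle Z C \<longleftrightarrow> periodic_orbit Z C \<and>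
     (\<exists>U. open U \<and> C \<subseteq> U \<and> (\<forall>C'. periodic_orbit Z C' \<and> C' \<subseteq> U \<longrightarrow> C' = C))"

text \<open>For \<open>\<epsilon> = 0\<close> the period annulus is the punctured plane, foliated by the circles about the
  origin.  The limit cycles bifurcating from it are those which, as \<open>\<epsilon> \<rightarrow> 0\<close>, stay in a compact part
  \<open>r\<^sub>1 \<le> \<bar>p\<bar> \<le> r\<^sub>2\<close> of this annulus, i.e. tend neither to the centre nor to infinity.\<close>

definition limit_cycles_in_annulus ::
    "coeffs \<Rightarrow> coeffs \<Rightarrow> real \<Rightarrow> real \<Rightarrow> real \<Rightarrow> (real \<times> real) set set" where
  "limit_cycles_in_annulus a b \<epsilon> r\<^sub>1 r\<^sub>2 =
     {C. limit_cycle (filippov_field a b \<epsilon>) C \<and> C \<subseteq> {p. r\<^sub>1 \<le> norm p \<and> norm p \<le> r\<^sub>2}}"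

text \<open>The value chosen at \<open>\<theta> = \<pi>\<close> does not affect the integral below.\<close>

definition polar_F :: "coeffs \<Rightarrow> coeffs \<Rightarrow> real \<Rightarrow> real \<Rightarrow> real" where
  "polar_F a b \<theta> r =
     (let k = (if \<theta> < pi then 1 else 2) in
       (cos \<theta> * cubic (a k) (r * cos \<theta>) (r * sin \<theta>) +
        sin \<theta> * cubic (b k) (r * cos \<theta>) (r * sin \<theta>)) / (r\<^sup>2 * (cos \<theta>)\<^sup>2 + 1))"

definition average_function :: "coeffs \<Rightarrow> coeffs \<Rightarrow> real \<Rightarrow> real" where
  "average_function a b r = integral {0..2 * pi} (\<lambda>\<theta>. polar_F a b \<theta> r)"

definition average_nonzero :: "coeffs \<Rightarrow> coeffs \<Rightarrow> bool" where
  "average_nonzero a b \<longleftrightarrow> (\<exists>r>0. average_function a b r \<noteq> 0)"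

end

theory Submission
  imports Defs "HOL-Complex_Analysis.Complex_Analysis"
begin

text \<open>
  In polar coordinates the half return map of either half-plane is the time-\<open>\<pi>\<close> map of a scalar
  equation \<open>dr/d\<theta> = \<epsilon> S(\<theta>, r, \<epsilon>)\<close>. For complex \<open>r\<close> near a compact interval its Picard iterates
  are holomorphic in the initial value, so the displacement function divided by \<open>\<epsilon>\<close> is holomorphic
  on a fixed complex neighbourhood and lies within \<open>O(\<epsilon>)\<close> of the average function \<open>f\<close> there. By
  Cauchy's estimates all its derivatives converge too, so for small \<open>\<epsilon>\<close> it has at most as many
  zeros as \<open>f\<close> has with multiplicity.

  With \<open>s = (1 + r\<^sup>2)\<^bsup>1/2\<^esup>\<close>, the functions \<open>r f(r)\<close> form the space spanned by \<open>arctan r\<close>, \<open>r\<^sup>2 arctan r\<close>,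
  \<open>r\<close>, \<open>r\<^sup>2\<close>, \<open>1/s - 1\<close>, \<open>s - 1\<close>, \<open>s\<^sup>3 - 1\<close>. All of them vanish at \<open>0\<close>, and Rolle's theorem,
  used alternately with multiplications by functions without zeros, shows that a nontrivial
  combination has at most six positive zeros with multiplicity. A combination vanishing at
  \<open>1, \<dots>, 6\<close> exists by counting dimensions; its zeros are simple, and each persists as a limit cycle.

  That zeros of the displacement function are exactly the periodic orbits in an annulus follows from
  the transversality of the Filippov field to the rays: a solution crosses the switching line,
  alternately traces the two half-plane arcs, and a monotone return map has only fixed periodic points.
\<close>

section \<open>Rolle's theorem with multiplicities\<close>

text \<open>The annulus is fixed before \<open>\<epsilon>\<close> is chosen, and a multiple zero of
  \<open>f\<close> may split into several cycles, so zeros must be counted with multiplicity.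
  Multiplicity is recorded through complex derivatives at real points: holomorphy supplies all
  orders at once, Cauchy's estimates carry smallness of a difference to each order, and reality on
  the axis makes Rolle's theorem available. Near a point where the \<open>m\<close>-th derivative of
  \<open>f\<close> is nonzero, \<open>m\<close> applications of Rolle's theorem to the displacement
  then bound its real zeros; complex zeros are never counted. Why six: the seven generators and the
  constant function span a space that seven differentiations reduce to the multiples of a single
  function positive on the axis. Each differentiation costs one zero except the first, where the
  common zero at \<open>0\<close> supplies an extra interval. Seven positive zeros would leave one
  zero at the end, which forces all coefficients to vanish in turn.\<close>

definition vanishes :: "nat \<Rightarrow> (complex \<Rightarrow> complex) \<Rightarrow> real \<Rightarrow> bool" where
  "vanishes m g s \<longleftrightarrow> (\<forall>j<m. (deriv ^^ j) g (of_real s) = 0)"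

text \<open>The number \<open>m s\<close> may be smaller than the true order and may be
  \<open>0\<close>, so only lower bounds are recorded. A function that vanishes near a point of
  \<open>I\<close> satisfies this for every \<open>n\<close>.\<close>

definition zeros_at_least :: "(complex \<Rightarrow> complex) \<Rightarrow> real set \<Rightarrow> nat \<Rightarrow> bool" where
  "zeros_at_least g I n \<longleftrightarrow>
     (\<exists>S m. finite S \<and> S \<subseteq> I \<and> (\<forall>s\<in>S. vanishes (m s) g s) \<and> n \<le> sum m S)"

text \<open>The imaginary part is constantly \<open>0\<close> along \<open>I\<close>, so its
  derivative, which is \<open>Im g'\<close>, vanishes.\<close>

lemma deriv_real:
  assumes "open I" "x \<in> I"
    and diff: "(g has_field_derivative g') (at (complex_of_real x))"
    and real: "\<And>t. t \<in> I \<Longrightarrow> g (of_real t) \<in> \<real>"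
  shows "((\<lambda>t. Re (g (of_real t))) has_real_derivative Re g') (at x)" "g' \<in> \<real>"
proof -
  have v: "((\<lambda>t. g (complex_of_real t)) has_vector_derivative g') (at x)"
    using has_vector_derivative_real_field[OF diff] by (simp add: o_def)
  show "((\<lambda>t. Re (g (of_real t))) has_real_derivative Re g') (at x)"
    using v by (simp add: has_vector_derivative_complex_iff)
  have "((\<lambda>t. Im (g (of_real t))) has_real_derivative Im g') (at x)"
    using v by (simp add: has_vector_derivative_complex_iff)
  moreover have "((\<lambda>t. Im (g (of_real t))) has_real_derivative 0) (at x)"
    by (rule has_field_derivative_transform_within_open[of "\<lambda>_. 0" 0 x I])
       (use assms real complex_is_Real_iff in auto)
  ultimately show "g' \<in> \<real>"
    using DERIV_unique complex_is_Real_iff by blast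
qed

text \<open>Rolle's theorem for the real part gives only a zero of the real part of the derivative;
  since the derivative is itself real inside the interval, it vanishes altogether. Reality on the
  axis is essential, as \<open>exp (\<i> * z) - 1\<close> between \<open>0\<close> and
  \<open>2 * pi\<close> shows.\<close>

lemma rolle_complex:
  fixes g :: "complex \<Rightarrow> complex"
  assumes "a < b" "g (of_real a) = 0" "g (of_real b) = 0"
    and diff: "\<And>t. t \<in> {a..b} \<Longrightarrow> g field_differentiable at (of_real t)"
    and real: "\<And>t. t \<in> {a..b} \<Longrightarrow> g (of_real t) \<in> \<real>"
  shows "\<exists>z. a < z \<and> z < b \<and> deriv g (of_real z) = 0"
proof -
  have d: "(g has_field_derivative deriv g (of_real t)) (at (of_real t))" if "t \<in> {a..b}" for t
    using diff[OF that] field_differentiable_derivI by blast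
  have r: "((\<lambda>t. Re (g (of_real t))) has_real_derivative Re (deriv g (of_real t))) (at t)"
          "deriv g (of_real t) \<in> \<real>" if "t \<in> {a<..<b}" for t
    using deriv_real[of "{a<..<b}" t g] d[of t] real that by auto
  have c: "continuous_on {a..b} (\<lambda>t. Re (g (of_real t)))"
  proof (intro continuous_on_Re continuous_at_imp_continuous_on ballI)
    fix t assume "t \<in> {a..b}"
    hence "isCont g (of_real t)" using diff field_differentiable_imp_continuous_at by blast
    thus "isCont (\<lambda>t. g (of_real t)) t"
      by (rule isCont_o2[rotated]) (intro continuous_intros)
  qed
  obtain z where z: "a < z" "z < b" "(\<lambda>h. h * Re (deriv g (of_real z))) = (\<lambda>v. 0)"
    using Rolle_deriv[of a b "\<lambda>t. Re (g (of_real t))" "\<lambda>t h. h * Re (deriv g (of_real t))"] assms c r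
    by (force simp: has_field_derivative_def mult.commute[of _ "Re _"])
  hence "Re (deriv g (of_real z)) = 0" by (metis mult_1)
  with r(2)[of z] z show ?thesis by (auto simp: complex_eq_iff complex_is_Real_iff)
qed

lemma vanishes_deriv: "vanishes m g s \<Longrightarrow> vanishes (m - 1) (deriv g) s"
  unfolding vanishes_def by (metis comp_apply funpow_Suc_right less_diff_conv Suc_eq_plus1)

lemma vanishes_zero: "vanishes m g s \<Longrightarrow> 0 < m \<Longrightarrow> g (of_real s) = 0"
  by (force simp: vanishes_def)

text \<open>If \<open>k\<close> points carry total multiplicity \<open>M\<close>, the derivative
  keeps \<open>M - k\<close> at these points and gains a zero in each of the \<open>k - 1\<close>
  gaps. The induction adds the largest point \<open>b\<close>, so that only the gap between
  \<open>Max A\<close> and \<open>b\<close> is new.\<close>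

lemma rolle_multiplicities:
  assumes "finite S" "S \<noteq> {}"
    and "\<And>s. s \<in> S \<Longrightarrow> 0 < m s \<and> vanishes (m s) g s"
    and "\<And>t. t \<in> {Min S..Max S} \<Longrightarrow> g field_differentiable at (of_real t)"
    and "\<And>t. t \<in> {Min S..Max S} \<Longrightarrow> g (of_real t) \<in> \<real>"
  shows "\<exists>S' m'. finite S' \<and> S' \<subseteq> {Min S..Max S} \<and> (\<forall>s\<in>S'. vanishes (m' s) (deriv g) s) \<and>
           sum m S \<le> sum m' S' + (1::nat)"
  using assms
proof (induction S rule: finite_linorder_max_induct)
  case empty then show ?case by simp
next
  case (insert b A)
  show ?case
  proof (cases "A = {}")
    case True
    show ?thesis
      by (rule exI[of _ "{b}"], rule exI[of _ "\<lambda>_. m b - 1"])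
         (use True insert.prems in \<open>auto simp: vanishes_deriv[of "m b", simplified]\<close>)
  next
    case False
    let ?a = "Max A"
    have aA: "?a \<in> A" and ab: "?a < b" using False insert by auto
    have mm: "Min (insert b A) = Min A" "Max (insert b A) = b"
      using False insert by (auto simp: less_imp_le intro!: Max_eqI min_absorb2)
    have *: "Min A \<le> ?a" using insert False by auto
    obtain S' m' where S': "finite S'" "S' \<subseteq> {Min A..?a}" "\<forall>s\<in>S'. vanishes (m' s) (deriv g) s"
       "sum m A \<le> sum m' S' + 1"
      using insert.IH[OF False] insert.prems(2-4) ab mm by fastforce
    have "g (of_real ?a) = 0" "g (of_real b) = 0"
      using insert.prems aA vanishes_zero by blast+
    then obtain z where z: "?a < z" "z < b" "deriv g (of_real z) = 0"
      using rolle_complex[OF ab, of g] insert.prems mm * ab by auto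
    \<comment> \<open>Both \<open>z\<close> and \<open>b\<close> lie to the right of
      \<open>S'\<close>, so the values of \<open>m'\<close> there are free to be
      overwritten.\<close>
    let ?m = "\<lambda>s. if s = z then 1 else if s = b then m b - 1 else m' s"
    have nin: "z \<notin> S'" "b \<notin> S'" "z \<noteq> b" using S' z ab by auto
    have "sum ?m (insert z (insert b S')) = 1 + (m b - 1) + sum m' S'"
      using nin S'(1) by (simp add: sum.insert) (intro sum.cong refl; use nin in auto)
    moreover have "0 < m b" "b \<notin> A" using insert by auto
    ultimately have "sum m (insert b A) \<le> sum ?m (insert z (insert b S')) + 1"
      using S'(4) insert.hyps(1) by simp
    moreover have "\<forall>s\<in>insert z (insert b S'). vanishes (?m s) (deriv g) s"
      using S' z insert.prems by (auto simp: vanishes_deriv[of "m b", simplified]) (auto simp: vanishes_def)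
    moreover have "insert z (insert b S') \<subseteq> {Min A..b}" using S' z * ab by auto
    ultimately show ?thesis using S'(1) mm
      by (intro exI[of _ "insert z (insert b S')"] exI[of _ ?m]) auto
  qed
qed

text \<open>Points with \<open>m s = 0\<close> need not be zeros of \<open>g\<close>; they are
  dropped because Rolle's theorem could not start from them.\<close>

lemma zeros_at_least_pos_part:
  assumes "zeros_at_least g I n"
  obtains S m where "finite S" "S \<subseteq> I" "\<And>s. s \<in> S \<Longrightarrow> 0 < m s \<and> vanishes (m s) g s" "n \<le> sum m S"
proof -
  obtain S m where S: "finite S" "S \<subseteq> I" "\<forall>s\<in>S. vanishes (m s) g s" "n \<le> sum m S"
    using assms by (auto simp: zeros_at_least_def)
  have "sum m {s\<in>S. 0 < m s} = sum m S"
    by (intro sum.mono_neutral_left) (use S in auto)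
  with S show ?thesis by (intro that[of "{s\<in>S. 0 < m s}" m]) auto
qed

lemma zeros_at_least_cong:
  assumes "zeros_at_least g I n" "open \<Omega>" "of_real ` I \<subseteq> \<Omega>" "\<And>z. z \<in> \<Omega> \<Longrightarrow> g z = h z"
  shows "zeros_at_least h I n"
proof -
  have "(deriv ^^ j) g (of_real s) = (deriv ^^ j) h (of_real s)" if "s \<in> I" for s j
  proof (rule higher_deriv_cong_ev)
    have "eventually (\<lambda>z. z \<in> \<Omega>) (nhds (of_real s))"
      using assms that by (intro eventually_nhds_in_open) auto
    thus "eventually (\<lambda>z. g z = h z) (nhds (of_real s))"
      by eventually_elim (use assms in auto)
  qed simp
  thus ?thesis using assms(1) unfolding zeros_at_least_def vanishes_def
    by (metis subset_iff)
qed

text \<open>By Leibniz' formula every term of a derivative of the product of order below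
  \<open>k\<close> contains a derivative of \<open>g\<close> of order below
  \<open>k\<close>.\<close>

lemma zeros_at_least_mult:
  assumes "zeros_at_least g I n" "open \<Omega>" "of_real ` I \<subseteq> \<Omega>" "g holomorphic_on \<Omega>" "h holomorphic_on \<Omega>"
  shows "zeros_at_least (\<lambda>z. g z * h z) I n"
proof -
  have "vanishes k (\<lambda>z. g z * h z) s" if "s \<in> I" "vanishes k g s" for s k
  proof -
    have "of_real s \<in> \<Omega>" using assms that by auto
    thus ?thesis using that by (auto simp: vanishes_def higher_deriv_mult[OF assms(4,5,2)])
  qed
  thus ?thesis using assms(1) unfolding zeros_at_least_def by (meson subset_iff)
qed

lemma zeros_at_least_exists:
  assumes "zeros_at_least g I n" "0 < n" shows "\<exists>x\<in>I. g (of_real x) = 0"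
proof -
  obtain S m where S: "finite S" "S \<subseteq> I" "\<And>s. s \<in> S \<Longrightarrow> 0 < m s \<and> vanishes (m s) g s" "n \<le> sum m S"
    using zeros_at_least_pos_part[OF assms(1)] by metis
  with assms(2) have "S \<noteq> {}" by force
  thus ?thesis using S vanishes_zero by blast
qed

lemma zeros_at_least_deriv:
  assumes "zeros_at_least g I (Suc n)" "is_interval I"
    and d: "\<And>t. t \<in> I \<Longrightarrow> g field_differentiable at (of_real t)"
    and real: "\<And>t. t \<in> I \<Longrightarrow> g (of_real t) \<in> \<real>"
  shows "zeros_at_least (deriv g) I n"
proof -
  obtain S m where S: "finite S" "S \<subseteq> I" "\<And>s. s \<in> S \<Longrightarrow> 0 < m s \<and> vanishes (m s) g s" "Suc n \<le> sum m S"
    using zeros_at_least_pos_part[OF assms(1)] by metis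
  hence ne: "S \<noteq> {}" by force
  have "Min S \<in> I" "Max S \<in> I" using S(1,2) ne by (meson Min_in Max_in subset_iff)+
  hence sub: "{Min S..Max S} \<subseteq> I"
    using assms(2) unfolding is_interval_1 by (meson atLeastAtMost_iff subsetI)
  show ?thesis using rolle_multiplicities[OF S(1) ne S(3)] S(4) d real sub
    unfolding zeros_at_least_def by fastforce
qed

text \<open>The zero at the excluded endpoint \<open>a\<close> opens one more gap, below the
  smallest zero. It makes up for the zero that Rolle's theorem normally costs, so the count stays at
  \<open>n\<close>.\<close>

lemma zeros_at_least_deriv_anchored:
  assumes "zeros_at_least g {a<..} n" and 0: "g (of_real a) = 0"
    and d: "\<And>t. t \<ge> a \<Longrightarrow> g field_differentiable at (of_real t)"
    and real: "\<And>t. t \<ge> a \<Longrightarrow> g (of_real t) \<in> \<real>"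
  shows "zeros_at_least (deriv g) {a<..} n"
proof -
  obtain S m where S: "finite S" "S \<subseteq> {a<..}" "\<And>s. s \<in> S \<Longrightarrow> 0 < m s \<and> vanishes (m s) g s" "n \<le> sum m S"
    using zeros_at_least_pos_part[OF assms(1)] by metis
  show ?thesis
  proof (cases "S = {}")
    case True thus ?thesis using S by (auto simp: zeros_at_least_def)
  next
    case ne: False
    have aS: "a < Min S" using S ne by auto
    obtain S' m' where S': "finite S'" "S' \<subseteq> {Min S..Max S}" "\<forall>s\<in>S'. vanishes (m' s) (deriv g) s"
       "sum m S \<le> sum m' S' + 1"
      using rolle_multiplicities[OF S(1) ne S(3)] d real aS by fastforce
    have "g (of_real (Min S)) = 0" using S ne vanishes_zero Min_in by blast
    then obtain z where z: "a < z" "z < Min S" "deriv g (of_real z) = 0"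
      using rolle_complex[OF aS, of g] 0 d real by auto
    let ?m = "\<lambda>s. if s = z then 1 else m' s"
    have nz: "z \<notin> S'" using S'(2) z by auto
    have "sum ?m (insert z S') = 1 + sum m' S'"
      using nz S'(1) by (simp add: sum.insert) (intro sum.cong refl; use nz in auto)
    moreover have "\<forall>s\<in>insert z S'. vanishes (?m s) (deriv g) s"
      using S' z by (auto simp: vanishes_def)
    moreover have "insert z S' \<subseteq> {a<..}" using S' z aS by auto
    ultimately show ?thesis using S S' unfolding zeros_at_least_def
      by (intro exI[of _ "insert z S'"] exI[of _ ?m]) auto
  qed
qed

lemma zeros_at_least_derivative:
  assumes "zeros_at_least g I (Suc n)" "is_interval I" "open \<Omega>" "of_real ` I \<subseteq> \<Omega>"
    and d: "\<And>z. z \<in> \<Omega> \<Longrightarrow> (g has_field_derivative g' z) (at z)"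
    and real: "\<And>t. t \<in> I \<Longrightarrow> g (of_real t) \<in> \<real>"
  shows "zeros_at_least g' I n"
proof (rule zeros_at_least_cong[OF _ assms(3,4)])
  show "zeros_at_least (deriv g) I n"
    using assms by (intro zeros_at_least_deriv) (auto simp: field_differentiable_def)
  show "deriv g z = g' z" if "z \<in> \<Omega>" for z using d[OF that] by (rule DERIV_imp_deriv)
qed

section \<open>A seven-dimensional Chebyshev system\<close>

text \<open>The plane without the two cuts that run along the imaginary axis from
  \<open>\<i>\<close> and \<open>- \<i>\<close> to infinity; on it both \<open>Arctan\<close> and
  the principal root of \<open>1 + z\<^sup>2\<close> are holomorphic.\<close>

definition slit :: "complex set" where "slit = {z. Re z = 0 \<longrightarrow> \<bar>Im z\<bar> < 1}"

definition rt :: "complex \<Rightarrow> complex" where "rt z = csqrt (1 + z\<^sup>2)"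

lemma open_slit: "open slit"
proof -
  have "slit = - ({z. Re z = 0} \<inter> ({z. Im z \<ge> 1} \<union> {z. Im z \<le> -1}))"
    by (auto simp: slit_def)
  moreover have "closed ({z. Re z = 0} \<inter> ({z. Im z \<ge> 1} \<union> {z. Im z \<le> -1}))"
    by (intro closed_Int closed_Un closed_halfspace_Re_eq closed_halfspace_Im_ge closed_halfspace_Im_le)
  ultimately show ?thesis by (metis open_Compl)
qed

lemma slit_not_nonpos:
  assumes "z \<in> slit" shows "1 + z\<^sup>2 \<notin> \<real>\<^sub>\<le>\<^sub>0"
proof
  assume "1 + z\<^sup>2 \<in> \<real>\<^sub>\<le>\<^sub>0"
  hence *: "1 + (Re z)\<^sup>2 \<le> (Im z)\<^sup>2" "Re z * Im z = 0"
    by (auto simp: complex_nonpos_Reals_iff power2_eq_square)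
  show False
  proof (cases "Re z = 0")
    case True
    hence "(Im z)\<^sup>2 < 1" using assms by (simp add: slit_def abs_square_less_1)
    with * True show False by simp
  next
    case False
    with * have "1 + (Re z)\<^sup>2 \<le> 0" by simp
    thus False using zero_le_power2[of "Re z"] by linarith
  qed
qed

lemma rt_sq: "(rt z)\<^sup>2 = 1 + z\<^sup>2" by (simp add: rt_def)

lemma rt_nz: "z \<in> slit \<Longrightarrow> rt z \<noteq> 0"
  using slit_not_nonpos[of z] by (auto simp: rt_def)

lemma DERIV_rt:
  assumes "z \<in> slit"
  shows "(rt has_field_derivative z * inverse (rt z)) (at z)"
  unfolding rt_def
  by (rule derivative_eq_intros assms slit_not_nonpos refl)+ (simp add: field_simps)

lemma DERIV_inverse_rt:
  assumes "z \<in> slit"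
  shows "((\<lambda>z. inverse (rt z)) has_field_derivative - z * inverse (rt z) ^ 3) (at z)"
  by (rule DERIV_rt[OF assms] derivative_eq_intros refl rt_nz[OF assms])+
     (simp add: field_simps power3_eq_cube)

lemma DERIV_Arctan_slit:
  assumes "z \<in> slit"
  shows "(Arctan has_field_derivative inverse (rt z) ^ 2) (at z)"
  using has_field_derivative_Arctan[of z] assms by (auto simp: slit_def rt_sq power_inverse)

text \<open>These polynomial relations allow \<open>z\<close>, \<open>rt z\<close> and
  \<open>inverse (rt z)\<close> to be treated as indeterminates: the derivative formulas below
  become ideal membership problems, which \<open>algebra\<close> decides.\<close>

lemma inverse_rt_relation:
  assumes "z \<in> slit"
  shows "rt z * inverse (rt z) = 1" "inverse (rt z) ^ 2 * (1 + z\<^sup>2) = 1" "rt z = inverse (rt z) * (1 + z\<^sup>2)"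
proof -
  have n: "rt z \<noteq> 0" by (rule rt_nz[OF assms])
  show "rt z * inverse (rt z) = 1" using n by simp
  show "inverse (rt z) ^ 2 * (1 + z\<^sup>2) = 1"
    unfolding rt_sq[symmetric] power_mult_distrib[symmetric] using n by simp
  show "rt z = inverse (rt z) * (1 + z\<^sup>2)"
    unfolding rt_sq[symmetric] using n by (simp add: power2_eq_square)
qed

lemma rt_of_real: "rt (of_real x) = of_real (sqrt (1 + x\<^sup>2))"
  using of_real_sqrt[of "1 + x\<^sup>2"] by (simp add: rt_def)

text \<open>\<open>ect\<close> is the continuation of \<open>r f(r)\<close> to complex \<open>r\<close>, and \<open>ect1\<close>, \<open>ect2\<close>, \<open>ect3\<close> are its derivatives;
  the coefficients \<open>c1\<close>, \<open>c3\<close> and the constant are gone after three steps.\<close>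

definition ect :: "complex \<Rightarrow> complex \<Rightarrow> complex \<Rightarrow> complex \<Rightarrow> complex \<Rightarrow> complex \<Rightarrow> complex \<Rightarrow> complex \<Rightarrow> complex" where
  "ect c0 c1 c2 c3 e1 e2 e3 z =
     (c0 + c2 * z\<^sup>2) * Arctan z + c1 * z + c3 * z\<^sup>2
     + e1 * (inverse (rt z) - 1) + e2 * (rt z - 1) + e3 * ((rt z)^3 - 1)"

definition ect1 :: "complex \<Rightarrow> complex \<Rightarrow> complex \<Rightarrow> complex \<Rightarrow> complex \<Rightarrow> complex \<Rightarrow> complex \<Rightarrow> complex \<Rightarrow> complex" where
  "ect1 c0 c1 c2 c3 e1 e2 e3 z =
     2 * c2 * z * Arctan z + (c0 + c2 * z\<^sup>2) * inverse (rt z) ^ 2 + c1 + 2 * c3 * z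
     - e1 * z * inverse (rt z)^3 + e2 * z * inverse (rt z) + 3 * e3 * z * rt z"

definition ect2 :: "complex \<Rightarrow> complex \<Rightarrow> complex \<Rightarrow> complex \<Rightarrow> complex \<Rightarrow> complex \<Rightarrow> complex \<Rightarrow> complex" where
  "ect2 c0 c2 c3 e1 e2 e3 z =
     2 * c2 * Arctan z + 4 * c2 * z * inverse (rt z)^2 - 2 * z * (c0 + c2 * z\<^sup>2) * inverse (rt z)^4  + 2 * c3
     + e1 * (2 * z\<^sup>2 - 1) * inverse (rt z)^5 + e2 * inverse (rt z)^3 + 3 * e3 * (1 + 2 * z\<^sup>2) * inverse (rt z)"

definition ect3 :: "complex \<Rightarrow> complex \<Rightarrow> complex \<Rightarrow> complex \<Rightarrow> complex \<Rightarrow> complex \<Rightarrow> complex" where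
  "ect3 A B \<alpha> \<beta> \<gamma> z =
     (A + B * z\<^sup>2) * inverse (rt z)^6 + z * (\<alpha> + \<beta> * z\<^sup>2 + \<gamma> * (7 * z^4 + 2 * z^6)) * inverse (rt z)^7"

lemmas DERIV_slit = DERIV_Arctan_slit DERIV_rt DERIV_inverse_rt

lemma DERIV_ect:
  assumes "z \<in> slit"
  shows "(ect c0 c1 c2 c3 e1 e2 e3 has_field_derivative ect1 c0 c1 c2 c3 e1 e2 e3 z) (at z)"
  unfolding ect_def ect1_def
  apply (rule DERIV_slit[OF assms] derivative_eq_intros refl)+
  apply (simp del: left_inverse right_inverse)
  using inverse_rt_relation(2,3)[OF assms]
  apply algebra
  done

lemma DERIV_ect1:
  assumes "z \<in> slit"
  shows "(ect1 c0 c1 c2 c3 e1 e2 e3 has_field_derivative ect2 c0 c2 c3 e1 e2 e3 z) (at z)"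
  unfolding ect1_def ect2_def
  apply (rule DERIV_slit[OF assms] derivative_eq_intros refl)+
  apply (simp del: left_inverse right_inverse)
  using inverse_rt_relation(2,3)[OF assms]
  apply algebra
  done

text \<open>The passage to the new coefficients loses nothing: \<open>c0\<close>, \<open>c2\<close>
  go to the first two with determinant \<open>-32\<close>, the last one determines
  \<open>e3\<close>, and \<open>e1\<close>, \<open>e2\<close> then enter the remaining two with
  determinant \<open>-45\<close>.\<close>

lemma DERIV_ect2:
  assumes "z \<in> slit"
  shows "(ect2 c0 c2 c3 e1 e2 e3 has_field_derivative
     ect3 (6*c2 - 2*c0) (6*c0 - 2*c2) (9*e1 - 3*e2 + 9*e3) (24*e3 - 6*e1 - 3*e2) (3*e3) z) (at z)"
  unfolding ect2_def ect3_def
  apply (rule DERIV_slit[OF assms] derivative_eq_intros refl)+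
  apply (simp del: left_inverse right_inverse)
  using inverse_rt_relation(2,3)[OF assms]
  apply algebra
  done

lemma holomorphic_ect3: "ect3 A B \<alpha> \<beta> \<gamma> holomorphic_on slit"
proof -
  have "(\<lambda>z. inverse (rt z)) holomorphic_on slit"
    using DERIV_inverse_rt open_slit holomorphic_on_open by blast
  hence "(\<lambda>z. (A + B * z\<^sup>2) * (\<lambda>z. inverse (rt z)) z^6 + z * (\<alpha> + \<beta> * z\<^sup>2 + \<gamma> * (7 * z^4 + 2 * z^6)) * (\<lambda>z. inverse (rt z)) z^7) holomorphic_on slit"
    by (intro holomorphic_on_add holomorphic_on_mult holomorphic_on_power holomorphic_on_const holomorphic_on_ident)
  thus ?thesis by (simp add: ect3_def[abs_def])
qed

text \<open>\<open>echeb\<close> is \<open>ect3\<close> times \<open>s\<^sup>7 / z\<close>. In the variable \<open>u = z\<^sup>2\<close> two differentiations remove \<open>\<alpha>\<close> and \<open>\<beta>\<close>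
  and, after clearing \<open>z\<^sup>4 s\<^sup>3\<close>, leave \<open>echeb2\<close>; two more leave a multiple of \<open>\<gamma>\<close> that is positive
  on the positive axis. The differentiations in \<open>u\<close> appear as derivatives in \<open>z\<close> with a factor \<open>z\<close> split off.\<close>

definition echeb :: "complex \<Rightarrow> complex \<Rightarrow> complex \<Rightarrow> complex \<Rightarrow> complex \<Rightarrow> complex \<Rightarrow> complex" where
  "echeb A B \<alpha> \<beta> \<gamma> z = (A + B * z\<^sup>2) * rt z * inverse z + \<alpha> + \<beta> * z\<^sup>2 + \<gamma> * (7 * z^4 + 2 * z^6)"

definition echeb1 :: "complex \<Rightarrow> complex \<Rightarrow> complex \<Rightarrow> complex \<Rightarrow> complex \<Rightarrow> complex" where
  "echeb1 A B \<beta> \<gamma> z = 2 * B * rt z * inverse z - (A + B * z\<^sup>2) * inverse z ^ 3 * inverse (rt z)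
     + 2 * \<beta> + \<gamma> * (28 * z\<^sup>2 + 12 * z^4)"

definition echeb2 :: "complex \<Rightarrow> complex \<Rightarrow> complex \<Rightarrow> complex \<Rightarrow> complex" where
  "echeb2 A B \<gamma> z = 3 * A + (4 * A - B) * z\<^sup>2 + \<gamma> * (56 + 48 * z\<^sup>2) * z^5 * rt z^3"

definition echeb3 :: "complex \<Rightarrow> complex \<Rightarrow> complex \<Rightarrow> complex \<Rightarrow> complex" where
  "echeb3 A B \<gamma> z = 2 * (4 * A - B)
     + \<gamma> * (96 * z^5 * rt z^3 + (56 + 48 * z\<^sup>2) * (5 * z^3 * rt z^3 + 3 * z^5 * rt z))"

definition echeb4 :: "complex \<Rightarrow> complex \<Rightarrow> complex" where
  "echeb4 \<gamma> z = \<gamma> * (96 * (5 * z^4 * rt z^3 + 3 * z^6 * rt z) + 96 * z * (5 * z^3 * rt z^3 + 3 * z^5 * rt z)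
      + (56 + 48 * z\<^sup>2) * (15 * z\<^sup>2 * rt z^3 + 30 * z^4 * rt z + 3 * z^6 * inverse (rt z)))"

text \<open>Unlike \<open>slit\<close>, this neighbourhood of the positive axis also avoids the pole
  of \<open>inverse z\<close> at the origin.\<close>

definition rhp :: "complex set" where "rhp = {z. Re z > 0}"

lemma rhp_slit: "z \<in> rhp \<Longrightarrow> z \<in> slit" by (simp add: rhp_def slit_def)

lemma open_rhp: "open rhp" by (simp add: rhp_def open_halfspace_Re_gt)

lemma DERIV_inverse_rhp: "z \<in> rhp \<Longrightarrow> (inverse has_field_derivative - (inverse z)\<^sup>2) (at z)"
  using DERIV_inverse[of z] by (cases "z = 0") (auto simp: rhp_def numeral_2_eq_2)

lemma rhp_inverse: "z \<in> rhp \<Longrightarrow> z * inverse z = 1"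
  by (cases "z = 0") (auto simp: rhp_def)

lemma DERIV_echeb:
  assumes "z \<in> rhp"
  shows "(echeb A B \<alpha> \<beta> \<gamma> has_field_derivative z * echeb1 A B \<beta> \<gamma> z) (at z)"
  unfolding echeb_def echeb1_def
  apply (rule DERIV_slit[OF rhp_slit[OF assms]] DERIV_inverse_rhp[OF assms] derivative_eq_intros refl)+
  apply (simp del: left_inverse right_inverse)
  using inverse_rt_relation[OF rhp_slit[OF assms]] rhp_inverse[OF assms]
  apply algebra
  done

lemma DERIV_echeb1:
  assumes "z \<in> rhp"
  shows "(echeb1 A B \<beta> \<gamma> has_field_derivative inverse z ^ 4 * inverse (rt z) ^ 3 * echeb2 A B \<gamma> z) (at z)"
  unfolding echeb1_def echeb2_def
  apply (rule DERIV_slit[OF rhp_slit[OF assms]] DERIV_inverse_rhp[OF assms] derivative_eq_intros refl)+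
  apply (simp del: left_inverse right_inverse)
  using inverse_rt_relation[OF rhp_slit[OF assms]] rhp_inverse[OF assms]
  apply algebra
  done

lemma DERIV_echeb2:
  assumes "z \<in> rhp"
  shows "(echeb2 A B \<gamma> has_field_derivative z * echeb3 A B \<gamma> z) (at z)"
  unfolding echeb2_def echeb3_def
  apply (rule DERIV_slit[OF rhp_slit[OF assms]] DERIV_inverse_rhp[OF assms] derivative_eq_intros refl)+
  apply (simp del: left_inverse right_inverse)
  using inverse_rt_relation[OF rhp_slit[OF assms]] rhp_inverse[OF assms]
  apply algebra
  done

lemma DERIV_echeb3:
  assumes "z \<in> rhp"
  shows "(echeb3 A B \<gamma> has_field_derivative echeb4 \<gamma> z) (at z)"
  unfolding echeb3_def echeb4_def
  apply (rule DERIV_slit[OF rhp_slit[OF assms]] DERIV_inverse_rhp[OF assms] derivative_eq_intros refl)+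
  apply (simp del: left_inverse right_inverse)
  using inverse_rt_relation[OF rhp_slit[OF assms]] rhp_inverse[OF assms]
  apply algebra
  done

lemma real_rt: "rt (of_real t) \<in> \<real>" by (simp add: rt_of_real)

lemma of_real_pos_subset: "of_real ` {0<..} \<subseteq> rhp" "of_real ` {0<..} \<subseteq> slit"
  "of_real t \<in> slit"
  by (auto simp: rhp_def slit_def)

lemma holomorphic_rhp:
  "rt holomorphic_on rhp" "inverse holomorphic_on rhp" "(\<lambda>z. inverse (rt z)) holomorphic_on rhp"
  using DERIV_slit(2,3)[OF rhp_slit] DERIV_inverse_rhp open_rhp holomorphic_on_open by blast+

lemma echeb4_zero:
  assumes "x > 0" "echeb4 \<gamma> (of_real x) = 0"
  shows "\<gamma> = 0"
proof -
  define s where "s = sqrt (1 + x\<^sup>2)"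
  have s: "s > 0" using assms by (simp add: s_def add_pos_nonneg)
  define E where "E = 96 * (5 * x^4 * s^3 + 3 * x^6 * s) + 96 * x * (5 * x^3 * s^3 + 3 * x^5 * s)
      + (56 + 48 * x\<^sup>2) * (15 * x\<^sup>2 * s^3 + 30 * x^4 * s + 3 * x^6 * inverse s)"
  have "echeb4 \<gamma> (of_real x) = \<gamma> * of_real E"
    by (simp add: echeb4_def E_def rt_of_real s_def)
  moreover have "E > 0"
    unfolding E_def using assms s by (intro add_pos_pos mult_pos_pos zero_less_power positive_imp_inverse_positive) auto
  ultimately show ?thesis using assms by simp
qed

text \<open>The zero-free factor \<open>h\<close> is removed by multiplying with its reciprocal
  \<open>l\<close>, which preserves multiplicities; the only loss is the one zero of Rolle's
  theorem.\<close>

lemma zeros_at_least_deriv_factor: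
  assumes "zeros_at_least g {0<..} (Suc n)"
    and d: "\<And>z. z \<in> rhp \<Longrightarrow> (g has_field_derivative h z * k z) (at z)"
    and real: "\<And>t. g (of_real t) \<in> \<real>"
    and "l holomorphic_on rhp" "\<And>z. z \<in> rhp \<Longrightarrow> l z * h z = 1"
  shows "zeros_at_least k {0<..} n"
proof -
  note s = open_rhp of_real_pos_subset(1)
  have 1: "zeros_at_least (deriv g) {0<..} n"
    
  proof (rule zeros_at_least_deriv[OF assms(1) _ _ real])
    show "g field_differentiable at (of_real t)" if "t \<in> {0<..}" for t
      using d[of "of_real t"] that by (auto simp: field_differentiable_def rhp_def)
  qed (auto simp: is_interval_1)
  have "g holomorphic_on rhp" using d open_rhp holomorphic_on_open by blast
  hence "zeros_at_least (\<lambda>z. deriv g z * l z) {0<..} n"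
    by (intro zeros_at_least_mult[OF 1 s] holomorphic_deriv assms open_rhp)
  thus ?thesis
  proof (rule zeros_at_least_cong[OF _ s])
    fix z assume z: "z \<in> rhp"
    have "deriv g z * l z = (l z * h z) * k z" using DERIV_imp_deriv[OF d[OF z]] by simp
    thus "deriv g z * l z = k z" using assms(5)[OF z] by simp
  qed
qed

lemma zeros_of_constant:
  assumes "zeros_at_least g {0<..} n" "0 < n" "\<And>z. g z = c" shows "c = 0"
  using zeros_at_least_exists[OF assms(1,2)] assms(3) by simp

text \<open>Descending the chain leaves one zero for \<open>echeb4\<close>, hence
  \<open>\<gamma> = 0\<close>. On the way back each function, stripped of the coefficients already
  known to vanish, is a constant that still has a zero; this yields \<open>4 * A - B\<close>,
  \<open>A\<close>, \<open>\<beta>\<close> and \<open>\<alpha>\<close> in turn.\<close>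

lemma echeb_zeros:
  fixes A B \<alpha> \<beta> \<gamma> :: complex
  assumes "zeros_at_least (echeb A B \<alpha> \<beta> \<gamma>) {0<..} 5"
    and real: "A \<in> \<real>" "B \<in> \<real>" "\<alpha> \<in> \<real>" "\<beta> \<in> \<real>" "\<gamma> \<in> \<real>"
  shows "A = 0 \<and> B = 0 \<and> \<alpha> = 0 \<and> \<beta> = 0 \<and> \<gamma> = 0"
proof -
  note [simp] = real real_rt
  have *: "rhp \<subseteq> slit" using rhp_slit by blast
  have R: "inverse z * z = 1" "rt z \<noteq> 0" "z \<noteq> 0" if "z \<in> rhp" for z
    using rhp_inverse[OF that] rt_nz[OF rhp_slit[OF that]] that by (auto simp: rhp_def mult.commute)
  have z1: "zeros_at_least (echeb1 A B \<beta> \<gamma>) {0<..} 4"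
    by (rule zeros_at_least_deriv_factor[OF _ DERIV_echeb, of A B \<alpha> \<beta> \<gamma> 4 inverse])
       (use assms R in \<open>auto simp: echeb_def intro!: holomorphic_rhp\<close>)
  have z2: "zeros_at_least (echeb2 A B \<gamma>) {0<..} 3"
    by (rule zeros_at_least_deriv_factor[OF _ DERIV_echeb1, of A B \<beta> \<gamma> 3 "\<lambda>z. z^4 * rt z^3"])
       (use z1 R in \<open>auto simp: echeb1_def field_simps intro!: holomorphic_intros holomorphic_rhp\<close>)
  have z3: "zeros_at_least (echeb3 A B \<gamma>) {0<..} 2"
    by (rule zeros_at_least_deriv_factor[OF _ DERIV_echeb2, of A B \<gamma> 2 inverse])
       (use z2 R in \<open>auto simp: echeb2_def intro!: holomorphic_rhp\<close>)
  have z4: "zeros_at_least (echeb4 \<gamma>) {0<..} 1"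
    by (rule zeros_at_least_derivative[OF _ _ open_rhp of_real_pos_subset(1) DERIV_echeb3, of A B])
       (use z3 in \<open>auto simp: echeb3_def is_interval_1 eval_nat_numeral\<close>)
  have \<gamma>: "\<gamma> = 0" using zeros_at_least_exists[OF z4] echeb4_zero by auto
  have AB: "2 * (4 * A - B) = 0"
    by (rule zeros_of_constant[OF z3]) (auto simp: echeb3_def \<gamma>)
  have A: "3 * A = 0"
    by (rule zeros_of_constant[OF z2]) (use AB in \<open>auto simp: echeb2_def \<gamma>\<close>)
  have B: "B = 0" using A AB by simp
  have \<beta>: "2 * \<beta> = 0"
    by (rule zeros_of_constant[OF z1]) (use A B in \<open>auto simp: echeb1_def \<gamma>\<close>)
  have \<alpha>: "\<alpha> = 0"
    by (rule zeros_of_constant[OF assms(1)]) (use A B \<beta> in \<open>auto simp: echeb_def \<gamma>\<close>)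
  show ?thesis using A B \<alpha> \<beta> \<gamma> by simp
qed

text \<open>The zero at \<open>0\<close> keeps the count at seven through the first differentiation;
  the next two leave six and five, which is what \<open>echeb_zeros\<close> requires. Then
  \<open>c3\<close> and \<open>c1\<close> are read off from \<open>ect2\<close> and
  \<open>ect1\<close>, which have become constant.\<close>

lemma ect_zeros:
  fixes c0 c1 c2 c3 e1 e2 e3 :: real
  assumes "zeros_at_least (ect c0 c1 c2 c3 e1 e2 e3) {0<..} 7"
  shows "c0 = 0 \<and> c1 = 0 \<and> c2 = 0 \<and> c3 = 0 \<and> e1 = 0 \<and> e2 = 0 \<and> e3 = 0"
proof -
  note sl = open_slit of_real_pos_subset(2)
  have Arctan_real: "Arctan (of_real t) \<in> \<real>" for t using Arctan_of_real[of t] by simp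
  note [simp] = real_rt Arctan_real
  have 0: "ect c0 c1 c2 c3 e1 e2 e3 (of_real 0) = 0" by (simp add: ect_def rt_def)
  have z1: "zeros_at_least (ect1 c0 c1 c2 c3 e1 e2 e3) {0<..} 7"
  proof (rule zeros_at_least_cong[OF _ sl])
    show "zeros_at_least (deriv (ect c0 c1 c2 c3 e1 e2 e3)) {0<..} 7"
    proof (rule zeros_at_least_deriv_anchored[OF assms 0])
      show "ect c0 c1 c2 c3 e1 e2 e3 field_differentiable at (of_real t)" for t
        using DERIV_ect[OF of_real_pos_subset(3)] field_differentiable_def by blast
    qed (simp add: ect_def)
  qed (use DERIV_ect DERIV_imp_deriv in blast)
  have z2: "zeros_at_least (ect2 c0 c2 c3 e1 e2 e3) {0<..} 6"
    by (rule zeros_at_least_derivative[OF _ _ sl DERIV_ect1])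
       (use z1 in \<open>auto simp: is_interval_1 ect1_def\<close>)
  define A B \<alpha> \<beta> \<gamma> where d: "A = 6*c2 - 2*c0" "B = 6*c0 - 2*c2" "\<alpha> = 9*e1 - 3*e2 + 9*e3"
    "\<beta> = 24*e3 - 6*e1 - 3*e2" "\<gamma> = 3*e3"
  have z3: "zeros_at_least (ect3 A B \<alpha> \<beta> \<gamma>) {0<..} 5"
    unfolding d of_real_diff of_real_add of_real_mult of_real_numeral
    by (rule zeros_at_least_derivative[OF _ _ sl DERIV_ect2])
       (use z2 in \<open>auto simp: is_interval_1 ect2_def\<close>)
  have "zeros_at_least (\<lambda>z. ect3 A B \<alpha> \<beta> \<gamma> z * (rt z^7 * inverse z)) {0<..} 5"
  proof (rule zeros_at_least_mult[OF z3 open_rhp of_real_pos_subset(1)])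
    show "ect3 A B \<alpha> \<beta> \<gamma> holomorphic_on rhp"
      using holomorphic_on_subset[OF holomorphic_ect3] rhp_slit by blast
  qed (auto intro!: holomorphic_intros holomorphic_rhp)
  hence z4: "zeros_at_least (echeb A B \<alpha> \<beta> \<gamma>) {0<..} 5"
  proof (rule zeros_at_least_cong[OF _ open_rhp of_real_pos_subset(1)])
    fix z assume z: "z \<in> rhp"
    have "rt z * inverse (rt z) = 1" "z * inverse z = 1"
      using rt_nz[OF rhp_slit[OF z]] rhp_inverse[OF z] by auto
    thus "ect3 A B \<alpha> \<beta> \<gamma> z * (rt z^7 * inverse z) = echeb A B \<alpha> \<beta> \<gamma> z"
      unfolding ect3_def echeb_def by algebra
  qed
  have "A = 0 \<and> B = 0 \<and> \<alpha> = 0 \<and> \<beta> = 0 \<and> \<gamma> = 0"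
    using echeb_zeros[OF z4] by simp
  hence z: "c0 = 0" "c2 = 0" "e1 = 0" "e2 = 0" "e3 = 0" unfolding d by linarith+
  have "2 * complex_of_real c3 = 0"
    by (rule zeros_of_constant[OF z2]) (use z in \<open>auto simp: ect2_def\<close>)
  moreover from this have "complex_of_real c1 = 0"
    by (intro zeros_of_constant[OF z1]) (use z in \<open>auto simp: ect1_def\<close>)
  ultimately show ?thesis using z by simp
qed

section \<open>Holomorphic dependence on the initial value\<close>

text \<open>Uniform continuity on a compact product makes \<open>g t - g t0\<close> small on a whole
  disc, and Cauchy's estimate turns this into smallness of the difference of derivatives. Continuity
  of the single derivative \<open>deriv (g t0)\<close> supplies the other half of
  \<open>e\<close>.\<close>

lemma continuous_on_deriv_parameter:
  fixes g :: "real \<Rightarrow> complex \<Rightarrow> complex"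
  assumes A: "open A" and cont: "continuous_on ({a..b} \<times> A) (\<lambda>(t, z). g t z)"
    and hol: "\<And>t. t \<in> {a..b} \<Longrightarrow> g t holomorphic_on A"
  shows "continuous_on ({a..b} \<times> A) (\<lambda>(t, z). deriv (g t) z)"
  unfolding continuous_on_iff
proof (intro ballI allI impI)
  fix x and e :: real
  assume "x \<in> {a..b} \<times> A" and e: "0 < e"
  then obtain t0 z0 where x: "x = (t0, z0)" and t0: "a \<le> t0" "t0 \<le> b" and z0: "z0 \<in> A" by auto
  obtain d' where d': "d' > 0" "cball z0 d' \<subseteq> A" using A z0 open_contains_cball_eq by blast
  define d where "d = d' / 2"
  have d: "d > 0" "cball z0 (2 * d) \<subseteq> A" using d' by (auto simp: d_def)
  have "uniformly_continuous_on ({a..b} \<times> cball z0 (2*d)) (\<lambda>(t, z). g t z)"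
    by (rule compact_uniformly_continuous[OF continuous_on_subset[OF cont]])
       (use d in \<open>auto intro: compact_Times\<close>)
  \<comment> \<open>The factor \<open>d\<close> cancels against the radius in Cauchy's estimate,
    leaving \<open>e / 2\<close>.\<close>
  then obtain \<eta> where \<eta>: "\<eta> > 0" "\<And>x y. x \<in> {a..b} \<times> cball z0 (2*d) \<Longrightarrow> y \<in> {a..b} \<times> cball z0 (2*d) \<Longrightarrow>
      dist y x < \<eta> \<Longrightarrow> dist ((\<lambda>(t, z). g t z) y) ((\<lambda>(t, z). g t z) x) < d * e / 2"
    unfolding uniformly_continuous_on_def using d(1) e by (metis half_gt_zero mult_pos_pos)
  have near: "norm (g t w - g t0 w) \<le> d * e / 2" if "t \<in> {a..b}" "\<bar>t - t0\<bar> < \<eta>" "w \<in> cball z0 (2*d)" for t w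
    using \<eta>(2)[of "(t0, w)" "(t, w)"] that t0 by (auto simp: dist_Pair_Pair dist_norm)
  have "continuous_on A (deriv (g t0))"
    using hol[of t0] t0 A by (intro holomorphic_on_imp_continuous_on holomorphic_deriv) auto
  then obtain \<kappa> where \<kappa>: "\<kappa> > 0" "\<And>z. z \<in> A \<Longrightarrow> dist z z0 < \<kappa> \<Longrightarrow> dist (deriv (g t0) z) (deriv (g t0) z0) < e / 2"
    unfolding continuous_on_iff using z0 e by (metis half_gt_zero)
  have "dist (deriv (g t) z) (deriv (g t0) z0) < e"
    if t: "t \<in> {a..b}" and z: "z \<in> A" and D: "dist (t, z) (t0, z0) < min \<eta> (min \<kappa> d)" for t z
  proof -
    have tz: "\<bar>t - t0\<bar> < \<eta>" "dist z z0 < \<kappa>" "dist z z0 < d"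
      using D dist_fst_le[of "(t,z)" "(t0,z0)"] dist_snd_le[of "(t,z)" "(t0,z0)"] by (auto simp: dist_real_def)
    have sub: "cball z d \<subseteq> cball z0 (2*d)"
    proof
      fix w assume "w \<in> cball z d"
      thus "w \<in> cball z0 (2*d)" using tz(3) dist_triangle[of z0 w z] by (simp add: dist_commute)
    qed
    have ht: "(\<lambda>w. g t w - g t0 w) holomorphic_on A"
      using hol[OF t] hol[of t0] t0 by (intro holomorphic_intros) auto
    have "norm ((deriv ^^ 1) (\<lambda>w. g t w - g t0 w) z) \<le> fact 1 * (d * e / 2) / d ^ 1"
    proof (rule Cauchy_inequality)
      show "(\<lambda>w. g t w - g t0 w) holomorphic_on ball z d"
        using ht sub d ball_subset_cball holomorphic_on_subset by blast
      show "continuous_on (cball z d) (\<lambda>w. g t w - g t0 w)"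
        using ht sub d holomorphic_on_imp_continuous_on holomorphic_on_subset by blast
      show "norm (g t x - g t0 x) \<le> d * e / 2" if "norm (z - x) = d" for x
        using near[OF t tz(1)] sub that by (auto simp: dist_norm subset_iff)
    qed (use d in auto)
    moreover have "deriv (\<lambda>w. g t w - g t0 w) z = deriv (g t) z - deriv (g t0) z"
      using hol[OF t] hol[of t0] t0 A z by (intro deriv_diff) (auto simp: holomorphic_on_imp_differentiable_at)
    ultimately have "norm (deriv (g t) z - deriv (g t0) z) \<le> e / 2" using d by simp
    thus ?thesis using \<kappa>(2)[OF z tz(2)] dist_triangle[of "deriv (g t) z" "deriv (g t0) z0" "deriv (g t0) z"]
      by (simp add: dist_norm)
  qed
  thus "\<exists>\<delta>>0. \<forall>y\<in>{a..b} \<times> A. dist y x < \<delta> \<longrightarrow>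
      dist ((\<lambda>(t, z). deriv (g t) z) y) ((\<lambda>(t, z). deriv (g t) z) x) < e"
    unfolding x
    using \<eta>(1) \<kappa>(1) d(1) by (intro exI[of _ "min \<eta> (min \<kappa> d)"]) auto
qed

text \<open>Differentiation under the integral sign asks for joint continuity of the complex
  derivative, which the preceding lemma extracts from joint continuity of \<open>g\<close>
  alone.\<close>

lemma holomorphic_on_integral:
  fixes g :: "real \<Rightarrow> complex \<Rightarrow> complex"
  assumes A: "open A" "convex A" and cont: "continuous_on ({a..b} \<times> A) (\<lambda>(t, z). g t z)"
    and hol: "\<And>t. t \<in> {a..b} \<Longrightarrow> g t holomorphic_on A"
  shows "(\<lambda>z. integral {a..b} (\<lambda>t. g t z)) holomorphic_on A"
proof -
  have "(\<lambda>z. integral (cbox a b) (\<lambda>t. g t z)) holomorphic_on A"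
  proof (rule leibniz_rule_holomorphic[where fx = "\<lambda>z t. deriv (g t) z"])
    show "((\<lambda>z. g t z) has_field_derivative deriv (g t) z) (at z within A)"
      if "z \<in> A" "t \<in> cbox a b" for z t
      using that hol A by (auto intro!: holomorphic_derivI)
    show "(\<lambda>t. g t z) integrable_on cbox a b" if "z \<in> A" for z
    proof -
      have "continuous_on {a..b} (\<lambda>t. (\<lambda>(t, z). g t z) (t, z))"
        by (rule continuous_on_compose2[OF cont]) (use that in \<open>auto intro!: continuous_intros\<close>)
      thus ?thesis using that by (simp add: integrable_continuous_real)
    qed
    show "continuous_on (A \<times> cbox a b) (\<lambda>(z, t). deriv (g t) z)"
    proof -
      have "continuous_on (A \<times> cbox a b) (\<lambda>x. (\<lambda>(t, z). deriv (g t) z) (snd x, fst x))"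
        by (rule continuous_on_compose2[OF continuous_on_deriv_parameter[OF A(1) cont hol]])
           (auto intro!: continuous_intros)
      thus ?thesis by (simp add: case_prod_beta)
    qed
  qed (use A in auto)
  thus ?thesis by simp
qed

text \<open>This serves the Picard iterates: they are holomorphic in the initial value for each
  \<open>t\<close> and Lipschitz in \<open>t\<close> uniformly in the initial value.\<close>

lemma continuous_on_separately_Lipschitz:
  fixes g :: "real \<Rightarrow> complex \<Rightarrow> complex"
  assumes cont: "\<And>t. t \<in> T \<Longrightarrow> continuous_on A (g t)"
    and lip: "\<And>z t t'. z \<in> A \<Longrightarrow> t \<in> T \<Longrightarrow> t' \<in> T \<Longrightarrow> norm (g t z - g t' z) \<le> C * \<bar>t - t'\<bar>"
  shows "continuous_on (T \<times> A) (\<lambda>(t, z). g t z)"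
  unfolding continuous_on_iff
proof (intro ballI allI impI)
  fix x and e :: real
  assume "x \<in> T \<times> A" and e: "0 < e"
  then obtain t0 z0 where x: "x = (t0, z0)" and t0: "t0 \<in> T" and z0: "z0 \<in> A" by auto
  define C' where "C' = \<bar>C\<bar> + 1"
  have C': "C' > 0" "\<And>x. C * \<bar>x\<bar> \<le> C' * \<bar>x\<bar>" by (auto simp: C'_def intro!: mult_right_mono)
  obtain \<kappa> where \<kappa>: "\<kappa> > 0" "\<And>z. z \<in> A \<Longrightarrow> dist z z0 < \<kappa> \<Longrightarrow> dist (g t0 z) (g t0 z0) < e / 2"
    using cont[OF t0] unfolding continuous_on_iff using z0 e by (metis half_gt_zero)
  have "dist (g t z) (g t0 z0) < e" if t: "t \<in> T" and z: "z \<in> A" and D: "dist (t, z) (t0, z0) < min \<kappa> (e / (2 * C'))" for t z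
  proof -
    have tz: "\<bar>t - t0\<bar> < e / (2 * C')" "dist z z0 < \<kappa>"
      using D dist_fst_le[of "(t,z)" "(t0,z0)"] dist_snd_le[of "(t,z)" "(t0,z0)"] by (auto simp: dist_real_def)
    have "norm (g t z - g t0 z) \<le> C' * \<bar>t - t0\<bar>" using lip[OF z t t0] C'(2) order_trans by blast
    also have "\<dots> < e / 2" using tz(1) C'(1) by (simp add: field_simps)
    finally show ?thesis using \<kappa>(2)[OF z tz(2)] dist_triangle[of "g t z" "g t0 z0" "g t0 z"]
      by (simp add: dist_norm)
  qed
  thus "\<exists>\<delta>>0. \<forall>y\<in>T \<times> A. dist y x < \<delta> \<longrightarrow> dist ((\<lambda>(t, z). g t z) y) ((\<lambda>(t, z). g t z) x) < e"
    unfolding x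
    using \<kappa>(1) e C'(1) by (intro exI[of _ "min \<kappa> (e / (2 * C'))"]) auto
qed

text \<open>\<open>A\<close> holds the initial values and \<open>B\<close> the solutions: the
  displacement bound keeps every iterate in \<open>B\<close>, and \<open>small\<close> makes
  consecutive iterates approach each other by a factor \<open>1 / 2\<close>. Convergence is
  therefore uniform, and a uniform limit of holomorphic functions of the initial value is
  holomorphic.\<close>

theorem holomorphic_Picard:
  fixes S :: "real \<Rightarrow> complex \<Rightarrow> complex" and \<epsilon> \<tau> :: real
  assumes A: "open A" "convex A" and d: "\<And>z w. z \<in> A \<Longrightarrow> norm (w - z) \<le> \<bar>\<epsilon>\<bar> * M * \<tau> \<Longrightarrow> w \<in> B"
    and cont: "continuous_on ({0..\<tau>} \<times> B) (\<lambda>(t, z). S t z)"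
    and hol: "\<And>t. t \<in> {0..\<tau>} \<Longrightarrow> S t holomorphic_on B"
    and bound: "\<And>t z. t \<in> {0..\<tau>} \<Longrightarrow> z \<in> B \<Longrightarrow> norm (S t z) \<le> M"
    and lip: "\<And>t z w. t \<in> {0..\<tau>} \<Longrightarrow> z \<in> B \<Longrightarrow> w \<in> B \<Longrightarrow> norm (S t z - S t w) \<le> L * norm (z - w)"
    and small: "\<bar>\<epsilon>\<bar> * L * \<tau> \<le> 1 / 2" and "0 \<le> \<tau>" "0 \<le> L" "0 \<le> M"
  obtains \<rho> :: "real \<Rightarrow> complex \<Rightarrow> complex" where
    "\<And>t z. t \<in> {0..\<tau>} \<Longrightarrow> z \<in> A \<Longrightarrow> norm (\<rho> t z - z) \<le> \<bar>\<epsilon>\<bar> * M * \<tau>"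
    "\<And>z. z \<in> A \<Longrightarrow> continuous_on {0..\<tau>} (\<lambda>t. \<rho> t z)"
    "\<And>t z. t \<in> {0..\<tau>} \<Longrightarrow> z \<in> A \<Longrightarrow> \<rho> t z = z + \<epsilon> * integral {0..t} (\<lambda>s. S s (\<rho> s z))"
    "\<And>t. t \<in> {0..\<tau>} \<Longrightarrow> \<rho> t holomorphic_on A"
    "\<And>t x. \<forall>t\<in>{0..\<tau>}. \<forall>x. S t (of_real x) \<in> \<real> \<Longrightarrow>
       t \<in> {0..\<tau>} \<Longrightarrow> of_real x \<in> A \<Longrightarrow> \<rho> t (of_real x) \<in> \<real>"
proof -
  define r where "r = rec_nat (\<lambda>t z. z) (\<lambda>n \<rho> t z. z + \<epsilon> * integral {0..t} (\<lambda>s. S s (\<rho> s z)))"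
  have r0: "r 0 t z = z" and rS: "r (Suc n) t z = z + \<epsilon> * integral {0..t} (\<lambda>s. S s (r n s z))" for n t z
    by (simp_all add: r_def)
  let ?T = "{0..\<tau>}"
  \<comment> \<open>Joint continuity is carried through the induction because the next iterate is
    holomorphic only as the integral of a jointly continuous family.\<close>
  have inv: "(\<forall>t\<in>?T. r n t holomorphic_on A) \<and> (\<forall>t\<in>?T. \<forall>z\<in>A. norm (r n t z - z) \<le> \<bar>\<epsilon>\<bar> * M * \<tau>)
     \<and> continuous_on (?T \<times> A) (\<lambda>(t, z). r n t z)" for n
  proof (induction n)
    case 0
    have "0 \<le> \<bar>\<epsilon>\<bar> * M * \<tau>" using assms by simp
    moreover have "continuous_on (?T \<times> A) (\<lambda>(t, z). z)" by (simp add: case_prod_beta continuous_on_snd)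
    ultimately show ?case unfolding r0 by (auto simp: holomorphic_on_ident r0[abs_def])
  next
    case (Suc n)
    have inB: "r n t z \<in> B" if "t \<in> ?T" "z \<in> A" for t z using Suc d that by blast
    have c: "continuous_on (?T \<times> A) (\<lambda>(t, z). S t (r n t z))"
    proof -
      have "continuous_on (?T \<times> A) (\<lambda>x. (\<lambda>(t, z). S t z) (fst x, (\<lambda>(t, z). r n t z) x))"
        by (rule continuous_on_compose2[OF cont])
           (use Suc inB in \<open>auto intro!: continuous_on_Pair continuous_on_fst continuous_on_id\<close>)
      thus ?thesis by (simp add: case_prod_beta)
    qed
    have h: "(\<lambda>z. S t (r n t z)) holomorphic_on A" if "t \<in> ?T" for t
      using holomorphic_on_compose_gen[of "r n t" A "S t" B] Suc hol[OF that] inB[OF that] that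
      by (auto simp: o_def)
    have ct: "continuous_on ?T (\<lambda>t. S t (r n t z))" if "z \<in> A" for z
    proof -
      have "continuous_on ?T (\<lambda>t. (\<lambda>(t, z). S t (r n t z)) (t, z))"
        by (rule continuous_on_compose2[OF c]) (use that in \<open>auto intro!: continuous_intros\<close>)
      thus ?thesis by simp
    qed
    have hol': "r (Suc n) t holomorphic_on A" if "t \<in> ?T" for t
    proof -
      have "(\<lambda>z. integral {0..t} (\<lambda>s. S s (r n s z))) holomorphic_on A"
        by (rule holomorphic_on_integral[OF A continuous_on_subset[OF c]]) (use h that in auto)
      thus ?thesis unfolding rS[abs_def] by (intro holomorphic_intros)
    qed
    have b: "norm (integral {s..t} (\<lambda>s. S s (r n s z))) \<le> M * (t - s)" if "0 \<le> s" "s \<le> t" "t \<le> \<tau>" "z \<in> A" for s t z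
      using that inB[of _ z] by (intro integral_bound continuous_on_subset[OF ct]) (auto intro!: bound)
    have L: "norm (r (Suc n) t z - r (Suc n) s z) \<le> \<bar>\<epsilon>\<bar> * M * \<bar>t - s\<bar>" if "s \<le> t" "s \<in> ?T" "t \<in> ?T" "z \<in> A" for s t z
    proof -
      have "integral {0..s} (\<lambda>s. S s (r n s z)) + integral {s..t} (\<lambda>s. S s (r n s z)) = integral {0..t} (\<lambda>s. S s (r n s z))"
        using that by (intro Henstock_Kurzweil_Integration.integral_combine integrable_continuous_real continuous_on_subset[OF ct]) auto
      hence "r (Suc n) t z - r (Suc n) s z = \<epsilon> * integral {s..t} (\<lambda>s. S s (r n s z))"
        unfolding rS by (simp add: algebra_simps flip: distrib_left)
      thus ?thesis using b[of s t z] that by (simp add: norm_mult mult.assoc mult_left_mono)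
    qed
    have "norm (r (Suc n) t z - r (Suc n) s z) \<le> \<bar>\<epsilon>\<bar> * M * \<bar>t - s\<bar>" if "s \<in> ?T" "t \<in> ?T" "z \<in> A" for s t z
      using L[of s t z] L[of t s z] that by (cases "s \<le> t") (auto simp: norm_minus_commute abs_minus_commute)
    hence "continuous_on (?T \<times> A) (\<lambda>(t, z). r (Suc n) t z)"
      using hol' by (intro continuous_on_separately_Lipschitz[where C = "\<bar>\<epsilon>\<bar> * M"]) (auto intro: holomorphic_on_imp_continuous_on)
    moreover have "norm (r (Suc n) t z - z) \<le> \<bar>\<epsilon>\<bar> * M * \<tau>" if "t \<in> ?T" "z \<in> A" for t z
    proof -
      have "norm (r (Suc n) t z - z) \<le> \<bar>\<epsilon>\<bar> * (M * t)"
        using b[of 0 t z] that unfolding rS by (simp add: norm_mult mult_left_mono)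
      also have "\<dots> \<le> \<bar>\<epsilon>\<bar> * M * \<tau>" using that assms by (simp add: mult.assoc mult_left_mono)
      finally show ?thesis .
    qed
    ultimately show ?case using hol' by blast
  qed
  have inB: "r n t z \<in> B" if "t \<in> ?T" "z \<in> A" for n t z using inv d that by blast
  have rc: "continuous_on ?T (\<lambda>t. r n t z)" if "z \<in> A" for n z
  proof -
    have "continuous_on ?T (\<lambda>t. (\<lambda>(t, z). r n t z) (t, z))"
      by (rule continuous_on_compose2[of "?T \<times> A"]) (use inv that in \<open>auto intro!: continuous_intros\<close>)
    thus ?thesis by simp
  qed
  have Sc: "continuous_on ?T (\<lambda>s. S s (f s))" if "continuous_on ?T f" "\<And>s. s \<in> ?T \<Longrightarrow> f s \<in> B" for f
  proof -
    have "continuous_on ?T (\<lambda>s. (\<lambda>(t, z). S t z) (s, f s))"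
      by (rule continuous_on_compose2[OF cont]) (use that in \<open>auto intro!: continuous_intros\<close>)
    thus ?thesis by simp
  qed
  define D where "D = \<bar>\<epsilon>\<bar> * M * \<tau>"
  have step: "norm (r (Suc n) t z - r n t z) \<le> D * (1/2) ^ n" if "t \<in> ?T" "z \<in> A" for n t z
    using that
  proof (induction n arbitrary: t)
    case 0 thus ?case using inv[of 1] by (simp add: r0 D_def)
  next
    case (Suc n)
    have I: "(\<lambda>s. S s (r n s z)) integrable_on {0..t}" for n
      using Suc.prems inB by (intro integrable_continuous_real continuous_on_subset[OF Sc[OF rc]]) auto
    have "r (Suc (Suc n)) t z - r (Suc n) t z
        = \<epsilon> * integral {0..t} (\<lambda>s. S s (r (Suc n) s z) - S s (r n s z))"
      unfolding rS[of "Suc n"] rS[of n t] using I by (simp add: integral_diff algebra_simps)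
    moreover have "norm (integral {0..t} (\<lambda>s. S s (r (Suc n) s z) - S s (r n s z))) \<le> (L * (D * (1/2)^n)) * (t - 0)"
    proof (rule integral_bound)
      show "continuous_on {0..t} (\<lambda>s. S s (r (Suc n) s z) - S s (r n s z))"
        using Suc.prems inB by (intro continuous_intros continuous_on_subset[OF Sc[OF rc]]) auto
      fix s assume s: "s \<in> {0..t}"
      have "norm (S s (r (Suc n) s z) - S s (r n s z)) \<le> L * norm (r (Suc n) s z - r n s z)"
        using s Suc.prems inB by (intro lip) auto
      also have "\<dots> \<le> L * (D * (1/2)^n)" using Suc.IH[of s] Suc.prems s assms by (intro mult_left_mono) auto
      finally show "norm (S s (r (Suc n) s z) - S s (r n s z)) \<le> L * (D * (1/2)^n)" .
    qed (use Suc.prems in auto)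
    ultimately have "norm (r (Suc (Suc n)) t z - r (Suc n) t z) \<le> \<bar>\<epsilon>\<bar> * ((L * (D * (1/2)^n)) * t)"
      by (simp add: norm_mult mult_left_mono)
    also have "\<dots> \<le> \<bar>\<epsilon>\<bar> * ((L * (D * (1/2)^n)) * \<tau>)"
      using Suc.prems assms by (intro mult_left_mono mult_nonneg_nonneg) (auto simp: D_def)
    also have "\<dots> = (\<bar>\<epsilon>\<bar> * L * \<tau>) * (D * (1/2)^n)" by simp
    also have "\<dots> \<le> 1/2 * (D * (1/2)^n)" using assms by (intro mult_right_mono small) (auto simp: D_def)
    finally show ?case by simp
  qed
  \<comment> \<open>Writing the limit as a telescoping series lets the geometric bound
    \<open>step\<close> give convergence uniform in time and initial value together.\<close>
  define \<rho> where "\<rho> t z = z + (\<Sum>n. r (Suc n) t z - r n t z)" for t z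
  have tel: "(\<Sum>i<n. r (Suc i) t z - r i t z) = r n t z - z" for n t z
    by (induction n) (simp_all add: r0)
  have "uniform_limit (?T \<times> A) (\<lambda>n x. \<Sum>i<n. r (Suc i) (fst x) (snd x) - r i (fst x) (snd x))
      (\<lambda>x. \<Sum>n. r (Suc n) (fst x) (snd x) - r n (fst x) (snd x)) sequentially"
    by (rule Weierstrass_m_test[where M = "\<lambda>n. D * (1/2)^n"]) (use step in \<open>auto intro!: summable_mult summable_geometric\<close>)
  hence "uniform_limit (?T \<times> A) (\<lambda>n x. snd x + (r n (fst x) (snd x) - snd x)) (\<lambda>x. \<rho> (fst x) (snd x)) sequentially"
    unfolding tel \<rho>_def by (intro uniform_limit_intros)
  hence ul: "uniform_limit (?T \<times> A) (\<lambda>n x. r n (fst x) (snd x)) (\<lambda>x. \<rho> (fst x) (snd x)) sequentially"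
    by simp
  have ulz: "uniform_limit A (\<lambda>n z. r n t z) (\<rho> t) sequentially" if "t \<in> ?T" for t
    by (rule uniform_limitI) (drule uniform_limitD[OF ul], use that in \<open>auto elim!: eventually_mono\<close>)
  have ult: "uniform_limit ?T (\<lambda>n t. r n t z) (\<lambda>t. \<rho> t z) sequentially" if "z \<in> A" for z
    by (rule uniform_limitI) (drule uniform_limitD[OF ul], use that in \<open>auto elim!: eventually_mono\<close>)
  have lim: "(\<lambda>n. r n t z) \<longlonglongrightarrow> \<rho> t z" if "t \<in> ?T" "z \<in> A" for t z
    using tendsto_uniform_limitI[OF ulz[OF that(1)] that(2)] .
  have 1: "norm (\<rho> t z - z) \<le> \<bar>\<epsilon>\<bar> * M * \<tau>" if "t \<in> ?T" "z \<in> A" for t z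
    by (rule LIMSEQ_le_const2[OF tendsto_norm[OF tendsto_diff[OF lim[OF that] tendsto_const]]])
       (use inv that in blast)
  have 2: "continuous_on ?T (\<lambda>t. \<rho> t z)" if "z \<in> A" for z
    by (rule uniform_limit_theorem[OF _ ult[OF that]]) (use rc that in auto)
  have \<rho>B: "\<rho> t z \<in> B" if "t \<in> ?T" "z \<in> A" for t z using 1 d that by blast
  have 3: "\<rho> t z = z + \<epsilon> * integral {0..t} (\<lambda>s. S s (\<rho> s z))" if t: "t \<in> ?T" and z: "z \<in> A" for t z
  proof -
    have "uniform_limit {0..t} (\<lambda>n s. S s (r n s z)) (\<lambda>s. S s (\<rho> s z)) sequentially"
    proof (rule uniform_limitI)
      fix e :: real assume e: "0 < e"
      \<comment> \<open>The denominator \<open>L + 1\<close> is positive even when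
        \<open>L = 0\<close>.\<close>
      have "eventually (\<lambda>n. \<forall>s\<in>?T. dist (r n s z) (\<rho> s z) < e / (L + 1)) sequentially"
        using ult[OF z] e assms by (intro uniform_limitD) auto
      thus "eventually (\<lambda>n. \<forall>s\<in>{0..t}. dist (S s (r n s z)) (S s (\<rho> s z)) < e) sequentially"
      proof eventually_elim
        case (elim n)
        show ?case
        proof
          fix s assume s: "s \<in> {0..t}"
          hence sT: "s \<in> ?T" using t by auto
          have "norm (S s (r n s z) - S s (\<rho> s z)) \<le> L * norm (r n s z - \<rho> s z)"
            using inB[OF sT z] \<rho>B[OF sT z] sT by (intro lip)
          also have "\<dots> \<le> L * (e / (L + 1))"
            using elim sT assms by (intro mult_left_mono) (auto simp: dist_norm less_imp_le)
          also have "\<dots> < e" using e assms by (simp add: field_simps)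
          finally show "dist (S s (r n s z)) (S s (\<rho> s z)) < e" by (simp add: dist_norm)
        qed
      qed
    qed
    then obtain I J where IJ: "\<And>n. ((\<lambda>s. S s (r n s z)) has_integral I n) {0..t}"
        "((\<lambda>s. S s (\<rho> s z)) has_integral J) {0..t}" "I \<longlonglongrightarrow> J"
    proof (rule uniform_limit_integral)
      show "continuous_on {0..t} (\<lambda>s. S s (r n s z))" for n
        using t z inB by (intro continuous_on_subset[OF Sc[OF rc]]) auto
    qed auto
    have "(\<lambda>n. z + \<epsilon> * I n) \<longlonglongrightarrow> z + \<epsilon> * J" by (intro tendsto_intros IJ)
    moreover have "(\<lambda>n. r (Suc n) t z) = (\<lambda>n. z + \<epsilon> * I n)"
      by (simp add: rS integral_unique[OF IJ(1)])
    ultimately have "\<rho> t z = z + \<epsilon> * J"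
      using LIMSEQ_unique LIMSEQ_Suc[OF lim[OF t z]] by metis
    thus ?thesis using IJ(2) by (simp add: integral_unique)
  qed
  have 4: "\<rho> t holomorphic_on A" if t: "t \<in> ?T" for t
  proof (rule holomorphic_uniform_sequence[OF A(1), of "\<lambda>n. r n t"])
    show "r n t holomorphic_on A" for n using inv t by blast
    fix x assume "x \<in> A"
    then obtain e where e: "e > 0" "cball x e \<subseteq> A" using A(1) open_contains_cball_eq by blast
    thus "\<exists>d>0. cball x d \<subseteq> A \<and> uniform_limit (cball x d) (\<lambda>n. r n t) (\<rho> t) sequentially"
      using uniform_limit_on_subset[OF ulz[OF t]] by blast
  qed
  \<comment> \<open>Real integrands have real integrals, so all iterates are real at real points;
    the real line is closed, so the limit is real too.\<close>
  have 5: "\<rho> t (of_real x) \<in> \<real>"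
    if S: "\<forall>t\<in>?T. \<forall>x. S t (of_real x) \<in> \<real>" and "t \<in> ?T" "of_real x \<in> A" for t x
  proof -
    have "r n t (of_real x) \<in> \<real>" if "t \<in> ?T" for n t
      using that
    proof (induction n arbitrary: t)
      case (Suc n)
      have "S s (r n s (of_real x)) \<in> \<real>" if "s \<in> {0..t}" for s
        using Suc.IH[of s] Suc.prems S that by (force elim!: Reals_cases)
      hence "integral {0..t} (\<lambda>s. Im (S s (r n s (of_real x)))) = integral {0..t} (\<lambda>s. 0)"
        by (intro Henstock_Kurzweil_Integration.integral_cong) (simp add: complex_is_Real_iff)
      moreover have "(\<lambda>s. S s (r n s (of_real x))) integrable_on {0..t}"
        using Suc.prems inB \<open>of_real x \<in> A\<close>
        by (intro integrable_continuous_real continuous_on_subset[OF Sc[OF rc]]) auto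
      ultimately have "Im (integral {0..t} (\<lambda>s. S s (r n s (of_real x)))) = 0"
        using integral_linear[OF _ bounded_linear_Im, of "\<lambda>s. S s (r n s (of_real x))" "{0..t}"]
        by (simp add: o_def)
      thus ?case unfolding rS by (simp add: complex_is_Real_iff)
    qed (simp add: r0)
    thus ?thesis using closed_sequentially[OF closed_complex_Reals _ lim] that by blast
  qed
  show ?thesis using that[OF 1 2 3 4 5] by blast
qed

section \<open>The flow in a half-plane as a scalar equation\<close>

text \<open>Rectangles are open and convex, and moving a point by \<open>e\<close> just adds
  \<open>e\<close> to the width, so that nested margins are easy to budget.\<close>

definition box_nbhd :: "real \<Rightarrow> real \<Rightarrow> real \<Rightarrow> complex set" where
  "box_nbhd r\<^sub>1 r\<^sub>2 d = {z. r\<^sub>1 - d < Re z \<and> Re z < r\<^sub>2 + d \<and> \<bar>Im z\<bar> < d}"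

lemma box_nbhd_eq: "box_nbhd r\<^sub>1 r\<^sub>2 d = box (Complex (r\<^sub>1 - d) (- d)) (Complex (r\<^sub>2 + d) d)"
  by (auto simp: box_nbhd_def box_def Basis_complex_def)

lemma open_box_nbhd: "open (box_nbhd r\<^sub>1 r\<^sub>2 d)"
  and convex_box_nbhd: "convex (box_nbhd r\<^sub>1 r\<^sub>2 d)"
  by (simp_all add: box_nbhd_eq open_box convex_box)

lemma box_nbhd_step:
  assumes "z \<in> box_nbhd r\<^sub>1 r\<^sub>2 d" "norm (w - z) \<le> e" shows "w \<in> box_nbhd r\<^sub>1 r\<^sub>2 (d + e)"
  using assms abs_Re_le_cmod[of "w - z"] abs_Im_le_cmod[of "w - z"] by (auto simp: box_nbhd_def)

lemma box_nbhd_mono: "d \<le> e \<Longrightarrow> box_nbhd r\<^sub>1 r\<^sub>2 d \<subseteq> box_nbhd r\<^sub>1 r\<^sub>2 e"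
  by (auto simp: box_nbhd_def)

lemma of_real_in_box_nbhd: "of_real x \<in> box_nbhd r\<^sub>1 r\<^sub>2 d \<longleftrightarrow> r\<^sub>1 - d < x \<and> x < r\<^sub>2 + d \<and> 0 < d"
  by (auto simp: box_nbhd_def)

definition cubicC :: "(nat \<Rightarrow> nat \<Rightarrow> real) \<Rightarrow> complex \<Rightarrow> complex \<Rightarrow> complex" where
  "cubicC c x y = (\<Sum>i\<le>3. \<Sum>j\<le>3 - i. of_real (c i j) * x ^ i * y ^ j)"

lemma cubicC_of_real: "cubicC c (of_real x) (of_real y) = of_real (cubic c x y)"
  by (simp add: cubicC_def cubic_def)

definition cubic_bound :: "(nat \<Rightarrow> nat \<Rightarrow> real) \<Rightarrow> real \<Rightarrow> real" where
  "cubic_bound c b = (\<Sum>i\<le>3. \<Sum>j\<le>3 - i. \<bar>c i j\<bar> * b ^ i * b ^ j)"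

lemma cubicC_le_bound:
  assumes "norm x \<le> b" "norm y \<le> b" shows "norm (cubicC c x y) \<le> cubic_bound c b"
proof -
  have "0 \<le> b" using assms(1) norm_ge_zero order_trans by blast
  thus ?thesis unfolding cubicC_def cubic_bound_def
    by (intro sum_norm_le) (auto simp: norm_mult norm_power intro!: mult_mono power_mono assms)
qed

lemma cubic_bound_nonneg: "0 \<le> b \<Longrightarrow> 0 \<le> cubic_bound c b"
  unfolding cubic_bound_def by (intro sum_nonneg) auto

text \<open>In polar coordinates the perturbed field reads \<open>r' = \<epsilon> * radial\<close>
  and \<open>\<theta>' = angular\<close>; dividing the two gives the scalar equation.\<close>

definition radial :: "(nat \<Rightarrow> nat \<Rightarrow> real) \<Rightarrow> (nat \<Rightarrow> nat \<Rightarrow> real) \<Rightarrow> real \<Rightarrow> real \<Rightarrow> real" where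
  "radial p q \<theta> r = cos \<theta> * cubic p (r * cos \<theta>) (r * sin \<theta>) + sin \<theta> * cubic q (r * cos \<theta>) (r * sin \<theta>)"

definition angular :: "(nat \<Rightarrow> nat \<Rightarrow> real) \<Rightarrow> (nat \<Rightarrow> nat \<Rightarrow> real) \<Rightarrow> real \<Rightarrow> real \<Rightarrow> real \<Rightarrow> real" where
  "angular p q \<epsilon> \<theta> r = r\<^sup>2 * (cos \<theta>)\<^sup>2 + 1
     + \<epsilon> * (cos \<theta> * cubic q (r * cos \<theta>) (r * sin \<theta>) - sin \<theta> * cubic p (r * cos \<theta>) (r * sin \<theta>)) / r"

definition radialC :: "(nat \<Rightarrow> nat \<Rightarrow> real) \<Rightarrow> (nat \<Rightarrow> nat \<Rightarrow> real) \<Rightarrow> real \<Rightarrow> complex \<Rightarrow> complex" where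
  "radialC p q \<theta> z = of_real (cos \<theta>) * cubicC p (z * of_real (cos \<theta>)) (z * of_real (sin \<theta>))
     + of_real (sin \<theta>) * cubicC q (z * of_real (cos \<theta>)) (z * of_real (sin \<theta>))"

definition angularC :: "(nat \<Rightarrow> nat \<Rightarrow> real) \<Rightarrow> (nat \<Rightarrow> nat \<Rightarrow> real) \<Rightarrow> real \<Rightarrow> real \<Rightarrow> complex \<Rightarrow> complex" where
  "angularC p q \<epsilon> \<theta> z = z\<^sup>2 * of_real ((cos \<theta>)\<^sup>2) + 1
     + of_real \<epsilon> * (of_real (cos \<theta>) * cubicC q (z * of_real (cos \<theta>)) (z * of_real (sin \<theta>))
                    - of_real (sin \<theta>) * cubicC p (z * of_real (cos \<theta>)) (z * of_real (sin \<theta>))) / z"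

lemma radialC_of_real: "radialC p q \<theta> (of_real r) = of_real (radial p q \<theta> r)"
  by (simp add: radialC_def radial_def flip: cubicC_of_real)

lemma angularC_of_real: "angularC p q \<epsilon> \<theta> (of_real r) = of_real (angular p q \<epsilon> \<theta> r)"
  by (simp add: angularC_def angular_def flip: cubicC_of_real)

definition slopeC :: "(nat \<Rightarrow> nat \<Rightarrow> real) \<Rightarrow> (nat \<Rightarrow> nat \<Rightarrow> real) \<Rightarrow> real \<Rightarrow> real \<Rightarrow> complex \<Rightarrow> complex" where
  "slopeC p q \<epsilon> \<theta> z = radialC p q \<theta> z / angularC p q \<epsilon> \<theta> z"

text \<open>The upper half-plane's share of the average function, continued to complex radii; at
  \<open>\<epsilon> = 0\<close> the denominator is the one in \<open>polar_F\<close>. The lower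
  share is the same expression for rotated coefficients.\<close>

definition half_average :: "(nat \<Rightarrow> nat \<Rightarrow> real) \<Rightarrow> (nat \<Rightarrow> nat \<Rightarrow> real) \<Rightarrow> complex \<Rightarrow> complex" where
  "half_average p q z = integral {0..pi} (\<lambda>\<theta>. slopeC p q 0 \<theta> z)"

lemma holomorphic_radialC: "radialC p q \<theta> holomorphic_on B"
  unfolding radialC_def cubicC_def by (intro holomorphic_intros)

lemma holomorphic_angularC: "0 \<notin> B \<Longrightarrow> angularC p q \<epsilon> \<theta> holomorphic_on B"
  unfolding angularC_def cubicC_def by (intro holomorphic_intros) auto

lemma continuous_on_radialC: "continuous_on X (\<lambda>(t, z). radialC p q t z)"
  unfolding radialC_def cubicC_def case_prod_beta by (intro continuous_intros)

lemma continuous_on_angularC: "0 \<notin> B \<Longrightarrow> continuous_on (T \<times> B) (\<lambda>(t, z). angularC p q \<epsilon> t z)"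
  unfolding angularC_def cubicC_def case_prod_beta by (intro continuous_intros) auto

text \<open>Cauchy's estimate on discs of radius \<open>d\<close> bounds the derivative by
  \<open>M / d\<close>, and convexity of \<open>A\<close> turns this into a Lipschitz
  constant.\<close>

lemma bounded_holomorphic_Lipschitz:
  assumes hol: "f holomorphic_on B" and bound: "\<And>z. z \<in> B \<Longrightarrow> norm (f z) \<le> M"
    and A: "convex A" "\<And>z. z \<in> A \<Longrightarrow> cball z d \<subseteq> B" and "d > 0" and B: "open B"
    and zw: "z \<in> A" "w \<in> A"
  shows "norm (f z - f w) \<le> M / d * norm (z - w)"
proof (rule field_differentiable_bound[OF A(1) _ _ zw])
  fix z assume z: "z \<in> A"
  have zB: "z \<in> B" using A(2)[OF z] \<open>d > 0\<close> by auto
  show "(f has_field_derivative deriv f z) (at z within A)"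
    using holomorphic_derivI[OF hol B zB] by blast
  have "norm ((deriv ^^ 1) f z) \<le> fact 1 * M / d ^ 1"
  proof (rule Cauchy_inequality)
    have h: "f holomorphic_on cball z d" by (rule holomorphic_on_subset[OF hol A(2)[OF z]])
    show "f holomorphic_on ball z d" by (rule holomorphic_on_subset[OF h ball_subset_cball])
    show "continuous_on (cball z d) f" by (rule holomorphic_on_imp_continuous_on[OF h])
    show "norm (f x) \<le> M" if "norm (z - x) = d" for x
      by (rule bound, rule subsetD[OF A(2)[OF z]]) (simp add: dist_norm that)
  qed fact
  thus "norm (deriv f z) \<le> M / d" by simp
qed

lemma polar_bounds:
  fixes b \<theta> :: real
  assumes "norm z \<le> b"
  shows "norm (radialC p q \<theta> z) \<le> cubic_bound p b + cubic_bound q b"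
    and "norm (of_real (cos \<theta>) * cubicC q (z * of_real (cos \<theta>)) (z * of_real (sin \<theta>))
           - of_real (sin \<theta>) * cubicC p (z * of_real (cos \<theta>)) (z * of_real (sin \<theta>)))
         \<le> cubic_bound p b + cubic_bound q b"
proof -
  have b: "norm (z * of_real (cos \<theta>)) \<le> b" "norm (z * of_real (sin \<theta>)) \<le> b"
    using assms mult_mono[OF assms abs_cos_le_one[of \<theta>]] mult_mono[OF assms abs_sin_le_one[of \<theta>]]
      order_trans[OF norm_ge_zero assms]
    by (simp_all add: norm_mult)
  have c: "norm (of_real u * cubicC c (z * of_real (cos \<theta>)) (z * of_real (sin \<theta>))) \<le> cubic_bound c b" if "\<bar>u\<bar> \<le> 1" for u c
    using mult_mono[OF that cubicC_le_bound[OF b, of c]] by (simp add: norm_mult)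
  show "norm (radialC p q \<theta> z) \<le> cubic_bound p b + cubic_bound q b"
    unfolding radialC_def by (intro norm_triangle_le add_mono c) auto
  show "norm (of_real (cos \<theta>) * cubicC q (z * of_real (cos \<theta>)) (z * of_real (sin \<theta>))
           - of_real (sin \<theta>) * cubicC p (z * of_real (cos \<theta>)) (z * of_real (sin \<theta>)))
         \<le> cubic_bound p b + cubic_bound q b"
    using norm_triangle_le_diff[OF add_mono[OF c[of "cos \<theta>" q] c[of "sin \<theta>" p]]] by simp
qed

text \<open>In this sector \<open>z\<^sup>2\<close> has nonnegative real part. This is what limits
  the width of the complex neighbourhood: points of width \<open>r\<^sub>1 / 2\<close> around the
  interval still lie in the sector.\<close>

lemma Re_polar_denominator:
  assumes "\<bar>Im z\<bar> \<le> Re z" shows "1 \<le> norm (z\<^sup>2 * of_real ((cos \<theta>)\<^sup>2) + 1)"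
proof -
  have "(Im z)\<^sup>2 \<le> (Re z)\<^sup>2" using assms by (metis abs_le_square_iff abs_of_nonneg abs_ge_zero order_trans)
  hence "0 \<le> ((Re z)\<^sup>2 - (Im z)\<^sup>2) * (cos \<theta>)\<^sup>2" by simp
  hence "1 \<le> Re (z\<^sup>2 * of_real ((cos \<theta>)\<^sup>2) + 1)"
    by (simp add: power2_eq_square Re_power2)
  thus ?thesis using complex_Re_le_cmod order_trans by blast
qed

text \<open>\<open>R \<theta> z\<close> is the solution with initial value \<open>z\<close>. The initial values fill the neighbourhood of width
  \<open>r\<^sub>1 / 4\<close>, the solutions stay in the one of width \<open>3 r\<^sub>1 / 8\<close>, and the equation is holomorphic on
  the one of width \<open>r\<^sub>1 / 2\<close>; the margins \<open>r\<^sub>1 / 8\<close> feed Cauchy's estimates.\<close>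

locale half_flow =
  fixes p q :: "nat \<Rightarrow> nat \<Rightarrow> real" and r\<^sub>1 r\<^sub>2 \<epsilon> C :: real and R :: "real \<Rightarrow> complex \<Rightarrow> complex"
  assumes radii: "0 < r\<^sub>1" "r\<^sub>1 < r\<^sub>2"
    and angular_ge: "\<And>\<theta> r. r\<^sub>1 / 2 < r \<Longrightarrow> r < r\<^sub>2 + r\<^sub>1 / 2 \<Longrightarrow> 1 / 2 \<le> angular p q \<epsilon> \<theta> r"
    and slope_lip: "\<And>\<theta> z w. \<theta> \<in> {0..pi} \<Longrightarrow> z \<in> box_nbhd r\<^sub>1 r\<^sub>2 (3 * r\<^sub>1 / 8) \<Longrightarrow> w \<in> box_nbhd r\<^sub>1 r\<^sub>2 (3 * r\<^sub>1 / 8) \<Longrightarrow>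
       \<bar>\<epsilon>\<bar> * pi * norm (slopeC p q \<epsilon> \<theta> z - slopeC p q \<epsilon> \<theta> w) \<le> norm (z - w) / 2"
    and R_near: "\<And>\<theta> z. \<theta> \<in> {0..pi} \<Longrightarrow> z \<in> box_nbhd r\<^sub>1 r\<^sub>2 (r\<^sub>1 / 4) \<Longrightarrow> norm (R \<theta> z - z) \<le> C * \<bar>\<epsilon>\<bar>"
    and C_small: "0 \<le> C" "C * \<bar>\<epsilon>\<bar> \<le> r\<^sub>1 / 8"
    and R_cont: "\<And>z. z \<in> box_nbhd r\<^sub>1 r\<^sub>2 (r\<^sub>1 / 4) \<Longrightarrow> continuous_on {0..pi} (\<lambda>\<theta>. R \<theta> z)"
    and R_eq: "\<And>\<theta> z. \<theta> \<in> {0..pi} \<Longrightarrow> z \<in> box_nbhd r\<^sub>1 r\<^sub>2 (r\<^sub>1 / 4) \<Longrightarrow>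
       R \<theta> z = z + \<epsilon> * integral {0..\<theta>} (\<lambda>s. slopeC p q \<epsilon> s (R s z))"
    and R_hol: "R pi holomorphic_on box_nbhd r\<^sub>1 r\<^sub>2 (r\<^sub>1 / 4)"
    and R_real: "\<And>\<theta> x. \<theta> \<in> {0..pi} \<Longrightarrow> of_real x \<in> box_nbhd r\<^sub>1 r\<^sub>2 (r\<^sub>1 / 4) \<Longrightarrow> R \<theta> (of_real x) \<in> \<real>"
    and R_average: "\<And>z. z \<in> box_nbhd r\<^sub>1 r\<^sub>2 (r\<^sub>1 / 4) \<Longrightarrow>
       norm (R pi z - z - \<epsilon> * half_average p q z) \<le> C * \<epsilon>\<^sup>2"
    and half_average_hol: "half_average p q holomorphic_on box_nbhd r\<^sub>1 r\<^sub>2 (r\<^sub>1 / 4)"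
    and half_average_bound: "\<And>z. z \<in> box_nbhd r\<^sub>1 r\<^sub>2 (r\<^sub>1 / 4) \<Longrightarrow> norm (half_average p q z) \<le> C"

text \<open>The constant \<open>C\<close> is chosen before \<open>\<epsilon>\<close>, so that all
  later error terms are uniform as \<open>\<epsilon>\<close> tends to \<open>0\<close>.\<close>

theorem half_flow_exists:
  assumes r: "0 < r\<^sub>1" "r\<^sub>1 < r\<^sub>2"
  shows "\<exists>\<epsilon>\<^sub>0>0. \<exists>C. \<forall>\<epsilon>. \<bar>\<epsilon>\<bar> < \<epsilon>\<^sub>0 \<longrightarrow> (\<exists>R. half_flow p q r\<^sub>1 r\<^sub>2 \<epsilon> C R)"
proof -
  define K where "K = cubic_bound p (2 * r\<^sub>2) + cubic_bound q (2 * r\<^sub>2) + 1"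
  define d where "d = r\<^sub>1 / 8"
  define L where "L = 2 * K / d"
  have K: "K \<ge> 1" using r by (simp add: K_def cubic_bound_nonneg)
  have d: "d > 0" using r by (simp add: d_def)
  have L: "L > 0" using K d by (simp add: L_def)
  let ?B = "\<lambda>k. box_nbhd r\<^sub>1 r\<^sub>2 k"
  \<comment> \<open>The first summand bounds the displacement, as the slope is at most
    \<open>2 * K\<close>. The second bounds the error of averaging: \<open>L\<close> times the
    displacement for replacing the solution by its initial value, and
    \<open>4 * K * K / r\<^sub>1\<close> for replacing \<open>\<epsilon>\<close> by \<open>0\<close>
    in the denominator.\<close>
  define C where "C = 2 * K * pi + (L * (2 * K * pi) + 4 * K * K / r\<^sub>1) * pi"
  have C1: "2 * K * pi \<le> C" and C2: "(L * (2 * K * pi) + 4 * K * K / r\<^sub>1) * pi \<le> C"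
    using r K L by (auto simp: C_def)
  have C: "C > 0" using C1 K by (smt (verit) mult_pos_pos pi_gt_zero)
  \<comment> \<open>The three entries ensure in turn that the perturbation of the denominator is at
    most \<open>1 / 2\<close>, that solutions move by at most the margin \<open>d\<close>, and that
    the Picard iteration contracts.\<close>
  define \<epsilon>\<^sub>0 where "\<epsilon>\<^sub>0 = Min {r\<^sub>1 / (4 * K), d / C, 1 / (2 * L * pi)}"
  have \<epsilon>\<^sub>0: "\<epsilon>\<^sub>0 > 0" using r K d L C by (simp add: \<epsilon>\<^sub>0_def)
  have B4: "norm z \<le> 2 * r\<^sub>2" "\<bar>Im z\<bar> \<le> Re z" "r\<^sub>1 / 2 \<le> norm z" if "z \<in> ?B (4 * d)" for z
  proof -
    show 1: "norm z \<le> 2 * r\<^sub>2" using that r cmod_le[of z] by (auto simp: box_nbhd_def d_def)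
    show 2: "\<bar>Im z\<bar> \<le> Re z" using that r by (auto simp: box_nbhd_def d_def)
    show 3: "r\<^sub>1 / 2 \<le> norm z" using that r complex_Re_le_cmod[of z] by (auto simp: box_nbhd_def d_def)
  qed
  have 0: "0 \<notin> ?B (4 * d)" using B4(3)[of 0] r by auto
  have e1: "\<bar>\<epsilon>\<bar> * K / (r\<^sub>1 / 2) \<le> 1 / 2" and e2: "C * \<bar>\<epsilon>\<bar> \<le> d" and e3: "\<bar>\<epsilon>\<bar> * L * pi \<le> 1 / 2"
    if "\<bar>\<epsilon>\<bar> < \<epsilon>\<^sub>0" for \<epsilon>
    using that r K d L C by (auto simp: \<epsilon>\<^sub>0_def field_simps)
  have N: "norm (radialC p q \<theta> z) \<le> K" if "z \<in> ?B (4 * d)" for z \<theta>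
    using polar_bounds(1)[OF B4(1)[OF that], of p q \<theta>] by (simp add: K_def)
  have D: "norm (angularC p q \<epsilon> \<theta> z - angularC p q 0 \<theta> z) \<le> \<bar>\<epsilon>\<bar> * K / (r\<^sub>1 / 2)" if z: "z \<in> ?B (4 * d)" for z \<theta> \<epsilon>
  proof -
    let ?V = "of_real (cos \<theta>) * cubicC q (z * of_real (cos \<theta>)) (z * of_real (sin \<theta>))
           - of_real (sin \<theta>) * cubicC p (z * of_real (cos \<theta>)) (z * of_real (sin \<theta>))"
    have "angularC p q \<epsilon> \<theta> z - angularC p q 0 \<theta> z = of_real \<epsilon> * ?V / z" by (simp add: angularC_def)
    moreover have "norm ?V \<le> K" using polar_bounds(2)[OF B4(1)[OF z], of \<theta> q p] by (simp add: K_def)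
    moreover have "norm (of_real \<epsilon> * ?V / z) = \<bar>\<epsilon>\<bar> * norm ?V / norm z"
      by (simp only: norm_mult norm_divide norm_of_real)
    moreover have "\<bar>\<epsilon>\<bar> * norm ?V / norm z \<le> \<bar>\<epsilon>\<bar> * K / (r\<^sub>1 / 2)"
      using calculation(2) B4(3)[OF z] r K by (intro frac_le mult_left_mono) auto
    ultimately show ?thesis by (simp only:)
  qed
  have W0: "1 \<le> norm (angularC p q 0 \<theta> z)" if "z \<in> ?B (4 * d)" for z \<theta>
    using Re_polar_denominator[OF B4(2)[OF that], of \<theta>] by (simp add: angularC_def)
  have W: "1 / 2 \<le> norm (angularC p q \<epsilon> \<theta> z)" if "\<bar>\<epsilon>\<bar> < \<epsilon>\<^sub>0" "z \<in> ?B (4 * d)" for z \<theta> \<epsilon>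
    using D[OF that(2), of \<epsilon> \<theta>] W0[OF that(2), of \<theta>] e1[OF that(1)]
      norm_triangle_ineq2[of "angularC p q 0 \<theta> z" "angularC p q \<epsilon> \<theta> z"]
    by (simp add: norm_minus_commute)
  have Wn: "angularC p q \<epsilon> \<theta> z \<noteq> 0" if "\<bar>\<epsilon>\<bar> < \<epsilon>\<^sub>0" "z \<in> ?B (4 * d)" for z \<theta> \<epsilon>
    using W[OF that, of \<theta>] by auto
  have S: "norm (slopeC p q \<epsilon> \<theta> z) \<le> 2 * K" if "\<bar>\<epsilon>\<bar> < \<epsilon>\<^sub>0" "z \<in> ?B (4 * d)" for z \<theta> \<epsilon>
  proof -
    have "norm (slopeC p q \<epsilon> \<theta> z) \<le> K / (1 / 2)"
      unfolding slopeC_def norm_divide by (intro frac_le N W that) (use K in auto)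
    thus ?thesis by simp
  qed
  have hol: "slopeC p q \<epsilon> \<theta> holomorphic_on ?B (4 * d)" if "\<bar>\<epsilon>\<bar> < \<epsilon>\<^sub>0" for \<theta> \<epsilon>
    unfolding slopeC_def[abs_def] using Wn[OF that]
    by (intro holomorphic_on_divide holomorphic_radialC holomorphic_angularC[OF 0])
  have cont: "continuous_on (T \<times> ?B (4 * d)) (\<lambda>(t, z). slopeC p q \<epsilon> t z)" if "\<bar>\<epsilon>\<bar> < \<epsilon>\<^sub>0" for T \<epsilon>
  proof -
    have "continuous_on (T \<times> ?B (4 * d)) (\<lambda>x. (\<lambda>(t, z). radialC p q t z) x / (\<lambda>(t, z). angularC p q \<epsilon> t z) x)"
      using Wn[OF that] by (intro continuous_on_divide continuous_on_radialC continuous_on_angularC 0) auto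
    thus ?thesis by (simp add: slopeC_def case_prod_beta)
  qed
  have lip: "norm (slopeC p q \<epsilon> \<theta> z - slopeC p q \<epsilon> \<theta> w) \<le> L * norm (z - w)"
    if "\<bar>\<epsilon>\<bar> < \<epsilon>\<^sub>0" "z \<in> ?B (3 * d)" "w \<in> ?B (3 * d)" for z w \<theta> \<epsilon>
    unfolding L_def
  proof (rule bounded_holomorphic_Lipschitz[OF hol[OF that(1)] S[OF that(1)] convex_box_nbhd _ d open_box_nbhd that(2,3)])
    show "cball z d \<subseteq> ?B (4 * d)" if "z \<in> ?B (3 * d)" for z
      using box_nbhd_step[OF that, of _ d] by (auto simp: dist_norm norm_minus_commute)
  qed
  have B23: "?B (2 * d) \<subseteq> ?B (4 * d)" "?B (3 * d) \<subseteq> ?B (4 * d)" "?B (2 * d) \<subseteq> ?B (3 * d)"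
    using d by (auto intro!: box_nbhd_mono)
  have d': "r\<^sub>1 / 4 = 2 * d" "3 * r\<^sub>1 / 8 = 3 * d" "r\<^sub>1 / 8 = d" by (auto simp: d_def)
  have "\<exists>R. half_flow p q r\<^sub>1 r\<^sub>2 \<epsilon> C R" if \<epsilon>: "\<bar>\<epsilon>\<bar> < \<epsilon>\<^sub>0" for \<epsilon>
  proof -
    have small: "\<bar>\<epsilon>\<bar> * (2 * K) * pi \<le> C * \<bar>\<epsilon>\<bar>"
      using mult_left_mono[OF C1, of "\<bar>\<epsilon>\<bar>"] by (simp add: mult_ac)
    obtain R where R: "\<And>t z. t \<in> {0..pi} \<Longrightarrow> z \<in> ?B (2*d) \<Longrightarrow> norm (R t z - z) \<le> \<bar>\<epsilon>\<bar> * (2 * K) * pi"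
      "\<And>z. z \<in> ?B (2*d) \<Longrightarrow> continuous_on {0..pi} (\<lambda>t. R t z)"
      "\<And>t z. t \<in> {0..pi} \<Longrightarrow> z \<in> ?B (2*d) \<Longrightarrow> R t z = z + \<epsilon> * integral {0..t} (\<lambda>s. slopeC p q \<epsilon> s (R s z))"
      "\<And>t. t \<in> {0..pi} \<Longrightarrow> R t holomorphic_on ?B (2*d)"
      "\<And>t x. \<forall>t\<in>{0..pi}. \<forall>x. slopeC p q \<epsilon> t (of_real x) \<in> \<real> \<Longrightarrow>
         t \<in> {0..pi} \<Longrightarrow> of_real x \<in> ?B (2*d) \<Longrightarrow> R t (of_real x) \<in> \<real>"
    proof (rule holomorphic_Picard[of "?B (2*d)" \<epsilon> "2 * K" pi "?B (3*d)" "slopeC p q \<epsilon>" L])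
      show "w \<in> ?B (3*d)" if "z \<in> ?B (2*d)" "norm (w - z) \<le> \<bar>\<epsilon>\<bar> * (2*K) * pi" for z w
        using box_nbhd_step[OF that(1), of w d] that(2) small e2[OF \<epsilon>] by simp
      show "continuous_on ({0..pi} \<times> ?B (3*d)) (\<lambda>(t, z). slopeC p q \<epsilon> t z)"
        by (rule continuous_on_subset[OF cont[OF \<epsilon>]]) (use B23 in auto)
      show "slopeC p q \<epsilon> t holomorphic_on ?B (3*d)" for t
        using hol[OF \<epsilon>] B23 holomorphic_on_subset by blast
      show "norm (slopeC p q \<epsilon> t z) \<le> 2 * K" if "z \<in> ?B (3*d)" for t z
        using S[OF \<epsilon>] B23 that by blast
    qed (use K L e3[OF \<epsilon>] lip[OF \<epsilon>] in \<open>auto intro: open_box_nbhd convex_box_nbhd\<close>)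
    have RB: "R t z \<in> ?B (3*d)" if "t \<in> {0..pi}" "z \<in> ?B (2*d)" for t z
      using box_nbhd_step[OF that(2), of "R t z" d] R(1)[OF that] small e2[OF \<epsilon>] by simp
    have \<epsilon>0: "\<bar>0\<bar> < \<epsilon>\<^sub>0" using \<epsilon>\<^sub>0 by simp
    have I: "continuous_on {0..pi} (\<lambda>s. slopeC p q \<epsilon> s (f s))"
      if "\<bar>\<epsilon>\<bar> < \<epsilon>\<^sub>0" "continuous_on {0..pi} f" "\<And>s. s \<in> {0..pi} \<Longrightarrow> f s \<in> ?B (4*d)" for \<epsilon> f
    proof -
      have "continuous_on {0..pi} (\<lambda>s. (\<lambda>(t, z). slopeC p q \<epsilon> t z) (s, f s))"
        by (rule continuous_on_compose2[OF cont[OF that(1), of "{0..pi}"]])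
           (use that in \<open>auto intro!: continuous_intros\<close>)
      thus ?thesis by simp
    qed
    have avg: "norm (R pi z - z - \<epsilon> * half_average p q z) \<le> C * \<epsilon>\<^sup>2" if z: "z \<in> ?B (2*d)" for z
    proof -
      have z4: "z \<in> ?B (4*d)" using z B23 by blast
      have c: "continuous_on {0..pi} (\<lambda>s. slopeC p q \<epsilon> s (R s z))" "continuous_on {0..pi} (\<lambda>s. slopeC p q 0 s z)"
        using R(2)[OF z] RB[OF _ z] B23 z4 by (auto intro!: I \<epsilon> \<epsilon>0)
      have "R pi z - z - \<epsilon> * half_average p q z = \<epsilon> * integral {0..pi} (\<lambda>s. slopeC p q \<epsilon> s (R s z) - slopeC p q 0 s z)"
        using R(3)[of pi z] z c unfolding half_average_def
        by (simp add: integral_diff integrable_continuous_real algebra_simps)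
      moreover have "norm (integral {0..pi} (\<lambda>s. slopeC p q \<epsilon> s (R s z) - slopeC p q 0 s z))
          \<le> (L * (\<bar>\<epsilon>\<bar> * (2 * K) * pi) + 4 * K * K * \<bar>\<epsilon>\<bar> / r\<^sub>1) * (pi - 0)"
      proof (rule integral_bound)
        fix s assume s: "s \<in> {0..pi}"
        have "norm (slopeC p q \<epsilon> s (R s z) - slopeC p q \<epsilon> s z) \<le> L * norm (R s z - z)"
          using RB[OF s z] z B23 by (intro lip[OF \<epsilon>]) auto
        also have "\<dots> \<le> L * (\<bar>\<epsilon>\<bar> * (2 * K) * pi)" using R(1)[OF s z] L by (intro mult_left_mono) auto
        finally have 1: "norm (slopeC p q \<epsilon> s (R s z) - slopeC p q \<epsilon> s z) \<le> L * (\<bar>\<epsilon>\<bar> * (2 * K) * pi)" .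
        have nz: "angularC p q \<epsilon> s z \<noteq> 0" "angularC p q 0 s z \<noteq> 0" using W[OF \<epsilon> z4, of s] W0[OF z4, of s] by auto
        have "slopeC p q \<epsilon> s z - slopeC p q 0 s z
            = - (slopeC p q \<epsilon> s z * (angularC p q \<epsilon> s z - angularC p q 0 s z) / angularC p q 0 s z)"
          using nz by (simp add: slopeC_def field_simps)
        hence "norm (slopeC p q \<epsilon> s z - slopeC p q 0 s z)
            = norm (slopeC p q \<epsilon> s z) * norm (angularC p q \<epsilon> s z - angularC p q 0 s z) / norm (angularC p q 0 s z)"
          by (simp add: norm_mult norm_divide)
        also have "\<dots> \<le> (2 * K * (\<bar>\<epsilon>\<bar> * K / (r\<^sub>1 / 2))) / 1"
          using K r by (intro frac_le mult_mono S[OF \<epsilon> z4] D[OF z4] W0[OF z4]) auto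
        also have "\<dots> = 4 * K * K * \<bar>\<epsilon>\<bar> / r\<^sub>1" by simp
        finally show "norm (slopeC p q \<epsilon> s (R s z) - slopeC p q 0 s z) \<le> L * (\<bar>\<epsilon>\<bar> * (2 * K) * pi) + 4 * K * K * \<bar>\<epsilon>\<bar> / r\<^sub>1"
          using 1 norm_triangle_ineq[of "slopeC p q \<epsilon> s (R s z) - slopeC p q \<epsilon> s z" "slopeC p q \<epsilon> s z - slopeC p q 0 s z"]
          by simp
      qed (use c in \<open>auto intro!: continuous_intros\<close>)
      ultimately have "norm (R pi z - z - \<epsilon> * half_average p q z)
          \<le> \<bar>\<epsilon>\<bar> * ((L * (\<bar>\<epsilon>\<bar> * (2 * K) * pi) + 4 * K * K * \<bar>\<epsilon>\<bar> / r\<^sub>1) * pi)"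
        by (simp add: norm_mult mult_left_mono)
      also have "\<dots> = ((L * (2 * K * pi) + 4 * K * K / r\<^sub>1) * pi) * (\<bar>\<epsilon>\<bar> * \<bar>\<epsilon>\<bar>)" by (simp add: algebra_simps)
      also have "\<dots> \<le> C * (\<bar>\<epsilon>\<bar> * \<bar>\<epsilon>\<bar>)" by (intro mult_right_mono C2) auto
      finally show ?thesis by (simp add: power2_eq_square)
    qed
    have "half_average p q holomorphic_on ?B (2*d)"
      unfolding half_average_def[abs_def]
      by (rule holomorphic_on_integral[OF open_box_nbhd convex_box_nbhd continuous_on_subset[OF cont[OF \<epsilon>0]]])
         (use B23 holomorphic_on_subset[OF hol[OF \<epsilon>0]] in auto)
    moreover have "norm (half_average p q z) \<le> C" if "z \<in> ?B (2*d)" for z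
    proof -
      have "norm (half_average p q z) \<le> 2 * K * (pi - 0)"
        unfolding half_average_def using that B23 by (intro integral_bound I \<epsilon>0 S) auto
      thus ?thesis using C1 by simp
    qed
    moreover have "1 / 2 \<le> angular p q \<epsilon> \<theta> x" if x: "r\<^sub>1 / 2 < x" "x < r\<^sub>2 + r\<^sub>1 / 2" for \<theta> x
    proof -
      have "of_real x \<in> ?B (4*d)" using x r by (simp add: of_real_in_box_nbhd d_def)
      from D[OF this, of \<epsilon> \<theta>] e1[OF \<epsilon>] have "\<bar>angular p q \<epsilon> \<theta> x - angular p q 0 \<theta> x\<bar> \<le> 1 / 2"
        by (simp add: angularC_of_real flip: of_real_diff)
      moreover have "1 \<le> angular p q 0 \<theta> x" by (simp add: angular_def)
      ultimately show ?thesis by linarith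
    qed
    moreover have "\<bar>\<epsilon>\<bar> * pi * norm (slopeC p q \<epsilon> \<theta> z - slopeC p q \<epsilon> \<theta> w) \<le> norm (z - w) / 2"
      if "z \<in> ?B (3*d)" "w \<in> ?B (3*d)" for \<theta> z w
    proof -
      have "\<bar>\<epsilon>\<bar> * pi * norm (slopeC p q \<epsilon> \<theta> z - slopeC p q \<epsilon> \<theta> w) \<le> \<bar>\<epsilon>\<bar> * pi * (L * norm (z - w))"
        by (intro mult_left_mono lip[OF \<epsilon>] that) auto
      also have "\<dots> = (\<bar>\<epsilon>\<bar> * L * pi) * norm (z - w)" by simp
      also have "\<dots> \<le> 1 / 2 * norm (z - w)" by (intro mult_right_mono e3[OF \<epsilon>]) auto
      finally show ?thesis by simp
    qed
    moreover have "slopeC p q \<epsilon> t (of_real x) \<in> \<real>" for t x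
      by (simp add: slopeC_def radialC_of_real angularC_of_real)
    moreover have "norm (R t z - z) \<le> C * \<bar>\<epsilon>\<bar>" if "t \<in> {0..pi}" "z \<in> ?B (2*d)" for t z
      using R(1)[OF that] small by (rule order_trans)
    ultimately have "half_flow p q r\<^sub>1 r\<^sub>2 \<epsilon> C R"
      using r R(2-5) e2[OF \<epsilon>] less_imp_le[OF C] avg by (unfold_locales; (unfold d')?) (blast | simp)+
    thus ?thesis by blast
  qed
  thus ?thesis using \<epsilon>\<^sub>0 by blast
qed

section \<open>The average function\<close>

lemma has_integral_inverse_elliptic:
  fixes r :: real
  shows "((\<lambda>\<theta>. 1 / (r\<^sup>2 * (cos \<theta>)\<^sup>2 + 1)) has_integral (pi / sqrt (1 + r\<^sup>2))) {0..pi}"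
proof -
  define s where "s = sqrt (1 + r\<^sup>2)"
  have s2: "s\<^sup>2 = 1 + r\<^sup>2" by (simp add: s_def add_nonneg_nonneg)
  have s: "s > 0" by (simp add: s_def add_pos_nonneg)
  \<comment> \<open>\<open>\<Psi>\<close> is \<open>arctan (tan \<theta> / s) / s\<close> made continuous across \<open>\<theta> = \<pi>/2\<close>.\<close>
  define N D where "N = (\<lambda>\<theta>. (s - 1) * sin \<theta> * cos \<theta>)" and "D = (\<lambda>\<theta>. s * (cos \<theta>)\<^sup>2 + (sin \<theta>)\<^sup>2)"
  define \<Psi> where "\<Psi> = (\<lambda>\<theta>. (\<theta> - arctan (N \<theta> / D \<theta>)) / s)"
  have "((\<lambda>\<theta>. 1 / (r\<^sup>2 * (cos \<theta>)\<^sup>2 + 1)) has_integral (\<Psi> pi - \<Psi> 0)) {0..pi}"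
  proof (rule fundamental_theorem_of_calculus)
    fix \<theta> :: real
    define c \<sigma> where "c = cos \<theta>" and "\<sigma> = sin \<theta>"
    have cs: "c\<^sup>2 + \<sigma>\<^sup>2 = 1" by (simp add: c_def \<sigma>_def)
    have D: "D \<theta> > 0"
    proof (cases "cos \<theta> = 0")
      case True
      hence "sin \<theta> \<noteq> 0" using sin_cos_squared_add[of \<theta>] by auto
      thus ?thesis using True by (simp add: D_def)
    next
      case False thus ?thesis using s by (simp add: D_def add_pos_nonneg)
    qed
    have "(N has_real_derivative (s - 1) * (c\<^sup>2 - \<sigma>\<^sup>2)) (at \<theta>)"
      unfolding N_def by (auto intro!: derivative_eq_intros simp: c_def \<sigma>_def power2_eq_square algebra_simps)
    moreover have "(D has_real_derivative - 2 * (s - 1) * \<sigma> * c) (at \<theta>)"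
      unfolding D_def by (auto intro!: derivative_eq_intros simp: c_def \<sigma>_def algebra_simps)
    ultimately have "((\<lambda>\<theta>. N \<theta> / D \<theta>) has_real_derivative
        ((s - 1) * (c\<^sup>2 - \<sigma>\<^sup>2) * D \<theta> - N \<theta> * (- 2 * (s - 1) * \<sigma> * c)) / (D \<theta> * D \<theta>)) (at \<theta>)"
      using D by (intro DERIV_divide) auto
    hence "(\<Psi> has_real_derivative (1 - inverse (1 + (N \<theta> / D \<theta>)\<^sup>2) *
        (((s - 1) * (c\<^sup>2 - \<sigma>\<^sup>2) * D \<theta> - N \<theta> * (- 2 * (s - 1) * \<sigma> * c)) / (D \<theta> * D \<theta>))) / s) (at \<theta>)"
      unfolding \<Psi>_def by (intro DERIV_cdivide DERIV_diff DERIV_ident DERIV_chain2[OF DERIV_arctan])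
    also have "inverse (1 + (N \<theta> / D \<theta>)\<^sup>2) *
        (((s - 1) * (c\<^sup>2 - \<sigma>\<^sup>2) * D \<theta> - N \<theta> * (- 2 * (s - 1) * \<sigma> * c)) / (D \<theta> * D \<theta>))
      = ((s - 1) * (c\<^sup>2 - \<sigma>\<^sup>2) * D \<theta> - N \<theta> * (- 2 * (s - 1) * \<sigma> * c)) / ((D \<theta>)\<^sup>2 + (N \<theta>)\<^sup>2)"
    proof -
      have "(D \<theta>)\<^sup>2 + (N \<theta>)\<^sup>2 > 0" "1 + (N \<theta> / D \<theta>)\<^sup>2 = ((D \<theta>)\<^sup>2 + (N \<theta>)\<^sup>2) / (D \<theta>)\<^sup>2"
        using D by (auto simp: field_simps add_pos_nonneg)
      thus ?thesis using D by (simp add: power2_eq_square)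
    qed
    \<comment> \<open>\<open>N\<close> and \<open>D\<close> have been chosen so that the sum of
      their squares is exactly the denominator of the integrand.\<close>
    also have "(D \<theta>)\<^sup>2 + (N \<theta>)\<^sup>2 = r\<^sup>2 * c\<^sup>2 + 1"
      unfolding D_def N_def c_def[symmetric] \<sigma>_def[symmetric] using cs s2 by algebra
    also have "(s - 1) * (c\<^sup>2 - \<sigma>\<^sup>2) * D \<theta> - N \<theta> * (- 2 * (s - 1) * \<sigma> * c) = r\<^sup>2 * c\<^sup>2 + 1 - s"
      unfolding D_def N_def c_def[symmetric] \<sigma>_def[symmetric] using cs s2 by algebra
    also have "(1 - (r\<^sup>2 * c\<^sup>2 + 1 - s) / (r\<^sup>2 * c\<^sup>2 + 1)) / s = 1 / (r\<^sup>2 * c\<^sup>2 + 1)"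
    proof -
      have "(1 - (X - s) / X) / s = 1 / X" if "X > 0" for X
        using s that by (simp add: field_simps)
      thus ?thesis by (simp add: add_nonneg_pos)
    qed
    finally show "(\<Psi> has_vector_derivative 1 / (r\<^sup>2 * (cos \<theta>)\<^sup>2 + 1)) (at \<theta> within {0..pi})"
      by (simp add: c_def has_real_derivative_iff_has_vector_derivative has_vector_derivative_at_within)
  qed simp
  thus ?thesis by (simp add: \<Psi>_def N_def s_def)
qed

lemma has_integral_sin_elliptic:
  fixes r :: real assumes r: "r > 0"
  shows "((\<lambda>\<theta>. sin \<theta> / (r\<^sup>2 * (cos \<theta>)\<^sup>2 + 1)) has_integral (2 * arctan r / r)) {0..pi}"
proof -
  have "((\<lambda>\<theta>. sin \<theta> / (r\<^sup>2 * (cos \<theta>)\<^sup>2 + 1)) has_integral (- arctan (r * cos pi) / r - (- arctan (r * cos 0) / r))) {0..pi}"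
  proof (rule fundamental_theorem_of_calculus)
    fix \<theta> :: real
    have "((\<lambda>\<theta>. - arctan (r * cos \<theta>) / r) has_real_derivative
        - (inverse (1 + (r * cos \<theta>)\<^sup>2) * (r * - sin \<theta>)) / r) (at \<theta>)"
      by (auto intro!: derivative_eq_intros)
    also have "- (inverse (1 + (r * cos \<theta>)\<^sup>2) * (r * - sin \<theta>)) / r = sin \<theta> / (r\<^sup>2 * (cos \<theta>)\<^sup>2 + 1)"
      using r by (simp add: power_mult_distrib divide_inverse add.commute)
    finally show "((\<lambda>\<theta>. - arctan (r * cos \<theta>) / r) has_vector_derivative sin \<theta> / (r\<^sup>2 * (cos \<theta>)\<^sup>2 + 1)) (at \<theta> within {0..pi})"
      by (simp add: has_real_derivative_iff_has_vector_derivative has_vector_derivative_at_within)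
  qed simp
  thus ?thesis by (simp add: arctan_minus field_simps)
qed

text \<open>The reflection \<open>t\<close> to \<open>a - t\<close> preserves the interval and
  reverses the sign of \<open>h\<close>, so the integral equals its own negative.\<close>

lemma has_integral_antisymmetric:
  fixes h :: "real \<Rightarrow> real"
  assumes "continuous_on {0..a} h" "\<And>t. h (a - t) = - h t" "0 \<le> a"
  shows "(h has_integral 0) {0..a}"
proof -
  have I: "(h has_integral integral {0..a} h) (cbox 0 a)"
    using integrable_continuous_real[OF assms(1)] by (simp add: integrable_integral)
  have "((\<lambda>x. h (- 1 * x + a)) has_integral integral {0..a} h) ((\<lambda>x. - x + a) ` {0..a})"
    using has_integral_affinity[OF I, of "- 1" a] assms(3) by (simp add: algebra_simps)
  moreover have "(\<lambda>x. - x + a) ` {0..a} = {0..a}"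
    by (auto simp: image_iff intro!: bexI[of _ "a - _"])
  ultimately have "((\<lambda>x. - h x) has_integral integral {0..a} h) {0..a}"
    using assms(2) by simp
  moreover have "((\<lambda>x. - h x) has_integral - integral {0..a} h) {0..a}"
    using has_integral_neg[OF I] by simp
  ultimately have "integral {0..a} h = - integral {0..a} h" by (rule has_integral_unique)
  thus ?thesis using I by simp
qed

definition ectR :: "real \<Rightarrow> real \<Rightarrow> real \<Rightarrow> real \<Rightarrow> real \<Rightarrow> real \<Rightarrow> real \<Rightarrow> real \<Rightarrow> real" where
  "ectR c0 c1 c2 c3 e1 e2 e3 r =
     (c0 + c2 * r\<^sup>2) * arctan r + c1 * r + c3 * r\<^sup>2
     + e1 * (inverse (sqrt (1 + r\<^sup>2)) - 1) + e2 * (sqrt (1 + r\<^sup>2) - 1) + e3 * ((sqrt (1 + r\<^sup>2))^3 - 1)"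

lemma ect_of_real: "ect c0 c1 c2 c3 e1 e2 e3 (of_real r) = of_real (ectR c0 c1 c2 c3 e1 e2 e3 r)"
  by (simp add: ect_def ectR_def rt_of_real Arctan_of_real)

text \<open>After multiplication by \<open>r\<close>, division with remainder by the denominator
  reduces every surviving monomial to \<open>1\<close>, \<open>sin\<close>, the squares of sine and
  cosine, and the two elliptic integrands treated above.\<close>

lemma has_integral_radial:
  fixes r :: real assumes r: "r > 0"
  shows "((\<lambda>\<theta>. radial p q \<theta> r / (r\<^sup>2 * (cos \<theta>)\<^sup>2 + 1)) has_integral
     (ectR (2 * q 0 0 - 2 * (q 2 0 + p 1 1) + 2 * q 0 2) (2 * (q 2 0 + p 1 1) - 2 * q 0 2) (2 * q 0 2)
       (pi / 2 * (p 3 0 + p 1 2 + q 2 1 - 3 * q 0 3)) (pi * (p 3 0 - p 1 0)) (pi * (q 0 1 - p 1 2 - q 2 1)) (pi * q 0 3) r / r))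
     {0..pi}"
proof -
  define s where "s = sqrt (1 + r\<^sup>2)"
  have s2: "s\<^sup>2 = 1 + r\<^sup>2" by (simp add: s_def add_nonneg_nonneg)
  have s: "s > 0" by (simp add: s_def add_pos_nonneg)
  let ?w = "\<lambda>\<theta>. 1 / (r\<^sup>2 * (cos \<theta>)\<^sup>2 + 1)"
  have w: "r\<^sup>2 * (cos \<theta>)\<^sup>2 + 1 > 0" for \<theta> by (simp add: add_nonneg_pos)
  \<comment> \<open>Terms with an odd power of the cosine are antisymmetric about \<open>\<theta> = \<pi>/2\<close> and integrate to \<open>0\<close>.\<close>
  define even where "even \<theta> = q 0 0 * (r * (sin \<theta> / (r\<^sup>2 * (cos \<theta>)\<^sup>2 + 1))) + p 1 0 * (1 - ?w \<theta>) + q 0 1 * (s\<^sup>2 * ?w \<theta> - 1)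
     + (p 1 1 + q 2 0) * (r * sin \<theta> - r * (sin \<theta> / (r\<^sup>2 * (cos \<theta>)\<^sup>2 + 1)))
     + q 0 2 * ((r^3 + r) * (sin \<theta> / (r\<^sup>2 * (cos \<theta>)\<^sup>2 + 1)) - r * sin \<theta>)
     + p 3 0 * (r\<^sup>2 * (cos \<theta>)\<^sup>2 - (1 - ?w \<theta>)) + (p 1 2 + q 2 1) * (r\<^sup>2 * (sin \<theta>)\<^sup>2 - (s\<^sup>2 * ?w \<theta> - 1))
     + q 0 3 * (s\<^sup>2 * (s\<^sup>2 * ?w \<theta> - 1) - r\<^sup>2 * (sin \<theta>)\<^sup>2)" for \<theta>
  define odd where "odd \<theta> = cos \<theta> * (r * p 0 0 + r\<^sup>2 * (p 0 1 + q 1 0) * sin \<theta> + r^3 * (p 2 0 * (cos \<theta>)\<^sup>2 + (p 0 2 + q 1 1) * (sin \<theta>)\<^sup>2)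
      + r^4 * sin \<theta> * ((p 2 1 + q 3 0) * (cos \<theta>)\<^sup>2 + (p 0 3 + q 1 2) * (sin \<theta>)\<^sup>2)) * ?w \<theta>" for \<theta>
  have split: "radial p q \<theta> r / (r\<^sup>2 * (cos \<theta>)\<^sup>2 + 1) = (even \<theta> + odd \<theta>) / r" for \<theta>
  proof -
    define c \<sigma> w where "c = cos \<theta>" and "\<sigma> = sin \<theta>" and "w = ?w \<theta>"
    have cs: "c\<^sup>2 + \<sigma>\<^sup>2 = 1" by (simp add: c_def \<sigma>_def)
    have ww: "w * (r\<^sup>2 * c\<^sup>2 + 1) = 1" using w[of \<theta>] by (simp add: w_def c_def)
    have "\<sigma> / (r\<^sup>2 * c\<^sup>2 + 1) = \<sigma> * w" by (simp add: w_def c_def)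
    hence e: "even \<theta> = q 0 0 * (r * (\<sigma> * w)) + p 1 0 * (1 - w) + q 0 1 * (s\<^sup>2 * w - 1)
     + (p 1 1 + q 2 0) * (r * \<sigma> - r * (\<sigma> * w)) + q 0 2 * ((r^3 + r) * (\<sigma> * w) - r * \<sigma>)
     + p 3 0 * (r\<^sup>2 * c\<^sup>2 - (1 - w)) + (p 1 2 + q 2 1) * (r\<^sup>2 * \<sigma>\<^sup>2 - (s\<^sup>2 * w - 1))
     + q 0 3 * (s\<^sup>2 * (s\<^sup>2 * w - 1) - r\<^sup>2 * \<sigma>\<^sup>2)"
      unfolding even_def c_def[symmetric] \<sigma>_def[symmetric] by (simp add: w_def c_def)
    \<comment> \<open>Everything follows from \<open>r\<^sup>2 * c\<^sup>2 * w = 1 - w\<close> and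
      \<open>r\<^sup>2 * \<sigma>\<^sup>2 * w = s\<^sup>2 * w - 1\<close>, that is, from
      \<open>w\<close> being the reciprocal of the denominator.\<close>
    have k: "r * \<sigma> * w * (r\<^sup>2 * c\<^sup>2) = r * \<sigma> - r * (\<sigma> * w)"
      "r * \<sigma> * w * (r\<^sup>2 * \<sigma>\<^sup>2) = (r^3 + r) * (\<sigma> * w) - r * \<sigma>"
      "r\<^sup>2 * c\<^sup>2 * w = 1 - w" "r\<^sup>2 * \<sigma>\<^sup>2 * w = s\<^sup>2 * w - 1"
      "r^4 * c^4 * w = r\<^sup>2 * c\<^sup>2 - (1 - w)"
      "r^4 * c\<^sup>2 * \<sigma>\<^sup>2 * w = r\<^sup>2 * \<sigma>\<^sup>2 - (s\<^sup>2 * w - 1)"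
      "r^4 * \<sigma>^4 * w = s\<^sup>2 * (s\<^sup>2 * w - 1) - r\<^sup>2 * \<sigma>\<^sup>2"
      using ww cs s2 by algebra+
    have "r * radial p q \<theta> r * w = q 0 0 * (r * (\<sigma> * w)) + p 1 0 * (r\<^sup>2 * c\<^sup>2 * w) + q 0 1 * (r\<^sup>2 * \<sigma>\<^sup>2 * w)
     + (p 1 1 + q 2 0) * (r * \<sigma> * w * (r\<^sup>2 * c\<^sup>2)) + q 0 2 * (r * \<sigma> * w * (r\<^sup>2 * \<sigma>\<^sup>2))
     + p 3 0 * (r^4 * c^4 * w) + (p 1 2 + q 2 1) * (r^4 * c\<^sup>2 * \<sigma>\<^sup>2 * w)
     + q 0 3 * (r^4 * \<sigma>^4 * w) + odd \<theta>"
      unfolding odd_def radial_def cubic_def c_def[symmetric] \<sigma>_def[symmetric] w_def[symmetric, unfolded c_def[symmetric]]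
      by (simp add: eval_nat_numeral algebra_simps)
    also have "\<dots> = even \<theta> + odd \<theta>" unfolding e k by simp
    finally have "r * radial p q \<theta> r * w = even \<theta> + odd \<theta>" .
    thus ?thesis using r by (simp add: w_def c_def field_simps)
  qed
  have odd: "(odd has_integral 0) {0..pi}"
  proof (rule has_integral_antisymmetric)
    show "continuous_on {0..pi} odd"
      unfolding odd_def using w by (intro continuous_intros) (auto simp: less_imp_neq[symmetric])
  qed (auto simp: odd_def)
  have c2: "((\<lambda>\<theta>. (cos \<theta>)\<^sup>2) has_integral pi / 2) {0..pi}"
  proof -
    have "((\<lambda>\<theta>. (cos \<theta>)\<^sup>2) has_integral ((pi + sin pi * cos pi) / 2 - (0 + sin 0 * cos 0) / 2)) {0..pi}"
      by (rule fundamental_theorem_of_calculus)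
         (auto intro!: derivative_eq_intros simp: sin_squared_eq power2_eq_square[symmetric]
           simp flip: has_real_derivative_iff_has_vector_derivative)
    thus ?thesis by simp
  qed
  have s2': "((\<lambda>\<theta>. (sin \<theta>)\<^sup>2) has_integral pi / 2) {0..pi}"
    using has_integral_diff[OF has_integral_const_real[of "1::real" 0 pi] c2] by (simp add: sin_squared_eq)
  have s1: "(sin has_integral 2) {0..pi}"
  proof -
    have "(sin has_integral (- cos pi - (- cos 0))) {0..pi}"
      by (rule fundamental_theorem_of_calculus)
         (auto intro!: derivative_eq_intros simp flip: has_real_derivative_iff_has_vector_derivative)
    thus ?thesis by simp
  qed
  have one: "((\<lambda>_. 1) has_integral pi) {0..pi}" using has_integral_const_real[of "1::real" 0 pi] by simp
  note J0 = has_integral_inverse_elliptic[of r, folded s_def] and J1 = has_integral_sin_elliptic[OF r]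
  have "(even has_integral (q 0 0 * (r * (2 * arctan r / r)) + p 1 0 * (pi - pi / s) + q 0 1 * (s\<^sup>2 * (pi / s) - pi)
     + (p 1 1 + q 2 0) * (r * 2 - r * (2 * arctan r / r))
     + q 0 2 * ((r^3 + r) * (2 * arctan r / r) - r * 2)
     + p 3 0 * (r\<^sup>2 * (pi / 2) - (pi - pi / s)) + (p 1 2 + q 2 1) * (r\<^sup>2 * (pi / 2) - (s\<^sup>2 * (pi / s) - pi))
     + q 0 3 * (s\<^sup>2 * (s\<^sup>2 * (pi / s) - pi) - r\<^sup>2 * (pi / 2)))) {0..pi}"
    unfolding even_def
    by (intro has_integral_add has_integral_diff has_integral_mult_right J0 J1 s1 s2' c2 one)
  from has_integral_divide[OF has_integral_add[OF this odd], of r]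
  have "((\<lambda>\<theta>. radial p q \<theta> r / (r\<^sup>2 * (cos \<theta>)\<^sup>2 + 1)) has_integral ((q 0 0 * (r * (2 * arctan r / r)) + p 1 0 * (pi - pi / s) + q 0 1 * (s\<^sup>2 * (pi / s) - pi)
     + (p 1 1 + q 2 0) * (r * 2 - r * (2 * arctan r / r))
     + q 0 2 * ((r^3 + r) * (2 * arctan r / r) - r * 2)
     + p 3 0 * (r\<^sup>2 * (pi / 2) - (pi - pi / s)) + (p 1 2 + q 2 1) * (r\<^sup>2 * (pi / 2) - (s\<^sup>2 * (pi / s) - pi))
     + q 0 3 * (s\<^sup>2 * (s\<^sup>2 * (pi / s) - pi) - r\<^sup>2 * (pi / 2))) / r)) {0..pi}"
    unfolding split by simp
  also have "r * (2 * arctan r / r) = 2 * arctan r" using r by simp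
  also have "(r^3 + r) * (2 * arctan r / r) = 2 * r\<^sup>2 * arctan r + 2 * arctan r"
    using r by (simp add: field_simps power3_eq_cube power2_eq_square)
  also have "s\<^sup>2 * (pi / s) = pi * s" using s by (simp add: power2_eq_square)
  also have "s\<^sup>2 * (pi * s - pi) = pi * (s^3 - s\<^sup>2)" by (simp add: algebra_simps power3_eq_cube power2_eq_square)
  finally show ?thesis
    apply (rule has_integral_eq_rhs) apply (unfold ectR_def s_def[symmetric] divide_inverse)
    apply (rule arg_cong[where f = "\<lambda>x. x * inverse r"]) using s2 by algebra
qed

text \<open>Rotation by \<open>\<pi>\<close> interchanges the half-planes, so that only the upper one needs to be treated.\<close>

definition rotate :: "(nat \<Rightarrow> nat \<Rightarrow> real) \<Rightarrow> nat \<Rightarrow> nat \<Rightarrow> real" where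
  "rotate c i j = - ((- 1) ^ (i + j)) * c i j"

lemma cubic_rotate: "cubic (rotate c) x y = - cubic c (- x) (- y)"
  unfolding cubic_def rotate_def sum_negf[symmetric]
  by (intro sum.cong refl) (simp add: power_add power_minus[of x] power_minus[of y])

lemma radial_rotate: "radial (rotate p) (rotate q) \<theta> r = radial p q (\<theta> + pi) r"
  by (simp add: radial_def cubic_rotate)

definition half_averageR :: "(nat \<Rightarrow> nat \<Rightarrow> real) \<Rightarrow> (nat \<Rightarrow> nat \<Rightarrow> real) \<Rightarrow> real \<Rightarrow> real" where
  "half_averageR p q r = integral {0..pi} (\<lambda>\<theta>. radial p q \<theta> r / (r\<^sup>2 * (cos \<theta>)\<^sup>2 + 1))"

lemma half_averageR_has_integral:
  "r > 0 \<Longrightarrow> ((\<lambda>\<theta>. radial p q \<theta> r / (r\<^sup>2 * (cos \<theta>)\<^sup>2 + 1)) has_integral half_averageR p q r) {0..pi}"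
  unfolding half_averageR_def using has_integral_radial[of r p q] has_integral_integral by blast

lemma half_average_of_real:
  assumes "r > 0" shows "half_average p q (of_real r) = of_real (half_averageR p q r)"
proof -
  have "((\<lambda>\<theta>. complex_of_real (radial p q \<theta> r / (r\<^sup>2 * (cos \<theta>)\<^sup>2 + 1))) has_integral of_real (half_averageR p q r)) {0..pi}"
    by (rule has_integral_linear[OF half_averageR_has_integral[OF assms] bounded_linear_of_real, unfolded o_def])
  moreover have "slopeC p q 0 \<theta> (of_real r) = of_real (radial p q \<theta> r / (r\<^sup>2 * (cos \<theta>)\<^sup>2 + 1))" for \<theta>
    by (simp add: slopeC_def radialC_of_real angularC_of_real angular_def)
  ultimately show ?thesis unfolding half_average_def by (simp add: integral_unique)
qed

lemma average_function_eq:
  assumes r: "r > 0"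
  shows "average_function a b r = half_averageR (a 1) (b 1) r + half_averageR (rotate (a 2)) (rotate (b 2)) r"
proof -
  have F: "polar_F a b \<theta> r = (if \<theta> < pi then radial (a 1) (b 1) \<theta> r else radial (a 2) (b 2) \<theta> r) / (r\<^sup>2 * (cos \<theta>)\<^sup>2 + 1)" for \<theta>
    by (simp add: polar_F_def radial_def Let_def)
  have 1: "((\<lambda>\<theta>. polar_F a b \<theta> r) has_integral half_averageR (a 1) (b 1) r) {0..pi}"
    \<comment> \<open>At \<open>\<theta> = \<pi>\<close> the definition of \<open>polar_F\<close>
      already uses the lower coefficients; a single point does not change the integral.\<close>
    by (rule has_integral_spike_finite[OF _ _ half_averageR_has_integral[OF r], of "{pi}"]) (auto simp: F)
  have "((\<lambda>\<theta>. radial (rotate (a 2)) (rotate (b 2)) (1 * \<theta> + - pi) r / (r\<^sup>2 * (cos (1 * \<theta> + - pi))\<^sup>2 + 1))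
      has_integral (1 / \<bar>1\<bar>) *\<^sub>R half_averageR (rotate (a 2)) (rotate (b 2)) r) ((\<lambda>x. (1/1) *\<^sub>R x + - ((1/1) *\<^sub>R - pi)) ` cbox 0 pi)"
    using has_integral_affinity[OF half_averageR_has_integral[OF r, of "rotate (a 2)" "rotate (b 2)", unfolded cbox_interval[symmetric]], of 1 "- pi"] by simp
  moreover have "(\<lambda>x. (1/1) *\<^sub>R x + - ((1/1) *\<^sub>R - pi)) ` cbox 0 pi = {pi..2 * pi}"
    using image_add_atLeastAtMost[of pi 0 pi] by (simp add: add.commute)
  ultimately have "((\<lambda>\<theta>. radial (a 2) (b 2) \<theta> r / (r\<^sup>2 * (cos \<theta>)\<^sup>2 + 1))
      has_integral half_averageR (rotate (a 2)) (rotate (b 2)) r) {pi..2 * pi}"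
    by (simp add: radial_rotate)
  hence 2: "((\<lambda>\<theta>. polar_F a b \<theta> r) has_integral half_averageR (rotate (a 2)) (rotate (b 2)) r) {pi..2 * pi}"
    by (rule has_integral_eq[rotated]) (simp add: F)
  show ?thesis unfolding average_function_def
    by (rule integral_unique, rule has_integral_combine[OF _ _ 1 2]) auto
qed

lemma half_averageR_ectR:
  assumes "r > 0"
  shows "r * half_averageR p q r =
     ectR (2 * q 0 0 - 2 * (q 2 0 + p 1 1) + 2 * q 0 2) (2 * (q 2 0 + p 1 1) - 2 * q 0 2) (2 * q 0 2)
       (pi / 2 * (p 3 0 + p 1 2 + q 2 1 - 3 * q 0 3)) (pi * (p 3 0 - p 1 0)) (pi * (q 0 1 - p 1 2 - q 2 1)) (pi * q 0 3) r"
  using integral_unique[OF has_integral_radial[OF assms, of p q]] assms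
  by (simp add: half_averageR_def)

lemma ectR_add: "ectR c0 c1 c2 c3 e1 e2 e3 r + ectR c0' c1' c2' c3' e1' e2' e3' r =
    ectR (c0 + c0') (c1 + c1') (c2 + c2') (c3 + c3') (e1 + e1') (e2 + e2') (e3 + e3') r"
  by (simp add: ectR_def algebra_simps)

lemma average_function_ectR:
  "\<exists>c0 c1 c2 c3 e1 e2 e3. \<forall>r>0. r * average_function a b r = ectR c0 c1 c2 c3 e1 e2 e3 r"
  using half_averageR_ectR by (simp add: average_function_eq distrib_left ectR_add) blast

text \<open>A perturbation in the upper half-plane alone suffices. The coefficient formulas are
  solved for six entries in triangular order with \<open>p 1 2\<close>, \<open>q 2 1\<close> and
  \<open>q 2 0\<close> set to zero; \<open>x\<close> is the value of \<open>p 3 0\<close> that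
  produces \<open>c3\<close> once \<open>q 0 3\<close> is fixed, and \<open>p 1 0\<close> then
  adjusts \<open>e1\<close>.\<close>

lemma ectR_is_average:
  "\<exists>a b. \<forall>r>0. r * average_function a b r = ectR c0 c1 c2 c3 e1 e2 e3 r"
proof -
  define x where "x = (2 * c3 + 3 * e3) / pi"
  define p :: "nat \<Rightarrow> nat \<Rightarrow> real" where
    "p i j = (if (i, j) = (1, 1) then (c1 + c2) / 2 else if (i, j) = (3, 0) then x else if (i, j) = (1, 0) then x - e1 / pi else 0)" for i j
  define q :: "nat \<Rightarrow> nat \<Rightarrow> real" where
    "q i j = (if (i, j) = (0, 0) then (c0 + c1) / 2 else if (i, j) = (0, 2) then c2 / 2 else if (i, j) = (0, 1) then e2 / pi
       else if (i, j) = (0, 3) then e3 / pi else 0)" for i j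
  have z: "rotate (\<lambda>i j. 0) = (\<lambda>i j. 0)" by (simp add: rotate_def fun_eq_iff)
  have "half_averageR (\<lambda>i j. 0) (\<lambda>i j. 0) r = 0" for r by (simp add: half_averageR_def radial_def cubic_def)
  moreover have "r * half_averageR p q r = ectR c0 c1 c2 c3 e1 e2 e3 r" if "r > 0" for r
    unfolding half_averageR_ectR[OF that] by (simp add: p_def q_def x_def field_simps)
  ultimately have "\<forall>r>0. r * average_function (\<lambda>k. if k = 1 then p else (\<lambda>i j. 0)) (\<lambda>k. if k = 1 then q else (\<lambda>i j. 0)) r = ectR c0 c1 c2 c3 e1 e2 e3 r"
    by (simp add: average_function_eq z)
  thus ?thesis by blast
qed

section \<open>Solutions in the upper half-plane\<close>

definition half_field :: "(nat \<Rightarrow> nat \<Rightarrow> real) \<Rightarrow> (nat \<Rightarrow> nat \<Rightarrow> real) \<Rightarrow> real \<Rightarrow> real \<times> real \<Rightarrow> real \<times> real" where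
  "half_field p q \<epsilon> = (\<lambda>(x, y). (- y * (x\<^sup>2 + 1) + \<epsilon> * cubic p x y, x * (x\<^sup>2 + 1) + \<epsilon> * cubic q x y))"

lemma vfield_half_field: "vfield a b \<epsilon> k = half_field (a k) (b k) \<epsilon>"
  by (simp add: vfield_def half_field_def)

text \<open>On the closed upper half-plane without the origin this is the polar angle in
  \<open>[0, \<pi>]\<close>. The arccosine is continuous up to both half-axes, so no branch has to
  be chosen.\<close>

definition arg_of :: "real \<times> real \<Rightarrow> real" where
  "arg_of z = arccos (fst z / norm z)"

lemma norm_pair_sq: "(norm (z :: real \<times> real))\<^sup>2 = (fst z)\<^sup>2 + (snd z)\<^sup>2"
  by (simp add: norm_prod_def)

lemma abs_fst_le_norm: "\<bar>fst z\<bar> \<le> norm (z :: real \<times> real)"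
  using norm_fst_le[of "fst z" "snd z"] by simp

lemma fst_le_norm: "z \<noteq> (0 :: real \<times> real) \<Longrightarrow> -1 \<le> fst z / norm z \<and> fst z / norm z \<le> 1"
  using abs_fst_le_norm[of z] by (auto simp: field_simps abs_le_iff)

lemma arg_of_bounds: "z \<noteq> 0 \<Longrightarrow> 0 \<le> arg_of z \<and> arg_of z \<le> pi"
  unfolding arg_of_def using fst_le_norm[of z] by (auto intro: arccos_lbound arccos_ubound)

lemma polar_coordinates:
  assumes "z \<noteq> 0" "0 \<le> snd z"
  shows "norm z * cos (arg_of z) = fst z" "norm z * sin (arg_of z) = snd z"
proof -
  have n: "norm z > 0" using assms by simp
  note u = fst_le_norm[OF assms(1)]
  show "norm z * cos (arg_of z) = fst z" unfolding arg_of_def using u n by (simp add: cos_arccos)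
  have "1 - (fst z / norm z)\<^sup>2 = ((norm z)\<^sup>2 - (fst z)\<^sup>2) / (norm z)\<^sup>2"
    using n by (simp add: power_divide diff_divide_distrib)
  also have "(norm z)\<^sup>2 - (fst z)\<^sup>2 = (snd z)\<^sup>2" by (simp add: norm_pair_sq)
  finally have "1 - (fst z / norm z)\<^sup>2 = (snd z / norm z)\<^sup>2" by (simp add: power_divide)
  hence "sin (arg_of z) = snd z / norm z"
    unfolding arg_of_def using u n assms by (simp add: sin_arccos)
  thus "norm z * sin (arg_of z) = snd z" using n by simp
qed

lemma arg_of_on_axis:
  assumes "z \<noteq> 0" "snd z = 0"
  shows "fst z > 0 \<Longrightarrow> arg_of z = 0" "fst z < 0 \<Longrightarrow> arg_of z = pi"
proof -
  have "norm z = \<bar>fst z\<bar>" using assms by (simp add: norm_prod_def)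
  thus "fst z > 0 \<Longrightarrow> arg_of z = 0" "fst z < 0 \<Longrightarrow> arg_of z = pi" by (auto simp: arg_of_def)
qed

lemma continuous_on_arg_of:
  assumes "continuous_on S \<gamma>" "\<And>t. t \<in> S \<Longrightarrow> \<gamma> t \<noteq> (0 :: real \<times> real)"
  shows "continuous_on S (\<lambda>t. arg_of (\<gamma> t))"
  unfolding arg_of_def
proof (intro continuous_intros assms(1) ballI)
  show "norm (\<gamma> t) \<noteq> 0" if "t \<in> S" for t using assms(2)[OF that] by simp
  show "-1 \<le> fst (\<gamma> t) / norm (\<gamma> t) \<and> fst (\<gamma> t) / norm (\<gamma> t) \<le> 1" if "t \<in> S" for t
    by (rule fst_le_norm[OF assms(2)[OF that]])
qed

text \<open>The arccosine is differentiable only strictly between \<open>-1\<close> and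
  \<open>1\<close>, that is, off the axis. Later arguments therefore differentiate on open time
  intervals and use mere continuity at their ends.\<close>

lemma polar_derivatives:
  fixes \<gamma> :: "real \<Rightarrow> real \<times> real"
  assumes d: "(\<gamma> has_vector_derivative half_field p q \<epsilon> (\<gamma> t)) (at t)" and y: "snd (\<gamma> t) > 0"
  shows "((\<lambda>t. norm (\<gamma> t)) has_real_derivative \<epsilon> * radial p q (arg_of (\<gamma> t)) (norm (\<gamma> t))) (at t)"
    and "((\<lambda>t. arg_of (\<gamma> t)) has_real_derivative angular p q \<epsilon> (arg_of (\<gamma> t)) (norm (\<gamma> t))) (at t)"
proof -
  define X Y where "X t = fst (\<gamma> t)" and "Y t = snd (\<gamma> t)" for t
  define P Q where "P = cubic p (X t) (Y t)" and "Q = cubic q (X t) (Y t)"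
  define r where "r = norm (\<gamma> t)"
  have nz: "\<gamma> t \<noteq> 0" using y by auto
  have r: "r > 0" using nz by (simp add: r_def)
  have Y: "Y t > 0" using y by (simp add: Y_def)
  have r2: "r\<^sup>2 = (X t)\<^sup>2 + (Y t)\<^sup>2" by (simp add: r_def norm_pair_sq X_def Y_def)
  have pc: "r * cos (arg_of (\<gamma> t)) = X t" "r * sin (arg_of (\<gamma> t)) = Y t"
    using polar_coordinates[OF nz] y by (auto simp: r_def X_def Y_def)
  hence cs: "cos (arg_of (\<gamma> t)) = X t / r" "sin (arg_of (\<gamma> t)) = Y t / r" using r by (auto simp: field_simps)
  have rad: "radial p q (arg_of (\<gamma> t)) r = (X t * P + Y t * Q) / r"
    unfolding radial_def pc cs P_def Q_def by (simp add: add_divide_distrib)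
  have ang: "angular p q \<epsilon> (arg_of (\<gamma> t)) r = (X t)\<^sup>2 + 1 + \<epsilon> * (X t * Q - Y t * P) / r\<^sup>2"
    unfolding angular_def pc power_mult_distrib[symmetric] unfolding cs P_def Q_def
    by (simp add: power2_eq_square diff_divide_distrib right_diff_distrib)
  define x' y' where "x' = - Y t * ((X t)\<^sup>2 + 1) + \<epsilon> * P" and "y' = X t * ((X t)\<^sup>2 + 1) + \<epsilon> * Q"
  have d': "half_field p q \<epsilon> (\<gamma> t) = (x', y')"
    by (simp add: half_field_def x'_def y'_def X_def Y_def P_def Q_def case_prod_beta)
  have dX: "(X has_real_derivative x') (at t)"
    using bounded_linear.has_vector_derivative[OF bounded_linear_fst d] d'
    by (simp add: X_def[abs_def] has_real_derivative_iff_has_vector_derivative)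
  have dY: "(Y has_real_derivative y') (at t)"
    using bounded_linear.has_vector_derivative[OF bounded_linear_snd d] d'
    by (simp add: Y_def[abs_def] has_real_derivative_iff_has_vector_derivative)
  have nrm: "norm (\<gamma> t) = sqrt ((X t)\<^sup>2 + (Y t)\<^sup>2)" for t by (simp add: norm_prod_def X_def Y_def)
  have dsq: "((\<lambda>t. sqrt ((X t)\<^sup>2 + (Y t)\<^sup>2)) has_real_derivative (2 * X t * x' + 2 * Y t * y') * (inverse (sqrt ((X t)\<^sup>2 + (Y t)\<^sup>2)) / 2)) (at t)"
  proof -
    have "(X t)\<^sup>2 + (Y t)\<^sup>2 > 0" using Y by (simp add: add_nonneg_pos)
    thus ?thesis by (auto intro!: derivative_eq_intros dX dY)
  qed
  have dr: "((\<lambda>t. norm (\<gamma> t)) has_real_derivative (X t * x' + Y t * y') / r) (at t)"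
  proof -
    have E: "(2 * X t * x' + 2 * Y t * y') * (inverse r / 2) = (X t * x' + Y t * y') / r"
      using r by (simp add: field_simps)
    show ?thesis using dsq unfolding nrm[symmetric] r_def[symmetric] E .
  qed
  have "X t * x' + Y t * y' = \<epsilon> * (X t * P + Y t * Q)" by (simp add: x'_def y'_def algebra_simps)
  thus "((\<lambda>t. norm (\<gamma> t)) has_real_derivative \<epsilon> * radial p q (arg_of (\<gamma> t)) (norm (\<gamma> t))) (at t)"
    using dr unfolding r_def[symmetric] rad by simp
  have lt: "-1 < X t / r" "X t / r < 1"
  proof -
    have "(X t)\<^sup>2 < r\<^sup>2" using r2 Y by simp
    hence "\<bar>X t\<bar> < r" using r by (metis abs_of_pos abs_less_iff power2_less_imp_less abs_square_less_1 less_imp_le power2_abs)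
    thus "-1 < X t / r" "X t / r < 1" using r by (auto simp: field_simps)
  qed
  have sq: "sqrt (1 - (X t / r)\<^sup>2) = Y t / r"
  proof -
    have "(X t)\<^sup>2 = r\<^sup>2 - (Y t)\<^sup>2" using r2 by simp
    hence "1 - (X t / r)\<^sup>2 = (Y t / r)\<^sup>2" using r by (simp add: power_divide diff_divide_distrib)
    thus ?thesis using r Y by simp
  qed
  have "((\<lambda>t. X t / norm (\<gamma> t)) has_real_derivative (x' * r - X t * ((X t * x' + Y t * y') / r)) / (r * r)) (at t)"
    using DERIV_divide[OF dX dr] r unfolding r_def by auto
  moreover have "(arccos has_real_derivative inverse (- sqrt (1 - (X t / r)\<^sup>2))) (at (X t / norm (\<gamma> t)))"
    using DERIV_arccos[OF lt] by (simp add: r_def)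
  ultimately have "((\<lambda>t. arccos (X t / norm (\<gamma> t))) has_real_derivative
      inverse (- sqrt (1 - (X t / r)\<^sup>2)) * ((x' * r - X t * ((X t * x' + Y t * y') / r)) / (r * r))) (at t)"
    by (intro DERIV_chain2[where f = arccos and g = "\<lambda>t. X t / norm (\<gamma> t)"])
  also have "inverse (- sqrt (1 - (X t / r)\<^sup>2)) * ((x' * r - X t * ((X t * x' + Y t * y') / r)) / (r * r))
      = (X t * y' - Y t * x') / r\<^sup>2"
  proof -
    have "x' * r - X t * ((X t * x' + Y t * y') / r) = (x' * r\<^sup>2 - X t * (X t * x' + Y t * y')) / r"
      using r by (simp add: field_simps power2_eq_square)
    also have "\<dots> = - Y t * (X t * y' - Y t * x') / r" unfolding r2 by (simp add: algebra_simps power2_eq_square)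
    finally show ?thesis unfolding sq using r Y by (simp add: field_simps power2_eq_square)
  qed
  also have "X t * y' - Y t * x' = ((X t)\<^sup>2 + 1) * r\<^sup>2 + \<epsilon> * (X t * Q - Y t * P)"
    unfolding r2 by (simp add: x'_def y'_def algebra_simps power2_eq_square)
  also have "(((X t)\<^sup>2 + 1) * r\<^sup>2 + \<epsilon> * (X t * Q - Y t * P)) / r\<^sup>2 = angular p q \<epsilon> (arg_of (\<gamma> t)) r"
    unfolding ang using r by (simp add: add_divide_distrib)
  finally show "((\<lambda>t. arg_of (\<gamma> t)) has_real_derivative angular p q \<epsilon> (arg_of (\<gamma> t)) (norm (\<gamma> t))) (at t)"
    by (simp add: arg_of_def X_def r_def)
qed

section \<open>The real solution of the scalar equation\<close>

context half_flow begin

definition rad :: "real \<Rightarrow> real \<Rightarrow> real" where "rad \<theta> r = Re (R \<theta> (of_real r))"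

definition slope :: "real \<Rightarrow> real \<Rightarrow> real" where "slope \<theta> r = radial p q \<theta> r / angular p q \<epsilon> \<theta> r"

lemma slopeC_of_real: "slopeC p q \<epsilon> \<theta> (of_real r) = of_real (slope \<theta> r)"
  by (simp add: slopeC_def slope_def radialC_of_real angularC_of_real)

lemma in_nbhd: "x \<in> {r\<^sub>1..r\<^sub>2} \<Longrightarrow> of_real x \<in> box_nbhd r\<^sub>1 r\<^sub>2 (r\<^sub>1 / 4)"
  using radii by (auto simp: of_real_in_box_nbhd)

context
  fixes r assumes r: "r \<in> {r\<^sub>1..r\<^sub>2}"
begin

lemma R_of_real: "\<theta> \<in> {0..pi} \<Longrightarrow> R \<theta> (of_real r) = of_real (rad \<theta> r)"
  using R_real[OF _ in_nbhd[OF r]] by (auto simp: rad_def of_real_Re)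

lemma rad_near: "\<theta> \<in> {0..pi} \<Longrightarrow> \<bar>rad \<theta> r - r\<bar> \<le> C * \<bar>\<epsilon>\<bar>"
  using R_near[OF _ in_nbhd[OF r], of \<theta>] R_of_real[of \<theta>] by (simp flip: of_real_diff)

lemma rad_range: "\<theta> \<in> {0..pi} \<Longrightarrow> r\<^sub>1 - r\<^sub>1 / 8 \<le> rad \<theta> r \<and> rad \<theta> r \<le> r\<^sub>2 + r\<^sub>1 / 8"
  using rad_near[of \<theta>] C_small r by auto

lemma rad_pos: "\<theta> \<in> {0..pi} \<Longrightarrow> 0 < rad \<theta> r"
  using rad_range[of \<theta>] radii by auto

lemma rad_continuous: "continuous_on {0..pi} (\<lambda>\<theta>. rad \<theta> r)"
  unfolding rad_def by (intro continuous_on_Re R_cont in_nbhd r)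

lemma rad_0: "rad 0 r = r"
  using R_eq[OF _ in_nbhd[OF r], of 0] by (simp add: rad_def)

lemma rad_derivative:
  assumes "0 < \<theta>" "\<theta> < pi"
  shows "((\<lambda>\<theta>. rad \<theta> r) has_real_derivative \<epsilon> * slope \<theta> (rad \<theta> r)) (at \<theta>)"
proof -
  have pos: "angular p q \<epsilon> s (rad s r) \<noteq> 0" "rad s r \<noteq> 0" if "s \<in> {0..pi}" for s
    using angular_ge[of "rad s r" s] rad_range[OF that] rad_pos[OF that] radii by auto
  have c: "continuous_on {0..pi} (\<lambda>s. slope s (rad s r))"
    unfolding slope_def radial_def using pos(1) unfolding angular_def cubic_def
    by (intro continuous_intros rad_continuous) (use pos(2) in auto)
  have eq: "rad t r = r + \<epsilon> * integral {0..t} (\<lambda>s. slope s (rad s r))" if t: "t \<in> {0..pi}" for t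
  proof -
    have "((\<lambda>s. complex_of_real (slope s (rad s r))) has_integral of_real (integral {0..t} (\<lambda>s. slope s (rad s r)))) {0..t}"
      by (rule has_integral_linear[OF integrable_integral bounded_linear_of_real, unfolded o_def])
         (use t in \<open>auto intro!: integrable_continuous_real continuous_on_subset[OF c]\<close>)
    hence "((\<lambda>s. slopeC p q \<epsilon> s (R s (of_real r))) has_integral of_real (integral {0..t} (\<lambda>s. slope s (rad s r)))) {0..t}"
      by (rule has_integral_eq[rotated]) (use t in \<open>auto simp: R_of_real slopeC_of_real\<close>)
    hence "complex_of_real (rad t r) = of_real (r + \<epsilon> * integral {0..t} (\<lambda>s. slope s (rad s r)))"
      using R_eq[OF t in_nbhd[OF r]] R_of_real[OF t] by (simp add: integral_unique)
    thus ?thesis by (simp only: of_real_eq_iff)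
  qed
  have "((\<lambda>t. r + \<epsilon> * integral {0..t} (\<lambda>s. slope s (rad s r))) has_real_derivative \<epsilon> * slope \<theta> (rad \<theta> r)) (at \<theta> within {0..pi})"
    by (rule derivative_eq_intros integral_has_real_derivative[OF c] refl)+ (use assms in auto)
  hence "((\<lambda>t. r + \<epsilon> * integral {0..t} (\<lambda>s. slope s (rad s r))) has_real_derivative \<epsilon> * slope \<theta> (rad \<theta> r)) (at \<theta>)"
    using assms by (simp add: at_within_Icc_at)
  thus ?thesis
    by (rule has_field_derivative_transform_within_open[of _ _ _ "{0<..<pi}"]) (use assms eq in auto)
qed
end
end

section \<open>Comparison of planar curves with the scalar solution\<close>

context half_flow begin

text \<open>The constant is such that integration over an angle of at most \<open>\<pi>\<close>
  yields a factor \<open>1 / 2\<close>; the interval for \<open>x\<close> and \<open>y\<close> is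
  the one in which \<open>rad\<close> takes its values.\<close>

lemma slope_Lipschitz:
  assumes "\<theta> \<in> {0..pi}" "x \<in> {r\<^sub>1 - r\<^sub>1 / 8..r\<^sub>2 + r\<^sub>1 / 8}" "y \<in> {r\<^sub>1 - r\<^sub>1 / 8..r\<^sub>2 + r\<^sub>1 / 8}"
  shows "\<bar>\<epsilon> * (slope \<theta> x - slope \<theta> y)\<bar> \<le> \<bar>x - y\<bar> / (2 * pi)"
proof -
  have "of_real x \<in> box_nbhd r\<^sub>1 r\<^sub>2 (3 * r\<^sub>1 / 8)" "of_real y \<in> box_nbhd r\<^sub>1 r\<^sub>2 (3 * r\<^sub>1 / 8)"
    using assms radii by (auto simp: of_real_in_box_nbhd)
  from slope_lip[OF assms(1) this] have "\<bar>\<epsilon>\<bar> * pi * \<bar>slope \<theta> x - slope \<theta> y\<bar> \<le> \<bar>x - y\<bar> / 2"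
    by (simp add: slopeC_of_real flip: of_real_diff)
  thus ?thesis unfolding abs_mult by (simp add: field_simps)
qed

text \<open>No equation is imposed on or below the axis, so that both a Filippov solution and its
  negative, read in the rotated system, qualify.\<close>

definition half_curve :: "(real \<Rightarrow> real \<times> real) \<Rightarrow> bool" where
  "half_curve \<gamma> \<longleftrightarrow> continuous_on UNIV \<gamma> \<and> (\<forall>t. r\<^sub>1 \<le> norm (\<gamma> t) \<and> norm (\<gamma> t) \<le> r\<^sub>2) \<and>
     (\<forall>t. snd (\<gamma> t) > 0 \<longrightarrow> (\<gamma> has_vector_derivative half_field p q \<epsilon> (\<gamma> t)) (at t))"

definition half_arc :: "real \<Rightarrow> (real \<times> real) set" where
  "half_arc r = (\<lambda>\<theta>. (rad \<theta> r * cos \<theta>, rad \<theta> r * sin \<theta>)) ` {0..pi}"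

context
  fixes \<gamma> assumes \<gamma>: "half_curve \<gamma>"
begin

lemma curve_nz: "\<gamma> t \<noteq> 0"
  using \<gamma> radii unfolding half_curve_def by (metis norm_zero not_less)

lemma curve_continuous: "continuous_on S \<gamma>" "continuous_on S (\<lambda>t. snd (\<gamma> t))" "continuous_on S (\<lambda>t. arg_of (\<gamma> t))"
proof -
  show "continuous_on S \<gamma>" using \<gamma> continuous_on_subset unfolding half_curve_def by blast
  thus "continuous_on S (\<lambda>t. snd (\<gamma> t))" "continuous_on S (\<lambda>t. arg_of (\<gamma> t))"
    by (auto intro!: continuous_intros continuous_on_arg_of curve_nz)
qed

lemma curve_derivatives:
  assumes "snd (\<gamma> t) > 0"
  shows "((\<lambda>t. norm (\<gamma> t)) has_real_derivative \<epsilon> * radial p q (arg_of (\<gamma> t)) (norm (\<gamma> t))) (at t)"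
    and "((\<lambda>t. arg_of (\<gamma> t)) has_real_derivative angular p q \<epsilon> (arg_of (\<gamma> t)) (norm (\<gamma> t))) (at t)"
    and "1 / 2 \<le> angular p q \<epsilon> (arg_of (\<gamma> t)) (norm (\<gamma> t))"
proof -
  have d: "(\<gamma> has_vector_derivative half_field p q \<epsilon> (\<gamma> t)) (at t)"
    using \<gamma> assms unfolding half_curve_def by blast
  note polar_derivatives[OF d assms]
  thus "((\<lambda>t. norm (\<gamma> t)) has_real_derivative \<epsilon> * radial p q (arg_of (\<gamma> t)) (norm (\<gamma> t))) (at t)"
    and "((\<lambda>t. arg_of (\<gamma> t)) has_real_derivative angular p q \<epsilon> (arg_of (\<gamma> t)) (norm (\<gamma> t))) (at t)" .
  have "r\<^sub>1 \<le> norm (\<gamma> t)" "norm (\<gamma> t) \<le> r\<^sub>2" using \<gamma> unfolding half_curve_def by auto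
  thus "1 / 2 \<le> angular p q \<epsilon> (arg_of (\<gamma> t)) (norm (\<gamma> t))"
    using radii by (intro angular_ge) auto
qed

lemma arg_increases:
  assumes "a \<le> b" "\<And>t. t \<in> {a<..<b} \<Longrightarrow> snd (\<gamma> t) > 0"
  shows "(b - a) / 2 \<le> arg_of (\<gamma> b) - arg_of (\<gamma> a)"
proof -
  have "arg_of (\<gamma> a) - a / 2 \<le> arg_of (\<gamma> b) - b / 2"
  proof (rule DERIV_nonneg_imp_increasing_open[OF assms(1)])
    fix t assume t: "a < t" "t < b"
    have "((\<lambda>t. arg_of (\<gamma> t) - t / 2) has_real_derivative angular p q \<epsilon> (arg_of (\<gamma> t)) (norm (\<gamma> t)) - 1 / 2) (at t)"
      using t assms(2) by (auto intro!: derivative_eq_intros curve_derivatives)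
    thus "\<exists>y. ((\<lambda>t. arg_of (\<gamma> t) - t / 2) has_real_derivative y) (at t) \<and> 0 \<le> y"
      using curve_derivatives(3)[of t] t assms(2) by force
  qed (intro continuous_intros curve_continuous; simp)
  thus ?thesis by (simp add: field_simps)
qed

text \<open>Above the axis the argument grows at a rate of at least \<open>1 / 2\<close> but cannot
  exceed \<open>\<pi>\<close>, so the curve must leave. At the first exit time the argument is
  positive, which excludes the positive half-axis.\<close>

lemma curve_reaches_negative_axis:
  assumes "\<delta> > 0" "\<And>t. t \<in> {s<..<s + \<delta>} \<Longrightarrow> snd (\<gamma> t) > 0"
  obtains t1 where "t1 > s" "\<And>t. t \<in> {s<..<t1} \<Longrightarrow> snd (\<gamma> t) > 0" "snd (\<gamma> t1) = 0" "fst (\<gamma> t1) < 0"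
proof -
  define u where "u = s + \<delta> / 2"
  have yu: "snd (\<gamma> u) > 0" using assms by (auto simp: u_def)
  define N where "N = {t. u \<le> t \<and> snd (\<gamma> t) \<le> 0}"
  have "N \<noteq> {}"
  proof
    assume "N = {}"
    have "snd (\<gamma> t) > 0" if "t > u" for t
    proof (rule ccontr)
      assume "\<not> ?thesis"
      hence "t \<in> N" using that by (simp add: N_def)
      thus False using \<open>N = {}\<close> by simp
    qed
    \<comment> \<open>Staying above the axis for time \<open>8\<close> would raise the argument by
      at least \<open>4\<close>, which exceeds \<open>\<pi>\<close>.\<close>
    hence "(u + 8 - u) / 2 \<le> arg_of (\<gamma> (u + 8)) - arg_of (\<gamma> u)" by (intro arg_increases) auto
    moreover have "arg_of (\<gamma> (u + 8)) \<le> pi" "0 \<le> arg_of (\<gamma> u)" using arg_of_bounds curve_nz by auto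
    ultimately show False using pi_less_4 by simp
  qed
  have "closed N"
  proof -
    have "N = {u..} \<inter> (\<lambda>t. snd (\<gamma> t)) -` {..0}" by (auto simp: N_def)
    moreover have "closed ((\<lambda>t. snd (\<gamma> t)) -` {..0})"
      using continuous_closed_vimage[of "{..0}" "\<lambda>t. snd (\<gamma> t)"] curve_continuous(2)[of UNIV]
      by (simp add: continuous_on_eq_continuous_at)
    ultimately show ?thesis by (simp add: closed_Int)
  qed
  define t1 where "t1 = Inf N"
  have bdd: "bdd_below N" by (auto simp: N_def bdd_below_def)
  have t1: "t1 \<in> N" unfolding t1_def by (rule closed_contains_Inf[OF \<open>N \<noteq> {}\<close> bdd \<open>closed N\<close>])
  have least: "t1 \<le> t" if "t \<in> N" for t unfolding t1_def using that bdd by (rule cInf_lower)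
  have pos: "snd (\<gamma> t) > 0" if "t \<in> {u..<t1}" for t
    using least[of t] that by (force simp: N_def)
  have ut: "u < t1" using t1 yu by (cases "t1 = u") (auto simp: N_def)
  have y0: "snd (\<gamma> t1) = 0"
  proof (rule ccontr)
    assume "snd (\<gamma> t1) \<noteq> 0"
    hence neg: "snd (\<gamma> t1) < 0" using t1 by (auto simp: N_def)
    then obtain x where "u \<le> x" "x \<le> t1" "snd (\<gamma> x) = 0"
      using IVT2'[of "\<lambda>t. snd (\<gamma> t)" t1 0 u] yu ut curve_continuous(2) by auto
    thus False using least[of x] neg by (cases "x = t1") (auto simp: N_def)
  qed
  have "(t1 - u) / 2 \<le> arg_of (\<gamma> t1) - arg_of (\<gamma> u)" using ut pos by (intro arg_increases) auto
  hence "arg_of (\<gamma> t1) > 0" using arg_of_bounds[OF curve_nz, of u] ut by auto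
  hence "\<not> fst (\<gamma> t1) > 0" using arg_of_on_axis(1)[OF curve_nz y0] by auto
  moreover have "fst (\<gamma> t1) \<noteq> 0" using curve_nz[of t1] y0 by (auto simp: prod_eq_iff)
  ultimately have "fst (\<gamma> t1) < 0" by simp
  moreover have "snd (\<gamma> t) > 0" if "t \<in> {s<..<t1}" for t
    using pos[of t] assms(2)[of t] that \<open>\<delta> > 0\<close> by (cases "t < u") (auto simp: u_def)
  moreover have "s < t1" using ut \<open>\<delta> > 0\<close> by (simp add: u_def)
  ultimately show ?thesis using y0 that by blast
qed

text \<open>A uniqueness argument with the polar angle as independent variable: \<open>e\<close>
  compares the radius of the curve with the scalar solution at the same angle. It is differentiable
  only strictly between \<open>s\<close> and \<open>t1\<close>, and continuity covers the two points
  on the axis.\<close>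

lemma curve_traces_arc:
  assumes st: "s < t1" and pos: "\<And>t. t \<in> {s<..<t1} \<Longrightarrow> snd (\<gamma> t) > 0"
    and s: "snd (\<gamma> s) = 0" "fst (\<gamma> s) > 0" and t1: "snd (\<gamma> t1) = 0" "fst (\<gamma> t1) < 0"
  shows "fst (\<gamma> s) \<in> {r\<^sub>1..r\<^sub>2}" "fst (\<gamma> t1) = - rad pi (fst (\<gamma> s))" "\<gamma> ` {s..t1} = half_arc (fst (\<gamma> s))"
proof -
  define r where "r = fst (\<gamma> s)"
  define \<theta> where "\<theta> t = arg_of (\<gamma> t)" for t
  have ns: "norm (\<gamma> s) = r" using s by (simp add: norm_prod_def r_def)
  have ann: "r\<^sub>1 \<le> norm (\<gamma> t)" "norm (\<gamma> t) \<le> r\<^sub>2" for t using \<gamma> unfolding half_curve_def by auto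
  show r: "fst (\<gamma> s) \<in> {r\<^sub>1..r\<^sub>2}" using ann[of s] ns by (simp add: r_def)
  note r = r[folded r_def]
  have \<theta>s: "\<theta> s = 0" and \<theta>1: "\<theta> t1 = pi" using arg_of_on_axis curve_nz s t1 by (auto simp: \<theta>_def)
  have \<theta>b: "\<theta> t \<in> {0..pi}" for t using arg_of_bounds[OF curve_nz] by (simp add: \<theta>_def)
  have \<theta>i: "0 < \<theta> t" "\<theta> t < pi" if "t \<in> {s<..<t1}" for t
    using arg_increases[of s t] arg_increases[of t t1] pos that \<theta>s \<theta>1 by (auto simp: \<theta>_def)
  have \<theta>c: "continuous_on S \<theta>" for S unfolding \<theta>_def by (rule curve_continuous)
  define e where "e t = norm (\<gamma> t) - rad (\<theta> t) r" for t
  have ec: "continuous_on {s..t1} e"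
  proof -
    have "continuous_on {s..t1} (\<lambda>t. rad (\<theta> t) r)"
      by (rule continuous_on_compose2[OF rad_continuous[OF r] \<theta>c]) (use \<theta>b in auto)
    thus ?thesis unfolding e_def by (intro continuous_intros curve_continuous)
  qed
  obtain m where m: "m \<in> {s..t1}" "\<And>t. t \<in> {s..t1} \<Longrightarrow> \<bar>e t\<bar> \<le> \<bar>e m\<bar>"
    using continuous_attains_sup[OF _ _ continuous_on_rabs[OF ec]] st by force
  have e': "(e has_real_derivative angular p q \<epsilon> (\<theta> t) (norm (\<gamma> t)) * (\<epsilon> * (slope (\<theta> t) (norm (\<gamma> t)) - slope (\<theta> t) (rad (\<theta> t) r)))) (at t)"
    if t: "t \<in> {s<..<t1}" for t
  proof -
    note d = curve_derivatives[OF pos[OF t]]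
    have "((\<lambda>t. rad (\<theta> t) r) has_real_derivative \<epsilon> * slope (\<theta> t) (rad (\<theta> t) r) * angular p q \<epsilon> (\<theta> t) (norm (\<gamma> t))) (at t)"
      using DERIV_chain2[where f = "\<lambda>\<theta>. rad \<theta> r" and g = \<theta>, OF rad_derivative[OF r \<theta>i[OF t]]] d(2) by (simp add: \<theta>_def[abs_def])
    hence "(e has_real_derivative \<epsilon> * radial p q (\<theta> t) (norm (\<gamma> t)) - \<epsilon> * slope (\<theta> t) (rad (\<theta> t) r) * angular p q \<epsilon> (\<theta> t) (norm (\<gamma> t))) (at t)"
      unfolding e_def[abs_def] using d(1) by (intro DERIV_diff) (auto simp: \<theta>_def)
    moreover have "radial p q (\<theta> t) (norm (\<gamma> t)) = angular p q \<epsilon> (\<theta> t) (norm (\<gamma> t)) * slope (\<theta> t) (norm (\<gamma> t))"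
      using d(3) by (auto simp: slope_def \<theta>_def)
    ultimately show ?thesis by (simp add: algebra_simps)
  qed
  \<comment> \<open>By the Lipschitz bound the maximum of \<open>\<bar>e\<bar>\<close> is at most half of itself.\<close>
  have e0: "e m = 0"
  proof (cases "m = s")
    case True thus ?thesis using rad_0[OF r] by (simp add: e_def \<theta>s ns)
  next
    case False
    hence sm: "s < m" using m by auto
    define E where "E = \<bar>e m\<bar> / (2 * pi)"
    have "norm (e m - e s) \<le> E * \<theta> m - E * \<theta> s"
    proof (rule differentiable_bound_general[OF sm])
      show "continuous_on {s..m} e" using ec m by (auto elim: continuous_on_subset)
      show "continuous_on {s..m} (\<lambda>t. E * \<theta> t)" by (intro continuous_intros \<theta>c)
      fix t assume "s < t" "t < m"
      hence t: "t \<in> {s<..<t1}" using m by auto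
      note d = curve_derivatives[OF pos[OF t], folded \<theta>_def]
      show "(e has_vector_derivative angular p q \<epsilon> (\<theta> t) (norm (\<gamma> t)) * (\<epsilon> * (slope (\<theta> t) (norm (\<gamma> t)) - slope (\<theta> t) (rad (\<theta> t) r)))) (at t)"
        using e'[OF t] by (simp add: has_real_derivative_iff_has_vector_derivative)
      show "((\<lambda>t. E * \<theta> t) has_vector_derivative E * angular p q \<epsilon> (\<theta> t) (norm (\<gamma> t))) (at t)"
        using d(2) by (auto intro!: derivative_eq_intros simp flip: has_real_derivative_iff_has_vector_derivative)
      have "\<bar>\<epsilon> * (slope (\<theta> t) (norm (\<gamma> t)) - slope (\<theta> t) (rad (\<theta> t) r))\<bar> \<le> \<bar>norm (\<gamma> t) - rad (\<theta> t) r\<bar> / (2 * pi)"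
        using ann[of t] rad_range[OF r \<theta>b, of t] radii \<theta>b by (intro slope_Lipschitz) auto
      also have "\<dots> \<le> E" using m(2)[of t] t by (auto simp: E_def e_def intro!: divide_right_mono)
      finally show "norm (angular p q \<epsilon> (\<theta> t) (norm (\<gamma> t)) * (\<epsilon> * (slope (\<theta> t) (norm (\<gamma> t)) - slope (\<theta> t) (rad (\<theta> t) r))))
          \<le> E * angular p q \<epsilon> (\<theta> t) (norm (\<gamma> t))"
        using d(3) by (simp add: abs_mult mult.commute[of E] mult_left_mono)
    qed
    moreover have "e s = 0" using rad_0[OF r] by (simp add: e_def \<theta>s ns)
    moreover have "E * \<theta> m \<le> E * pi" using \<theta>b[of m] by (intro mult_left_mono) (auto simp: E_def)
    ultimately have "\<bar>e m\<bar> \<le> E * pi" using \<theta>s by simp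
    thus ?thesis by (simp add: E_def)
  qed
  have n: "norm (\<gamma> t) = rad (\<theta> t) r" if "t \<in> {s..t1}" for t using m(2)[OF that] e0 by (simp add: e_def)
  have y: "0 \<le> snd (\<gamma> t)" if "t \<in> {s..t1}" for t
    using pos[of t] that s t1 by (cases "t = s \<or> t = t1") auto
  have g: "\<gamma> t = (rad (\<theta> t) r * cos (\<theta> t), rad (\<theta> t) r * sin (\<theta> t))" if "t \<in> {s..t1}" for t
    using polar_coordinates[OF curve_nz y[OF that]] n[OF that] by (simp add: \<theta>_def prod_eq_iff)
  show "fst (\<gamma> t1) = - rad pi (fst (\<gamma> s))" using g[of t1] st by (simp add: \<theta>1 r_def)
  have "\<theta> ` {s..t1} = {0..pi}"
  proof
    show "\<theta> ` {s..t1} \<subseteq> {0..pi}" using \<theta>b by auto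
    show "{0..pi} \<subseteq> \<theta> ` {s..t1}"
    proof
      fix x assume "x \<in> {0..pi}"
      thus "x \<in> \<theta> ` {s..t1}" using IVT'[of \<theta> s x t1] \<theta>s \<theta>1 \<theta>c st by auto
    qed
  qed
  moreover have "\<gamma> ` {s..t1} = (\<lambda>\<theta>. (rad \<theta> r * cos \<theta>, rad \<theta> r * sin \<theta>)) ` (\<theta> ` {s..t1})"
    using g by (force simp: image_image intro!: image_cong)
  ultimately show "\<gamma> ` {s..t1} = half_arc (fst (\<gamma> s))" by (simp add: half_arc_def r_def)
qed
end
end

section \<open>Filippov solutions and the return map\<close>

text \<open>The index \<open>3 - k\<close> exchanges \<open>1\<close> and \<open>2\<close>, so the
  upper half of the rotated system is the lower half of the given one.\<close>

definition rotated :: "coeffs \<Rightarrow> coeffs" where "rotated a k = rotate (a (3 - k))"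

lemma half_field_rotate: "half_field (rotate p) (rotate q) \<epsilon> z = - half_field p q \<epsilon> (- z)"
  by (simp add: half_field_def case_prod_beta cubic_rotate algebra_simps)

lemma filippov_field_rotated: "filippov_field (rotated a) (rotated b) \<epsilon> z = uminus ` filippov_field a b \<epsilon> (- z)"
proof -
  have "closed_segment (- u) (- v) = uminus ` closed_segment v u" for u v :: "real \<times> real"
    using closed_segment_linear_image[of "uminus :: real \<times> real \<Rightarrow> _" u v] bounded_linear.linear[OF bounded_linear_minus[OF bounded_linear_ident]]
    by (simp add: closed_segment_commute)
  thus ?thesis by (simp add: filippov_field_def vfield_half_field rotated_def half_field_rotate)
qed

lemma inclusion_solution_rotated:
  assumes "inclusion_solution (filippov_field a b \<epsilon>) \<gamma>"
  shows "inclusion_solution (filippov_field (rotated a) (rotated b) \<epsilon>) (\<lambda>t. - \<gamma> t)"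
proof -
  obtain v where v: "\<And>t. v t \<in> filippov_field a b \<epsilon> (\<gamma> t)"
    "\<And>s t. s \<le> t \<Longrightarrow> v absolutely_integrable_on {s..t} \<and> (v has_integral (\<gamma> t - \<gamma> s)) {s..t}"
    using assms unfolding inclusion_solution_def by blast
  show ?thesis unfolding inclusion_solution_def
  proof (intro exI[of _ "\<lambda>t. - v t"] conjI allI impI)
    show "- v t \<in> filippov_field (rotated a) (rotated b) \<epsilon> (- \<gamma> t)" for t
      using v(1)[of t] by (simp add: filippov_field_rotated)
    fix s t :: real assume "s \<le> t"
    note v = v(2)[OF this]
    show "(\<lambda>t. - v t) absolutely_integrable_on {s..t}"
      using absolutely_integrable_linear[OF conjunct1[OF v] bounded_linear_minus[OF bounded_linear_ident]] by (simp add: o_def)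
    show "((\<lambda>t. - v t) has_integral (- \<gamma> t - - \<gamma> s)) {s..t}"
      using has_integral_neg[of v "\<gamma> t - \<gamma> s"] v by simp
  qed
qed

lemma continuous_positive_near:
  fixes f :: "real \<Rightarrow> real"
  assumes "continuous_on UNIV f" "f s > 0"
  shows "\<exists>\<delta>>0. \<forall>t. \<bar>t - s\<bar> < \<delta> \<longrightarrow> f t > 0"
proof -
  obtain \<delta> where \<delta>: "\<delta> > 0" "\<And>t. dist t s < \<delta> \<Longrightarrow> dist (f t) (f s) < f s"
    using assms unfolding continuous_on_iff by blast
  show ?thesis
  proof (intro exI[of _ \<delta>] conjI allI impI \<delta>(1))
    fix t assume "\<bar>t - s\<bar> < \<delta>"
    hence "\<bar>f t - f s\<bar> < f s" using \<delta>(2)[of t] by (simp add: dist_real_def)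
    thus "f t > 0" by linarith
  qed
qed

text \<open>The condition \<open>crossing\<close> covers every Filippov velocity, not only the two
  one-sided fields; this rules out sliding along the positive axis and makes the choice of selection
  there harmless.\<close>

locale annulus_flow = half_flow "a 1" "b 1" r\<^sub>1 r\<^sub>2 \<epsilon> C R
  for a b :: coeffs and r\<^sub>1 r\<^sub>2 \<epsilon> C :: real and R +
  fixes V :: real
  assumes crossing: "\<And>z w. r\<^sub>1 / 2 \<le> fst z \<Longrightarrow> norm z \<le> r\<^sub>2 \<Longrightarrow> w \<in> filippov_field a b \<epsilon> z \<Longrightarrow> r\<^sub>1 / 4 \<le> snd w"
    and speed: "\<And>z w. norm z \<le> r\<^sub>2 \<Longrightarrow> w \<in> filippov_field a b \<epsilon> z \<Longrightarrow> norm w \<le> V"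
    and V_pos: "V > 0"
begin

context
  fixes \<gamma> assumes sol: "inclusion_solution (filippov_field a b \<epsilon>) \<gamma>"
    and ann: "\<And>t. r\<^sub>1 \<le> norm (\<gamma> t) \<and> norm (\<gamma> t) \<le> r\<^sub>2"
begin

lemma solution_Lipschitz: "s \<le> t \<Longrightarrow> norm (\<gamma> t - \<gamma> s) \<le> V * (t - s)"
proof -
  assume st: "s \<le> t"
  obtain v where v: "\<And>t. v t \<in> filippov_field a b \<epsilon> (\<gamma> t)" "(v has_integral (\<gamma> t - \<gamma> s)) {s..t}"
    using sol st unfolding inclusion_solution_def by blast
  have "norm (\<gamma> t - \<gamma> s) \<le> V * measure lborel {s..t}"
    by (rule has_integral_bound_real[OF less_imp_le[OF V_pos] finite.emptyI v(2)])
       (rule speed[OF conjunct2[OF ann] v(1)])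
  thus ?thesis using st by simp
qed

lemma solution_continuous: "continuous_on S \<gamma>"
proof -
  have "isCont \<gamma> t" for t
  proof (unfold continuous_at_eps_delta, intro allI impI)
    fix e :: real assume e: "0 < e"
    have "dist (\<gamma> s) (\<gamma> t) < e" if "dist s t < e / V" for s
    proof -
      have "norm (\<gamma> s - \<gamma> t) \<le> V * \<bar>s - t\<bar>"
        using solution_Lipschitz[of s t] solution_Lipschitz[of t s] by (cases "s \<le> t") (auto simp: norm_minus_commute)
      also have "\<dots> < e" using that V_pos by (simp add: dist_real_def field_simps)
      finally show ?thesis by (simp add: dist_norm)
    qed
    thus "\<exists>d>0. \<forall>s. dist s t < d \<longrightarrow> dist (\<gamma> s) (\<gamma> t) < e" using e V_pos by (intro exI[of _ "e / V"]) auto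
  qed
  thus ?thesis by (simp add: continuous_at_imp_continuous_on)
qed

text \<open>Off the axis the Filippov set is a singleton, so the selection equals a continuous
  function of time near \<open>t\<close>, and its indefinite integral is differentiable at
  \<open>t\<close> itself rather than only almost everywhere.\<close>

lemma solution_upper_derivative:
  assumes "snd (\<gamma> t) > 0" shows "(\<gamma> has_vector_derivative half_field (a 1) (b 1) \<epsilon> (\<gamma> t)) (at t)"
proof -
  obtain v where v: "\<And>t. v t \<in> filippov_field a b \<epsilon> (\<gamma> t)" "\<And>s t. s \<le> t \<Longrightarrow> (v has_integral (\<gamma> t - \<gamma> s)) {s..t}"
    using sol unfolding inclusion_solution_def by blast
  obtain d where d: "d > 0" "\<And>u. \<bar>u - t\<bar> < d \<Longrightarrow> snd (\<gamma> u) > 0"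
    using continuous_positive_near[OF continuous_on_snd[OF solution_continuous] assms] by blast
  define \<delta> where "\<delta> = d / 2"
  have \<delta>: "\<delta> > 0" using d by (simp add: \<delta>_def)
  have pos: "snd (\<gamma> u) > 0" if "u \<in> {t - \<delta>..t + \<delta>}" for u
    using that d by (auto simp: \<delta>_def)
  let ?f = "\<lambda>u. half_field (a 1) (b 1) \<epsilon> (\<gamma> u)"
  have veq: "v u = ?f u" if "u \<in> {t - \<delta>..t + \<delta>}" for u
    using v(1)[of u] pos[OF that] by (simp add: filippov_field_def vfield_half_field)
  have c: "continuous_on {t - \<delta>..t + \<delta>} ?f"
    unfolding half_field_def case_prod_beta cubic_def by (intro continuous_intros solution_continuous)
  have "((\<lambda>u. \<gamma> (t - \<delta>) + integral {t - \<delta>..u} ?f) has_vector_derivative ?f t) (at t within {t - \<delta>..t + \<delta>})"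
    using integral_has_vector_derivative[OF c, of t] \<delta> by (auto intro!: derivative_eq_intros)
  hence "((\<lambda>u. \<gamma> (t - \<delta>) + integral {t - \<delta>..u} ?f) has_vector_derivative ?f t) (at t)"
    using \<delta> by (simp add: at_within_Icc_at)
  thus ?thesis
  proof (rule has_vector_derivative_transform_within_open[of _ _ _ "{t - \<delta><..<t + \<delta>}"])
    fix u assume u: "u \<in> {t - \<delta><..<t + \<delta>}"
    have "(?f has_integral (\<gamma> u - \<gamma> (t - \<delta>))) {t - \<delta>..u}"
      by (rule has_integral_eq[OF _ v(2)]) (use u veq in auto)
    thus "\<gamma> (t - \<delta>) + integral {t - \<delta>..u} ?f = \<gamma> u" by (simp add: integral_unique)
  qed (use \<delta> in auto)
qed

lemma solution_half_curve: "half_curve \<gamma>"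
  unfolding half_curve_def using solution_continuous solution_upper_derivative ann by blast

text \<open>Near the positive axis any selection has vertical component at least
  \<open>r\<^sub>1 / 4\<close>; integrating it makes the height positive at once, whichever
  velocities are taken on the axis.\<close>

lemma solution_enters_upper:
  assumes "snd (\<gamma> s) = 0" "fst (\<gamma> s) > 0"
  shows "\<exists>\<delta>>0. \<forall>t\<in>{s<..<s + \<delta>}. snd (\<gamma> t) > 0"
proof -
  obtain v where v: "\<And>t. v t \<in> filippov_field a b \<epsilon> (\<gamma> t)" "\<And>s t. s \<le> t \<Longrightarrow> (v has_integral (\<gamma> t - \<gamma> s)) {s..t}"
    using sol unfolding inclusion_solution_def by blast
  have "norm (\<gamma> s) = fst (\<gamma> s)" using assms by (simp add: norm_prod_def)
  hence p: "fst (\<gamma> s) - r\<^sub>1 / 2 > 0" using ann[of s] radii by auto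
  obtain \<delta> where \<delta>: "\<delta> > 0" "\<And>t. \<bar>t - s\<bar> < \<delta> \<Longrightarrow> fst (\<gamma> t) - r\<^sub>1 / 2 > 0"
    using continuous_positive_near[OF continuous_on_diff[OF continuous_on_fst[OF solution_continuous] continuous_on_const] p] by blast
  have "snd (\<gamma> t) > 0" if t: "t \<in> {s<..<s + \<delta>}" for t
  proof -
    have i: "((\<lambda>u. snd (v u)) has_integral snd (\<gamma> t - \<gamma> s)) {s..t}"
      using has_integral_linear[OF v(2)[of s t] bounded_linear_snd] t by (simp add: o_def)
    have "((\<lambda>u. r\<^sub>1 / 4) has_integral (t - s) * (r\<^sub>1 / 4)) {s..t}"
      using has_integral_const_real[of "r\<^sub>1 / 4" s t] t by simp
    hence "(t - s) * (r\<^sub>1 / 4) \<le> snd (\<gamma> t - \<gamma> s)"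
    proof (rule has_integral_le[OF _ i])
      fix u assume "u \<in> {s..t}"
      hence "fst (\<gamma> u) > r\<^sub>1 / 2" using t \<delta>(2)[of u] by auto
      thus "r\<^sub>1 / 4 \<le> snd (v u)" using crossing[OF _ _ v(1)[of u]] ann[of u] by auto
    qed
    moreover have "(t - s) * (r\<^sub>1 / 4) > 0" using t radii by simp
    ultimately show ?thesis using assms by simp
  qed
  thus ?thesis using \<delta>(1) by blast
qed

text \<open>The ends of the arc lie at distance at least \<open>2 * r\<^sub>1\<close> and the speed
  is at most \<open>V\<close>, hence the bound on the duration. It prevents crossing times from
  accumulating.\<close>

lemma solution_upper_arc:
  assumes "snd (\<gamma> s) = 0" "fst (\<gamma> s) > 0"
  obtains t1 where "s + 2 * r\<^sub>1 / V \<le> t1" "\<And>t. t \<in> {s<..<t1} \<Longrightarrow> snd (\<gamma> t) > 0" "snd (\<gamma> t1) = 0" "fst (\<gamma> t1) < 0"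
    "fst (\<gamma> s) \<in> {r\<^sub>1..r\<^sub>2}" "fst (\<gamma> t1) = - rad pi (fst (\<gamma> s))" "\<gamma> ` {s..t1} = half_arc (fst (\<gamma> s))"
proof -
  obtain \<delta> where "\<delta> > 0" "\<forall>t\<in>{s<..<s + \<delta>}. snd (\<gamma> t) > 0" using solution_enters_upper[OF assms] by blast
  then obtain t1 where t1: "t1 > s" "\<And>t. t \<in> {s<..<t1} \<Longrightarrow> snd (\<gamma> t) > 0" "snd (\<gamma> t1) = 0" "fst (\<gamma> t1) < 0"
    using curve_reaches_negative_axis[OF solution_half_curve, of \<delta> s] by metis
  note arc = curve_traces_arc[OF solution_half_curve t1(1,2) assms t1(3,4)]
  have "norm (\<gamma> t1) = - fst (\<gamma> t1)" using t1 by (simp add: norm_prod_def)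
  hence "2 * r\<^sub>1 \<le> fst (\<gamma> s) - fst (\<gamma> t1)" using ann[of t1] arc(1) by auto
  also have "\<dots> \<le> norm (\<gamma> t1 - \<gamma> s)" using abs_fst_le_norm[of "\<gamma> t1 - \<gamma> s"] by simp
  also have "\<dots> \<le> V * (t1 - s)" using t1 by (intro solution_Lipschitz) auto
  finally have "s + 2 * r\<^sub>1 / V \<le> t1" using V_pos by (simp add: field_simps)
  thus ?thesis using that t1 arc by blast
qed
end
end

section \<open>Both half-planes together: first returns to the positive axis\<close>

locale annulus_system = upper: annulus_flow a b r\<^sub>1 r\<^sub>2 \<epsilon> C R V + lower: annulus_flow "rotated a" "rotated b" r\<^sub>1 r\<^sub>2 \<epsilon> C' R' V'
  for a b :: coeffs and r\<^sub>1 r\<^sub>2 \<epsilon> C R V C' R' V'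
begin

definition return_map :: "real \<Rightarrow> real" where "return_map r = lower.rad pi (upper.rad pi r)"

definition orbit :: "real \<Rightarrow> (real \<times> real) set" where
  "orbit r = upper.half_arc r \<union> uminus ` lower.half_arc (upper.rad pi r)"

definition on_axis :: "real \<times> real \<Rightarrow> bool" where "on_axis z \<longleftrightarrow> snd z = 0 \<and> fst z > 0"

context
  fixes \<gamma> assumes sol: "inclusion_solution (filippov_field a b \<epsilon>) \<gamma>"
    and ann: "\<And>t. r\<^sub>1 \<le> norm (\<gamma> t) \<and> norm (\<gamma> t) \<le> r\<^sub>2"
begin

lemma sol': "inclusion_solution (filippov_field (rotated a) (rotated b) \<epsilon>) (\<lambda>t. - \<gamma> t)"
  and ann': "\<And>t. r\<^sub>1 \<le> norm (- \<gamma> t) \<and> norm (- \<gamma> t) \<le> r\<^sub>2"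
  using inclusion_solution_rotated[OF sol] ann by simp_all

lemma first_return:
  assumes "on_axis (\<gamma> s)"
  shows "\<exists>t2 \<ge> s + 2 * r\<^sub>1 / V. on_axis (\<gamma> t2) \<and> fst (\<gamma> t2) = return_map (fst (\<gamma> s)) \<and> \<gamma> ` {s..t2} = orbit (fst (\<gamma> s))
     \<and> (\<forall>t\<in>{s<..<t2}. \<not> on_axis (\<gamma> t)) \<and> fst (\<gamma> s) \<in> {r\<^sub>1..r\<^sub>2} \<and> upper.rad pi (fst (\<gamma> s)) \<in> {r\<^sub>1..r\<^sub>2}"
proof -
  obtain t1 where t1: "s + 2 * r\<^sub>1 / V \<le> t1" "\<And>t. t \<in> {s<..<t1} \<Longrightarrow> snd (\<gamma> t) > 0" "snd (\<gamma> t1) = 0" "fst (\<gamma> t1) < 0"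
    "fst (\<gamma> s) \<in> {r\<^sub>1..r\<^sub>2}" "fst (\<gamma> t1) = - upper.rad pi (fst (\<gamma> s))" "\<gamma> ` {s..t1} = upper.half_arc (fst (\<gamma> s))"
    using upper.solution_upper_arc[OF sol ann, of s] assms unfolding on_axis_def by metis
  have "snd (- \<gamma> t1) = 0" "fst (- \<gamma> t1) > 0" using t1 by auto
  then obtain t2 where t2: "t1 + 2 * r\<^sub>1 / V' \<le> t2" "\<And>t. t \<in> {t1<..<t2} \<Longrightarrow> snd (- \<gamma> t) > 0" "snd (- \<gamma> t2) = 0" "fst (- \<gamma> t2) < 0"
    "fst (- \<gamma> t1) \<in> {r\<^sub>1..r\<^sub>2}" "fst (- \<gamma> t2) = - lower.rad pi (fst (- \<gamma> t1))" "(\<lambda>t. - \<gamma> t) ` {t1..t2} = lower.half_arc (fst (- \<gamma> t1))"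
    using lower.solution_upper_arc[OF sol' ann', of t1] by metis
  have st: "s < t1" "t1 < t2"
  proof -
    have "2 * r\<^sub>1 / V > 0" "2 * r\<^sub>1 / V' > 0" using upper.radii upper.V_pos lower.V_pos by auto
    thus "s < t1" "t1 < t2" using t1(1) t2(1) by linarith+
  qed
  have "\<gamma> ` {s..t2} = \<gamma> ` {s..t1} \<union> \<gamma> ` {t1..t2}"
    using st by (simp add: ivl_disj_un_two_touch flip: image_Un)
  also have "\<gamma> ` {t1..t2} = uminus ` ((\<lambda>t. - \<gamma> t) ` {t1..t2})" by (simp add: image_image)
  finally have "\<gamma> ` {s..t2} = orbit (fst (\<gamma> s))" using t1(6,7) t2(7) by (simp add: orbit_def)
  moreover have "\<not> on_axis (\<gamma> t)" if "t \<in> {s<..<t2}" for t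
    using t1(2)[of t] t2(2)[of t] t1(3,4) that by (cases t t1 rule: linorder_cases) (auto simp: on_axis_def)
  moreover have "on_axis (\<gamma> t2)" using t2 by (simp add: on_axis_def)
  moreover have "fst (\<gamma> t2) = return_map (fst (\<gamma> s))" using t2(6) t1(6) by (simp add: return_map_def)
  moreover have "upper.rad pi (fst (\<gamma> s)) \<in> {r\<^sub>1..r\<^sub>2}" using t2(5) t1(6) by simp
  moreover have "s + 2 * r\<^sub>1 / V \<le> t2" using t1(1) st by simp
  ultimately show ?thesis using t1(5) by blast
qed

text \<open>From the upper half-plane a solution runs to the negative axis, from there into the
  lower half-plane, and from there to the positive axis; the three cases enter this cycle at
  different places.\<close>

lemma crossing_exists: "\<exists>s. on_axis (\<gamma> s)"
proof -
  note uc = upper.solution_half_curve[OF sol ann] and lc = lower.solution_half_curve[OF sol' ann']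
  have pos: "\<exists>t1. (snd (\<gamma> t1) = 0 \<and> fst (\<gamma> t1) < 0)" if p: "snd (\<gamma> s) > 0" for s
  proof -
    obtain \<delta> where \<delta>: "\<delta> > 0" "\<And>t. \<bar>t - s\<bar> < \<delta> \<Longrightarrow> snd (\<gamma> t) > 0"
      using continuous_positive_near[OF upper.curve_continuous(2)[OF uc] p] by blast
    hence "snd (\<gamma> t) > 0" if "t \<in> {s<..<s+\<delta>}" for t using that by auto
    from \<delta>(1) this obtain t1 where "snd (\<gamma> t1) = 0" "fst (\<gamma> t1) < 0"
      using upper.curve_reaches_negative_axis[OF uc, of \<delta> s] by metis
    thus ?thesis by blast
  qed
  have neg: "\<exists>t1. on_axis (\<gamma> t1)" if "snd (\<gamma> s) < 0" for s
  proof -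
    have p: "snd (- \<gamma> s) > 0" using that by simp
    obtain \<delta> where \<delta>: "\<delta> > 0" "\<And>t. \<bar>t - s\<bar> < \<delta> \<Longrightarrow> snd (- \<gamma> t) > 0"
      using continuous_positive_near[OF lower.curve_continuous(2)[OF lc] p] by blast
    hence "snd (- \<gamma> t) > 0" if "t \<in> {s<..<s+\<delta>}" for t using that by auto
    from \<delta>(1) this obtain t1 where "snd (- \<gamma> t1) = 0" "fst (- \<gamma> t1) < 0"
      using lower.curve_reaches_negative_axis[OF lc, of \<delta> s] by metis
    hence "on_axis (\<gamma> t1)" by (simp add: on_axis_def)
    thus ?thesis by blast
  qed
  have zero: "\<exists>t1. on_axis (\<gamma> t1)" if z: "snd (\<gamma> s) = 0" "fst (\<gamma> s) < 0" for s
  proof -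
    obtain \<delta> where \<delta>: "\<delta> > 0" "\<forall>t\<in>{s<..<s + \<delta>}. snd (- \<gamma> t) > 0"
      using lower.solution_enters_upper[OF sol' ann', of s] z by auto
    hence "snd (\<gamma> (s + \<delta> / 2)) < 0" by auto
    thus ?thesis by (rule neg)
  qed
  have "fst (\<gamma> 0) \<noteq> 0 \<or> snd (\<gamma> 0) \<noteq> 0" using upper.curve_nz[OF uc, of 0] by (auto simp: prod_eq_iff)
  thus ?thesis using pos[of 0] neg[of 0] zero on_axis_def by (metis linorder_cases)
qed
end
end

section \<open>Periodic orbits are fixed points of the return map\<close>

context annulus_system begin

lemma axis_point_in_orbit: "r \<in> {r\<^sub>1..r\<^sub>2} \<Longrightarrow> (r, 0) \<in> orbit r"
  unfolding orbit_def upper.half_arc_def using upper.rad_0[of r]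
  by (intro UnI1 image_eqI[of _ _ 0]) auto

text \<open>For a general \<open>r\<close> the lower arc ends at \<open>return_map r\<close>, which
  would be a second point on the positive axis; the fixed-point hypothesis merges it with the
  starting point.\<close>

lemma orbit_axis_point:
  assumes r: "r \<in> {r\<^sub>1..r\<^sub>2}" "upper.rad pi r \<in> {r\<^sub>1..r\<^sub>2}" "return_map r = r" and z: "z \<in> orbit r" "on_axis z"
  shows "z = (r, 0)"
proof -
  have sin0: "\<theta> = 0 \<or> \<theta> = pi" if "\<theta> \<in> {0..pi}" "sin \<theta> = 0" for \<theta>
    using that sin_gt_zero[of \<theta>] by (cases "\<theta> = 0 \<or> \<theta> = pi") auto
  from z(1) consider \<theta> where "\<theta> \<in> {0..pi}" "z = (upper.rad \<theta> r * cos \<theta>, upper.rad \<theta> r * sin \<theta>)"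
    | \<theta> where "\<theta> \<in> {0..pi}" "z = - (lower.rad \<theta> (upper.rad pi r) * cos \<theta>, lower.rad \<theta> (upper.rad pi r) * sin \<theta>)"
    unfolding orbit_def upper.half_arc_def lower.half_arc_def by blast
  thus ?thesis
  proof cases
    case 1
    have p: "upper.rad \<theta> r > 0" by (rule upper.rad_pos[OF r(1) 1(1)])
    hence "\<theta> = 0 \<or> \<theta> = pi" using 1 z(2) sin0 by (auto simp: on_axis_def)
    thus ?thesis using 1 z(2) p upper.rad_0[OF r(1)] by (auto simp: on_axis_def)
  next
    case 2
    have p: "lower.rad \<theta> (upper.rad pi r) > 0" by (rule lower.rad_pos[OF r(2) 2(1)])
    hence "\<theta> = 0 \<or> \<theta> = pi" using 2 z(2) sin0 by (auto simp: on_axis_def)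
    thus ?thesis using 2 z(2) p r(3) by (auto simp: on_axis_def return_map_def)
  qed
qed

text \<open>Monotonicity excludes orbits that close only after several turns: the radii at
  successive crossings would form a strictly monotone sequence and could not recur.\<close>

theorem periodic_orbit_is_fixed_point:
  assumes C: "periodic_orbit (filippov_field a b \<epsilon>) S" "S \<subseteq> {z. r\<^sub>1 \<le> norm z \<and> norm z \<le> r\<^sub>2}"
    and mono: "\<And>x y. r\<^sub>1 \<le> x \<Longrightarrow> x < y \<Longrightarrow> y \<le> r\<^sub>2 \<Longrightarrow> return_map x < return_map y"
  shows "\<exists>r\<in>{r\<^sub>1..r\<^sub>2}. upper.rad pi r \<in> {r\<^sub>1..r\<^sub>2} \<and> return_map r = r \<and> S = orbit r"
proof -
  obtain \<gamma> T where T: "T > 0" and sol: "inclusion_solution (filippov_field a b \<epsilon>) \<gamma>"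
    and per: "\<And>t. \<gamma> (t + T) = \<gamma> t" and S: "S = range \<gamma>"
    using C(1) unfolding periodic_orbit_def by blast
  have ann: "r\<^sub>1 \<le> norm (\<gamma> t) \<and> norm (\<gamma> t) \<le> r\<^sub>2" for t using C(2) S by auto
  obtain s0 where s0: "on_axis (\<gamma> s0)" using crossing_exists[OF sol ann] by blast
  define g where "g = 2 * r\<^sub>1 / V"
  have g: "g > 0" using upper.radii upper.V_pos by (simp add: g_def)
  define nxt where "nxt s t \<longleftrightarrow> s + g \<le> t \<and> on_axis (\<gamma> t) \<and> fst (\<gamma> t) = return_map (fst (\<gamma> s)) \<and> \<gamma> ` {s..t} = orbit (fst (\<gamma> s))
     \<and> (\<forall>u\<in>{s<..<t}. \<not> on_axis (\<gamma> u)) \<and> fst (\<gamma> s) \<in> {r\<^sub>1..r\<^sub>2} \<and> upper.rad pi (fst (\<gamma> s)) \<in> {r\<^sub>1..r\<^sub>2}" for s t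
  have E: "\<exists>t. on_axis (\<gamma> t) \<and> nxt s t" if "on_axis (\<gamma> s)" for s
    using first_return[OF sol ann that] unfolding nxt_def g_def by blast
  have "\<exists>\<tau>. \<forall>n. (on_axis (\<gamma> (\<tau> n)) \<and> (n = 0 \<longrightarrow> \<tau> n = s0)) \<and> nxt (\<tau> n) (\<tau> (Suc n))"
    using s0 E by (intro dependent_nat_choice) auto
  then obtain \<tau> :: "nat \<Rightarrow> real" where \<tau>: "\<tau> 0 = s0" "\<And>n. on_axis (\<gamma> (\<tau> n))" "\<And>n. nxt (\<tau> n) (\<tau> (Suc n))" by blast
  \<comment> \<open>Crossings are at least \<open>g\<close> apart, so the chosen crossing times
    exhaust the half-line from \<open>s0\<close>.\<close>
  have lin: "s0 + n * g \<le> \<tau> n" for n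
  proof (induction n)
    case (Suc n) thus ?case using \<tau>(3)[of n] by (simp add: nxt_def algebra_simps)
  qed (simp add: \<tau>)
  have cover: "\<exists>n. \<tau> n \<le> t \<and> t < \<tau> (Suc n)" if t: "s0 \<le> t" for t
  proof -
    obtain m :: nat where "(t - s0) / g < m" using reals_Archimedean2 by blast
    hence "t < \<tau> m" using lin[of m] g by (simp add: field_simps)
    hence ex: "\<exists>m. t < \<tau> m" by blast
    define n where "n = (LEAST m. t < \<tau> m)"
    have n: "t < \<tau> n" unfolding n_def by (rule LeastI_ex[OF ex])
    have "\<tau> n \<noteq> s0" using n t by simp
    then obtain k where k: "n = Suc k" using \<tau>(1) by (cases n) auto
    hence "\<not> t < \<tau> k" using not_less_Least[of k "\<lambda>m. t < \<tau> m"] by (simp add: n_def)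
    thus ?thesis using n k by (intro exI[of _ k]) auto
  qed
  define \<rho> where "\<rho> n = fst (\<gamma> (\<tau> n))" for n
  have \<rho>S: "\<rho> (Suc n) = return_map (\<rho> n)" and \<rho>r: "\<rho> n \<in> {r\<^sub>1..r\<^sub>2}" "upper.rad pi (\<rho> n) \<in> {r\<^sub>1..r\<^sub>2}"
    and im: "\<gamma> ` {\<tau> n..\<tau> (Suc n)} = orbit (\<rho> n)" for n
    using \<tau>(3)[of n] unfolding nxt_def \<rho>_def by auto
  obtain N where N: "\<tau> N \<le> s0 + T" "s0 + T < \<tau> (Suc N)" using cover[of "s0 + T"] T by auto
  have "on_axis (\<gamma> (s0 + T))" using s0 per by simp
  \<comment> \<open>By periodicity \<open>s0 + T\<close> is itself a crossing time, and none lies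
    strictly between two consecutive \<open>\<tau>\<close>.\<close>
  hence NT: "\<tau> N = s0 + T" using N \<tau>(3)[of N] unfolding nxt_def by (cases "\<tau> N = s0 + T") auto
  hence \<rho>N: "\<rho> N = \<rho> 0" using per by (simp add: \<rho>_def \<tau>(1))
  have N0: "N \<noteq> 0"
  proof
    assume "N = 0"
    thus False using NT \<tau>(1) T by simp
  qed
  have mono': "return_map (\<rho> m) < return_map (\<rho> n)" if "\<rho> m < \<rho> n" for m n
    using mono[OF _ that] \<rho>r by auto
  have "\<rho> 1 = \<rho> 0"
  proof (rule linorder_cases[of "\<rho> 1" "\<rho> 0"])
    assume "\<rho> 1 < \<rho> 0"
    hence "\<rho> (Suc n) < \<rho> n" for n
      using mono' by (induction n) (auto simp: \<rho>S[symmetric])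
    hence "\<rho> N < \<rho> 0" using N0 lift_Suc_mono_less[of "\<lambda>n. - \<rho> n" 0 N] by simp
    thus ?thesis using \<rho>N by simp
  next
    assume "\<rho> 0 < \<rho> 1"
    hence "\<rho> n < \<rho> (Suc n)" for n
      using mono' by (induction n) (auto simp: \<rho>S[symmetric])
    hence "\<rho> 0 < \<rho> N" using N0 lift_Suc_mono_less by (metis neq0_conv)
    thus ?thesis using \<rho>N by simp
  qed
  hence fix0: "return_map (\<rho> 0) = \<rho> 0" using \<rho>S[of 0] by simp
  have \<rho>: "\<rho> n = \<rho> 0" for n by (induction n) (simp_all add: \<rho>S fix0)
  \<comment> \<open>Times before \<open>s0\<close> are moved forward by multiples of the period,
    since \<open>cover\<close> starts at \<open>s0\<close>.\<close>
  have shift: "\<gamma> (t + real k * T) = \<gamma> t" for t k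
  proof (induction k)
    case (Suc k)
    thus ?case using per[of "t + real k * T"] by (simp add: algebra_simps)
  qed simp
  have "range \<gamma> \<subseteq> orbit (\<rho> 0)"
  proof
    fix z assume "z \<in> range \<gamma>"
    then obtain t where t: "z = \<gamma> t" by blast
    obtain k :: nat where "(s0 - t) / T < k" using reals_Archimedean2 by blast
    hence "s0 \<le> t + real k * T" using T by (simp add: field_simps)
    then obtain n where "\<tau> n \<le> t + real k * T" "t + real k * T < \<tau> (Suc n)" using cover by blast
    hence "\<gamma> (t + real k * T) \<in> \<gamma> ` {\<tau> n..\<tau> (Suc n)}" by simp
    thus "z \<in> orbit (\<rho> 0)" using im[of n] \<rho>[of n] shift t by simp
  qed
  moreover have "orbit (\<rho> 0) \<subseteq> range \<gamma>" using im[of 0] by blast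
  ultimately show ?thesis using S fix0 \<rho>r[of 0] by (intro bexI[of _ "\<rho> 0"]) auto
qed
end

section \<open>Periodic orbits from fixed points\<close>

text \<open>Separation of variables for \<open>\<sigma>' = 1 / W(\<sigma>)\<close>: the integral of
  \<open>W\<close> is time as a function of the angle, and \<open>\<sigma>\<close> is its
  inverse.\<close>

lemma time_reparametrisation:
  fixes W :: "real \<Rightarrow> real"
  assumes W: "continuous_on {0..b} W" "\<And>x. x \<in> {0..b} \<Longrightarrow> W x > 0" and b: "b > 0"
  obtains T \<sigma> where "T > 0" "continuous_on {0..T} \<sigma>" "\<sigma> 0 = 0" "\<sigma> T = b" "\<sigma> ` {0..T} = {0..b}"
    "\<And>t. t \<in> {0<..<T} \<Longrightarrow> \<sigma> t \<in> {0<..<b}"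
    "\<And>t. t \<in> {0<..<T} \<Longrightarrow> (\<sigma> has_real_derivative inverse (W (\<sigma> t))) (at t)"
proof -
  define \<tau> where "\<tau> x = integral {0..x} W" for x
  have d: "(\<tau> has_real_derivative W x) (at x within {0..b})" if "x \<in> {0..b}" for x
    unfolding \<tau>_def using integral_has_real_derivative[OF W(1) that] .
  have c: "continuous_on {0..b} \<tau>"
    using d by (meson DERIV_continuous_on)
  have di: "(\<tau> has_real_derivative W x) (at x)" if "x \<in> {0<..<b}" for x
    using d[of x] that by (simp add: at_within_Icc_at)
  have mono: "\<tau> x < \<tau> y" if "0 \<le> x" "x < y" "y \<le> b" for x y
  proof (rule DERIV_pos_imp_increasing_open[OF that(2)])
    show "\<exists>d. (\<tau> has_real_derivative d) (at z) \<and> 0 < d" if "x < z" "z < y" for z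
      using di[of z] W(2)[of z] that \<open>0 \<le> x\<close> \<open>y \<le> b\<close> by auto
    show "continuous_on {x..y} \<tau>" using c that by (auto elim: continuous_on_subset)
  qed
  have inj: "inj_on \<tau> {0..b}"
  proof (rule inj_onI)
    fix x y assume "x \<in> {0..b}" "y \<in> {0..b}" "\<tau> x = \<tau> y"
    thus "x = y" using mono[of x y] mono[of y x] by (cases x y rule: linorder_cases) auto
  qed
  define T where "T = \<tau> b"
  have \<tau>0: "\<tau> 0 = 0" by (simp add: \<tau>_def)
  have T: "T > 0" using mono[of 0 b] b by (simp add: T_def \<tau>0)
  have im: "\<tau> ` {0..b} = {0..T}"
  proof
    have "\<tau> x \<in> {0..T}" if "x \<in> {0..b}" for x
      using mono[of 0 x] mono[of x b] that \<tau>0 by (cases "x = 0"; cases "x = b") (auto simp: T_def)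
    thus "\<tau> ` {0..b} \<subseteq> {0..T}" by blast
    show "{0..T} \<subseteq> \<tau> ` {0..b}"
    proof
      fix t assume "t \<in> {0..T}"
      thus "t \<in> \<tau> ` {0..b}" using IVT'[of \<tau> 0 t b] c b \<tau>0 by (auto simp: T_def)
    qed
  qed
  define \<sigma> where "\<sigma> = the_inv_into {0..b} \<tau>"
  have \<sigma>\<tau>: "\<sigma> (\<tau> x) = x" if "x \<in> {0..b}" for x
    using the_inv_into_f_f[OF inj that] by (simp add: \<sigma>_def)
  have \<tau>\<sigma>: "\<tau> (\<sigma> t) = t" "\<sigma> t \<in> {0..b}" if "t \<in> {0..T}" for t
    using \<sigma>\<tau> im that by (metis imageE)+
  have \<sigma>c: "continuous_on {0..T} \<sigma>"
    using continuous_on_inv_into[OF c _ inj] im by (simp add: \<sigma>_def)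
  have \<sigma>0: "\<sigma> 0 = 0" "\<sigma> T = b" using \<sigma>\<tau>[of 0] \<sigma>\<tau>[of b] b by (auto simp: \<tau>0 T_def)
  have \<sigma>i: "\<sigma> t \<in> {0<..<b}" if "t \<in> {0<..<T}" for t
  proof -
    have "t \<in> {0..T}" using that by auto
    note * = \<tau>\<sigma>[OF this]
    have "\<sigma> t \<noteq> 0" "\<sigma> t \<noteq> b" using *(1) that \<tau>0 by (auto simp: T_def)
    thus ?thesis using *(2) by auto
  qed
  have "(\<sigma> has_real_derivative inverse (W (\<sigma> t))) (at t)" if t: "t \<in> {0<..<T}" for t
  proof (rule DERIV_inverse_function[where f = \<tau> and a = 0 and b = T])
    show "(\<tau> has_real_derivative W (\<sigma> t)) (at (\<sigma> t))" by (rule di[OF \<sigma>i[OF t]])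
    show "W (\<sigma> t) \<noteq> 0" using W(2)[of "\<sigma> t"] \<sigma>i[OF t] by auto
    show "isCont \<sigma> t" using continuous_on_interior[OF \<sigma>c, of t] t by simp
    show "\<tau> (\<sigma> y) = y" if "0 < y" "y < T" for y using \<tau>\<sigma>(1)[of y] that by simp
  qed (use t in auto)
  moreover have "\<sigma> ` {0..T} = {0..b}"
    using \<sigma>\<tau> unfolding im[symmetric] image_image by (auto simp: image_iff)
  ultimately show ?thesis using that[OF T \<sigma>c \<sigma>0] \<sigma>i by blast
qed

context half_flow begin

text \<open>Time is recovered by integrating the reciprocal of \<open>angular\<close> along the arc;
  with this clock the arc solves the planar equation.\<close>

lemma half_arc_solution:
  assumes r: "r \<in> {r\<^sub>1..r\<^sub>2}"
  obtains T \<alpha> where "T > 0" "continuous_on {0..T} \<alpha>" "\<alpha> 0 = (r, 0)" "\<alpha> T = (- rad pi r, 0)" "\<alpha> ` {0..T} = half_arc r"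
    "\<And>t. t \<in> {0<..<T} \<Longrightarrow> snd (\<alpha> t) > 0 \<and> (\<alpha> has_vector_derivative half_field p q \<epsilon> (\<alpha> t)) (at t)"
proof -
  have ang: "angular p q \<epsilon> s (rad s r) \<ge> 1 / 2" if "s \<in> {0..pi}" for s
    using angular_ge[of "rad s r" s] rad_range[OF r that] radii by auto
  have rp: "rad s r > 0" if "s \<in> {0..pi}" for s by (rule rad_pos[OF r that])
  define W where "W s = inverse (angular p q \<epsilon> s (rad s r))" for s
  have "continuous_on {0..pi} (\<lambda>s. angular p q \<epsilon> s (rad s r))"
    unfolding angular_def cubic_def by (intro continuous_intros rad_continuous r) (use rp in force)
  hence Wc: "continuous_on {0..pi} W" unfolding W_def using ang by (intro continuous_on_inverse) force+
  have Wp: "W s > 0" if "s \<in> {0..pi}" for s using ang[OF that] by (simp add: W_def)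
  obtain T \<sigma> where T: "T > 0" "continuous_on {0..T} \<sigma>" "\<sigma> 0 = 0" "\<sigma> T = pi" "\<sigma> ` {0..T} = {0..pi}"
    "\<And>t. t \<in> {0<..<T} \<Longrightarrow> \<sigma> t \<in> {0<..<pi}"
    "\<And>t. t \<in> {0<..<T} \<Longrightarrow> (\<sigma> has_real_derivative inverse (W (\<sigma> t))) (at t)"
    using time_reparametrisation[OF Wc Wp pi_gt_zero] by metis
  define \<alpha> where "\<alpha> t = (rad (\<sigma> t) r * cos (\<sigma> t), rad (\<sigma> t) r * sin (\<sigma> t))" for t
  have "continuous_on {0..T} \<alpha>"
    unfolding \<alpha>_def by (intro continuous_intros T(2) continuous_on_compose2[OF rad_continuous[OF r] T(2)]) (use T(5) in auto)
  moreover have "\<alpha> 0 = (r, 0)" "\<alpha> T = (- rad pi r, 0)" using rad_0[OF r] by (auto simp: \<alpha>_def T)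
  moreover have "\<alpha> ` {0..T} = half_arc r" unfolding half_arc_def T(5)[symmetric] image_image \<alpha>_def ..
  moreover have "snd (\<alpha> t) > 0 \<and> (\<alpha> has_vector_derivative half_field p q \<epsilon> (\<alpha> t)) (at t)" if t: "t \<in> {0<..<T}" for t
  proof
    have \<sigma>t: "\<sigma> t \<in> {0..pi}" using T(6)[OF t] by auto
    define \<rho> c s A where "\<rho> = rad (\<sigma> t) r" and "c = cos (\<sigma> t)" and "s = sin (\<sigma> t)" and "A = angular p q \<epsilon> (\<sigma> t) \<rho>"
    define P Q where "P = cubic p (\<rho> * c) (\<rho> * s)" and "Q = cubic q (\<rho> * c) (\<rho> * s)"
    have \<rho>: "\<rho> > 0" using rp[OF \<sigma>t] by (simp add: \<rho>_def)
    show "snd (\<alpha> t) > 0" using T(6)[OF t] rp[OF \<sigma>t] by (simp add: \<alpha>_def sin_gt_zero)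
    have A: "A > 0" using ang[OF \<sigma>t] by (simp add: A_def \<rho>_def)
    have d\<sigma>: "(\<sigma> has_real_derivative A) (at t)" using T(7)[OF t] by (simp add: W_def A_def \<rho>_def)
    have "((\<lambda>t. rad (\<sigma> t) r) has_real_derivative \<epsilon> * slope (\<sigma> t) \<rho> * A) (at t)"
      unfolding \<rho>_def by (rule DERIV_chain2[where f = "\<lambda>\<theta>. rad \<theta> r", OF rad_derivative[OF r] d\<sigma>]) (use T(6)[OF t] in auto)
    moreover have "slope (\<sigma> t) \<rho> * A = c * P + s * Q"
      using A by (simp add: slope_def A_def radial_def c_def s_def P_def Q_def)
    ultimately have d\<rho>: "((\<lambda>t. rad (\<sigma> t) r) has_real_derivative \<epsilon> * (c * P + s * Q)) (at t)" by (simp add: mult.assoc)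
    have Aeq: "A = \<rho>\<^sup>2 * c\<^sup>2 + 1 + \<epsilon> * (c * Q - s * P) * inverse \<rho>"
      by (simp add: A_def angular_def c_def s_def P_def Q_def divide_inverse)
    have cs: "c\<^sup>2 + s\<^sup>2 = 1" by (simp add: c_def s_def)
    have ri: "\<rho> * inverse \<rho> = 1" using \<rho> by simp
    have dx: "((\<lambda>t. rad (\<sigma> t) r * cos (\<sigma> t)) has_real_derivative - (\<rho> * s) * ((\<rho> * c)\<^sup>2 + 1) + \<epsilon> * P) (at t)"
    proof -
      have "((\<lambda>t. rad (\<sigma> t) r * cos (\<sigma> t)) has_real_derivative \<epsilon> * (c * P + s * Q) * c + (- s * A) * \<rho>) (at t)"
        using DERIV_mult[OF d\<rho> DERIV_chain2[OF DERIV_cos d\<sigma>]] by (simp add: c_def s_def \<rho>_def)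
      moreover have "\<epsilon> * (c * P + s * Q) * c + (- s * A) * \<rho> = - (\<rho> * s) * ((\<rho> * c)\<^sup>2 + 1) + \<epsilon> * P"
        unfolding Aeq using cs ri by algebra
      ultimately show ?thesis by simp
    qed
    have dy: "((\<lambda>t. rad (\<sigma> t) r * sin (\<sigma> t)) has_real_derivative (\<rho> * c) * ((\<rho> * c)\<^sup>2 + 1) + \<epsilon> * Q) (at t)"
    proof -
      have "((\<lambda>t. rad (\<sigma> t) r * sin (\<sigma> t)) has_real_derivative \<epsilon> * (c * P + s * Q) * s + (c * A) * \<rho>) (at t)"
        using DERIV_mult[OF d\<rho> DERIV_chain2[OF DERIV_sin d\<sigma>]] by (simp add: c_def s_def \<rho>_def)
      moreover have "\<epsilon> * (c * P + s * Q) * s + (c * A) * \<rho> = (\<rho> * c) * ((\<rho> * c)\<^sup>2 + 1) + \<epsilon> * Q"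
        unfolding Aeq using cs ri by algebra
      ultimately show ?thesis by simp
    qed
    have "(\<alpha> has_vector_derivative (- (\<rho> * s) * ((\<rho> * c)\<^sup>2 + 1) + \<epsilon> * P, (\<rho> * c) * ((\<rho> * c)\<^sup>2 + 1) + \<epsilon> * Q)) (at t)"
      unfolding \<alpha>_def using dx dy
      by (intro has_vector_derivative_Pair) (simp_all only: has_real_derivative_iff_has_vector_derivative)
    thus "(\<alpha> has_vector_derivative half_field p q \<epsilon> (\<alpha> t)) (at t)"
      by (simp add: half_field_def \<alpha>_def P_def Q_def \<rho>_def c_def s_def)
  qed
  ultimately show ?thesis using that[OF T(1)] by blast
qed
end

text \<open>The integral form of a solution tolerates corners. They occur only at \<open>T1\<close>
  and at the ends of a period, modulo \<open>T\<close>; a bounded interval contains finitely many,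
  and the fundamental theorem of calculus allows such an exceptional set.\<close>

lemma periodic_extension:
  fixes \<gamma>0 :: "real \<Rightarrow> 'a :: banach"
  assumes T: "T > 0" and c: "continuous_on {0..T} \<gamma>0" and match: "\<gamma>0 T = \<gamma>0 0" and T1: "T1 \<in> {0<..<T}"
    and d: "\<And>t. t \<in> {0<..<T} \<Longrightarrow> t \<noteq> T1 \<Longrightarrow> (\<gamma>0 has_vector_derivative F (\<gamma>0 t)) (at t)"
  obtains \<gamma> where "\<And>t. \<gamma> (t + T) = \<gamma> t" "range \<gamma> = \<gamma>0 ` {0..T}" "\<And>t. t \<in> {0..T} \<Longrightarrow> \<gamma> t = \<gamma>0 t"
    "\<And>s t. s \<le> t \<Longrightarrow> ((\<lambda>u. F (\<gamma> u)) has_integral (\<gamma> t - \<gamma> s)) {s..t}"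
proof -
  define \<gamma> where "\<gamma> t = \<gamma>0 (t - T * of_int \<lfloor>t / T\<rfloor>)" for t
  have fl: "0 \<le> t - T * of_int \<lfloor>t / T\<rfloor>" "t - T * of_int \<lfloor>t / T\<rfloor> < T" for t
    using floor_divide_lower[OF T, of t] floor_divide_upper[OF T, of t] by (auto simp: algebra_simps)
  \<comment> \<open>By \<open>match\<close> the formula is valid at both ends of the cell, which
    gives continuity across multiples of \<open>T\<close>.\<close>
  have cell: "\<gamma> t = \<gamma>0 (t - T * of_int n)" if "t \<in> {T * of_int n..T * of_int n + T}" for t and n :: int
  proof (cases "t = T * of_int n + T")
    case True
    hence "t / T = of_int (n + 1)" using T by (simp add: field_simps)
    hence "\<lfloor>t / T\<rfloor> = n + 1" by (simp only: floor_of_int)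
    thus ?thesis using True match unfolding \<gamma>_def by (simp add: algebra_simps)
  next
    case False
    have "\<lfloor>t / T\<rfloor> = n" using that False T by (intro floor_unique) (auto simp: field_simps)
    thus ?thesis by (simp add: \<gamma>_def)
  qed
  have per: "\<gamma> (t + T) = \<gamma> t" for t
  proof -
    have "(t + T) / T = t / T + 1" using T by (simp add: field_simps)
    hence "\<lfloor>(t + T) / T\<rfloor> = \<lfloor>t / T\<rfloor> + 1" by simp
    thus ?thesis unfolding \<gamma>_def by (simp add: algebra_simps)
  qed
  have eq0: "\<gamma> t = \<gamma>0 t" if "t \<in> {0..T}" for t using cell[of t 0] that by simp
  have range: "range \<gamma> = \<gamma>0 ` {0..T}"
  proof
    show "range \<gamma> \<subseteq> \<gamma>0 ` {0..T}"
    proof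
      fix z assume "z \<in> range \<gamma>"
      then obtain t where "z = \<gamma>0 (t - T * of_int \<lfloor>t / T\<rfloor>)" unfolding \<gamma>_def by blast
      thus "z \<in> \<gamma>0 ` {0..T}" using fl[of t] by (auto intro: image_eqI)
    qed
    show "\<gamma>0 ` {0..T} \<subseteq> range \<gamma>" using eq0 by (metis image_subsetI rangeI)
  qed
  have cc: "continuous_on {T * of_int n..T * of_int n + T} \<gamma>" for n :: int
  proof -
    have "continuous_on {T * of_int n..T * of_int n + T} (\<lambda>t. \<gamma>0 (t - T * of_int n))"
      by (rule continuous_on_compose2[OF c]) (auto intro!: continuous_intros)
    thus ?thesis by (rule continuous_on_eq) (rule cell[symmetric])
  qed
  have cont: "continuous_on X \<gamma>" for X
  proof -
    have "isCont \<gamma> t" for t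
    proof -
      let ?n = "\<lfloor>t / T\<rfloor>"
      have "continuous_on ({T * of_int (?n - 1)..T * of_int (?n - 1) + T} \<union> {T * of_int ?n..T * of_int ?n + T}) \<gamma>"
        by (intro continuous_on_closed_Un cc) auto
      moreover have "{T * of_int (?n - 1)..T * of_int (?n - 1) + T} \<union> {T * of_int ?n..T * of_int ?n + T} = {T * of_int ?n - T..T * of_int ?n + T}"
        using T by (auto simp: algebra_simps)
      ultimately have "continuous_on {T * of_int ?n - T..T * of_int ?n + T} \<gamma>" by simp
      moreover have "t \<in> interior {T * of_int ?n - T..T * of_int ?n + T}" using fl[of t] T by simp
      ultimately show ?thesis by (rule continuous_on_interior)
    qed
    thus ?thesis by (simp add: continuous_at_imp_continuous_on)
  qed
  have deriv: "(\<gamma> has_vector_derivative F (\<gamma> t)) (at t)"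
    if t: "t - T * of_int \<lfloor>t / T\<rfloor> \<noteq> 0" "t - T * of_int \<lfloor>t / T\<rfloor> \<noteq> T1" for t
  proof -
    let ?n = "\<lfloor>t / T\<rfloor>"
    have u: "t - T * of_int ?n \<in> {0<..<T}" using fl[of t] t by auto
    have "((\<lambda>x. x - T * of_int ?n) has_vector_derivative 1) (at t)" by (auto intro!: derivative_eq_intros)
    from vector_diff_chain_at[OF this d[OF u t(2)]]
    have "((\<lambda>x. \<gamma>0 (x - T * of_int ?n)) has_vector_derivative F (\<gamma> t)) (at t)"
      by (simp add: o_def \<gamma>_def)
    thus ?thesis
      by (rule has_vector_derivative_transform_within_open[of _ _ _ "{T * of_int ?n<..<T * of_int ?n + T}"])
         (use u cell[of _ ?n] in auto)
  qed
  have "((\<lambda>u. F (\<gamma> u)) has_integral (\<gamma> t - \<gamma> s)) {s..t}" if st: "s \<le> t" for s t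
  proof (rule fundamental_theorem_of_calculus_strong[OF _ st _ cont])
    let ?E = "(\<lambda>n::int. T * of_int n) ` {\<lfloor>s / T\<rfloor>..\<lfloor>t / T\<rfloor>} \<union> (\<lambda>n::int. T * of_int n + T1) ` {\<lfloor>s / T\<rfloor>..\<lfloor>t / T\<rfloor>}"
    show "finite ?E" by simp
    fix x assume x: "x \<in> {s..t} - ?E"
    have "\<lfloor>x / T\<rfloor> \<in> {\<lfloor>s / T\<rfloor>..\<lfloor>t / T\<rfloor>}"
      using x T by (auto intro!: floor_mono divide_right_mono)
    hence "x \<noteq> T * of_int \<lfloor>x / T\<rfloor>" "x \<noteq> T * of_int \<lfloor>x / T\<rfloor> + T1" using x by blast+
    thus "(\<gamma> has_vector_derivative F (\<gamma> x)) (at x)" by (intro deriv) auto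
  qed
  thus ?thesis using that per range eq0 by blast
qed

context annulus_system begin

theorem fixed_point_is_periodic_orbit:
  assumes r: "r \<in> {r\<^sub>1..r\<^sub>2}" "upper.rad pi r \<in> {r\<^sub>1..r\<^sub>2}" "return_map r = r"
    and S: "orbit r \<subseteq> {z. norm z \<le> r\<^sub>2}"
  shows "periodic_orbit (filippov_field a b \<epsilon>) (orbit r)"
proof -
  let ?r' = "upper.rad pi r"
  obtain T1 \<alpha> where \<alpha>: "T1 > 0" "continuous_on {0..T1} \<alpha>" "\<alpha> 0 = (r, 0)" "\<alpha> T1 = (- ?r', 0)" "\<alpha> ` {0..T1} = upper.half_arc r"
    "\<And>t. t \<in> {0<..<T1} \<Longrightarrow> snd (\<alpha> t) > 0 \<and> (\<alpha> has_vector_derivative half_field (a 1) (b 1) \<epsilon> (\<alpha> t)) (at t)"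
    using upper.half_arc_solution[OF r(1)] by metis
  obtain T2 \<beta> where \<beta>: "T2 > 0" "continuous_on {0..T2} \<beta>" "\<beta> 0 = (?r', 0)" "\<beta> T2 = (- r, 0)" "\<beta> ` {0..T2} = lower.half_arc ?r'"
    "\<And>t. t \<in> {0<..<T2} \<Longrightarrow> snd (\<beta> t) > 0 \<and> (\<beta> has_vector_derivative half_field (rotated a 1) (rotated b 1) \<epsilon> (\<beta> t)) (at t)"
    using lower.half_arc_solution[OF r(2)] r(3) unfolding return_map_def by metis
  \<comment> \<open>On the axis the upper field is admissible as an endpoint of the Filippov
    segment; the orbit is there only at isolated times.\<close>
  define F where "F z = (if snd z \<ge> 0 then vfield a b \<epsilon> 1 z else vfield a b \<epsilon> 2 z)" for z
  have FZ: "F z \<in> filippov_field a b \<epsilon> z" for z by (simp add: F_def filippov_field_def)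
  define \<gamma>0 where "\<gamma>0 t = (if t \<le> T1 then \<alpha> t else - \<beta> (t - T1))" for t
  have c0: "continuous_on {0..T1 + T2} \<gamma>0"
  proof -
    have "continuous_on ({0..T1} \<union> {T1..T1 + T2}) \<gamma>0"
      unfolding \<gamma>0_def
    proof (rule continuous_on_If)
      show "continuous_on {T1..T1 + T2} (\<lambda>t. - \<beta> (t - T1))"
        by (intro continuous_on_minus continuous_on_compose2[OF \<beta>(2)]) (auto intro!: continuous_intros)
      show "\<alpha> t = - \<beta> (t - T1)" if "t \<in> {0..T1}" "\<not> t \<le> T1" for t using that by simp
      show "\<alpha> t = - \<beta> (t - T1)" if "t \<in> {T1..T1 + T2}" "t \<le> T1" for t
      proof -
        have "t = T1" using that by simp
        thus ?thesis by (simp add: \<alpha> \<beta>)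
      qed
    qed (auto simp: \<alpha>)
    moreover have "{0..T1} \<union> {T1..T1 + T2} = {0..T1 + T2}" using \<alpha>(1) \<beta>(1) by auto
    ultimately show ?thesis by simp
  qed
  have match: "\<gamma>0 (T1 + T2) = \<gamma>0 0" using \<alpha> \<beta> by (simp add: \<gamma>0_def)
  have d: "(\<gamma>0 has_vector_derivative F (\<gamma>0 t)) (at t)" if t: "t \<in> {0<..<T1 + T2}" "t \<noteq> T1" for t
  proof (cases "t < T1")
    case True
    hence t1: "t \<in> {0<..<T1}" using t by auto
    have "F (\<gamma>0 t) = half_field (a 1) (b 1) \<epsilon> (\<alpha> t)"
      using \<alpha>(6)[OF t1] True by (simp add: F_def \<gamma>0_def vfield_half_field)
    moreover have "(\<gamma>0 has_vector_derivative half_field (a 1) (b 1) \<epsilon> (\<alpha> t)) (at t)"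
      by (rule has_vector_derivative_transform_within_open[of \<alpha> _ _ "{0<..<T1}"])
         (use \<alpha>(6)[OF t1] t1 in \<open>auto simp: \<gamma>0_def\<close>)
    ultimately show ?thesis by simp
  next
    case False
    hence t2: "t - T1 \<in> {0<..<T2}" using t by auto
    have "F (\<gamma>0 t) = - half_field (rotated a 1) (rotated b 1) \<epsilon> (\<beta> (t - T1))"
      using \<beta>(6)[OF t2] t2 by (simp add: F_def \<gamma>0_def vfield_half_field rotated_def half_field_rotate)
    moreover have "(\<gamma>0 has_vector_derivative - half_field (rotated a 1) (rotated b 1) \<epsilon> (\<beta> (t - T1))) (at t)"
    proof (rule has_vector_derivative_transform_within_open[of "\<lambda>t. - \<beta> (t - T1)" _ _ "{T1<..<T1 + T2}"])
      have "((\<lambda>x. x - T1) has_vector_derivative 1) (at t)" by (auto intro!: derivative_eq_intros)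
      from vector_diff_chain_at[OF this conjunct2[OF \<beta>(6)[OF t2]]]
      show "((\<lambda>t. - \<beta> (t - T1)) has_vector_derivative - half_field (rotated a 1) (rotated b 1) \<epsilon> (\<beta> (t - T1))) (at t)"
        by (intro has_vector_derivative_minus) (simp add: o_def)
    qed (use t2 in \<open>auto simp: \<gamma>0_def\<close>)
    ultimately show ?thesis by simp
  qed
  have T: "T1 + T2 > 0" "T1 \<in> {0<..<T1 + T2}" using \<alpha>(1) \<beta>(1) by auto
  obtain \<gamma> where \<gamma>: "\<And>t. \<gamma> (t + (T1 + T2)) = \<gamma> t" "range \<gamma> = \<gamma>0 ` {0..T1 + T2}" "\<And>t. t \<in> {0..T1 + T2} \<Longrightarrow> \<gamma> t = \<gamma>0 t"
    "\<And>s t. s \<le> t \<Longrightarrow> ((\<lambda>u. F (\<gamma> u)) has_integral (\<gamma> t - \<gamma> s)) {s..t}"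
    using periodic_extension[OF T(1) c0 match T(2) d] by metis
  have "\<gamma>0 ` {0..T1 + T2} = \<gamma>0 ` {0..T1} \<union> \<gamma>0 ` {T1..T1 + T2}"
    using \<alpha>(1) \<beta>(1) by (simp add: ivl_disj_un_two_touch flip: image_Un)
  also have "\<gamma>0 ` {0..T1} = upper.half_arc r" unfolding \<alpha>(5)[symmetric] by (intro image_cong) (auto simp: \<gamma>0_def)
  also have "\<gamma>0 ` {T1..T1 + T2} = uminus ` lower.half_arc ?r'"
  proof -
    have "(\<lambda>t. T1 + t) ` {0..T2} = {T1..T1 + T2}"
      using image_add_atLeastAtMost[of T1 0 T2] by (simp add: add.commute)
    hence "\<gamma>0 ` {T1..T1 + T2} = \<gamma>0 ` ((\<lambda>t. T1 + t) ` {0..T2})" by (simp only:)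
    also have "\<dots> = (\<lambda>t. \<gamma>0 (T1 + t)) ` {0..T2}" by (rule image_image)
    also have "\<dots> = (\<lambda>t. - \<beta> t) ` {0..T2}"
      by (intro image_cong) (auto simp: \<gamma>0_def \<alpha> \<beta>)
    finally show ?thesis unfolding \<beta>(5)[symmetric] image_image .
  qed
  finally have ran: "range \<gamma> = orbit r" using \<gamma>(2) by (simp add: orbit_def)
  have "inclusion_solution (filippov_field a b \<epsilon>) \<gamma>"
    unfolding inclusion_solution_def
  proof (intro exI[of _ "\<lambda>t. F (\<gamma> t)"] conjI allI impI FZ)
    fix s t :: real assume st: "s \<le> t"
    show "((\<lambda>u. F (\<gamma> u)) has_integral (\<gamma> t - \<gamma> s)) {s..t}" by (rule \<gamma>(4)[OF st])
    have "norm (\<gamma> u) \<le> r\<^sub>2" for u using ran S by blast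
    hence "norm (F (\<gamma> u)) \<le> V" for u using upper.speed FZ by blast
    thus "(\<lambda>u. F (\<gamma> u)) absolutely_integrable_on {s..t}"
      using \<gamma>(4)[OF st] by (intro absolutely_integrable_integrable_bound[where g = "\<lambda>_. V"]) auto
  qed
  moreover have "\<gamma> T1 \<noteq> \<gamma> 0"
  proof -
    have "\<gamma> T1 = (- ?r', 0)" "\<gamma> 0 = (r, 0)" using \<gamma>(3)[of T1] \<gamma>(3)[of 0] \<alpha> \<beta>(1) by (auto simp: \<gamma>0_def)
    thus ?thesis using r upper.radii by auto
  qed
  ultimately show ?thesis unfolding periodic_orbit_def using T(1) \<gamma>(1) ran by blast
qed
end

section \<open>The displacement function\<close>

lemma cubic_le_bound:
  assumes "norm z \<le> \<rho>" shows "\<bar>cubic c (fst z) (snd z)\<bar> \<le> cubic_bound c \<rho>"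
proof -
  have "\<bar>fst z\<bar> \<le> \<rho>" "\<bar>snd z\<bar> \<le> \<rho>"
    using norm_fst_le[of "fst z" "snd z"] norm_snd_le[of "snd z" "fst z"] assms by auto
  hence "norm (cubicC c (of_real (fst z)) (of_real (snd z))) \<le> cubic_bound c \<rho>"
    by (intro cubicC_le_bound) auto
  thus ?thesis by (simp add: cubicC_of_real)
qed

text \<open>Where \<open>fst z\<close> is at least \<open>r\<^sub>1 / 2\<close>, the unperturbed
  field contributes at least \<open>r\<^sub>1 / 2\<close> to the vertical component and the
  perturbation takes away at most \<open>r\<^sub>1 / 4\<close>. Balls and half-planes are convex, so
  bounds for the two one-sided fields pass to the segment between them.\<close>

lemma filippov_field_bounds:
  assumes r: "0 < r\<^sub>1" "r\<^sub>1 < r\<^sub>2"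
  shows "\<exists>\<epsilon>\<^sub>0>0. \<exists>V>0. \<forall>\<epsilon>. \<bar>\<epsilon>\<bar> < \<epsilon>\<^sub>0 \<longrightarrow>
    (\<forall>z w. norm z \<le> r\<^sub>2 \<longrightarrow> w \<in> filippov_field a b \<epsilon> z \<longrightarrow> norm w \<le> V \<and> (r\<^sub>1 / 2 \<le> fst z \<longrightarrow> r\<^sub>1 / 4 \<le> snd w))"
proof -
  define K where "K = 1 + cubic_bound (a 1) r\<^sub>2 + cubic_bound (a 2) r\<^sub>2 + cubic_bound (b 1) r\<^sub>2 + cubic_bound (b 2) r\<^sub>2"
  have nn: "0 \<le> cubic_bound c r\<^sub>2" for c using r by (intro cubic_bound_nonneg) auto
  have K: "K \<ge> 1" using nn[of "a 1"] nn[of "a 2"] nn[of "b 1"] nn[of "b 2"] by (simp add: K_def)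
  define M where "M = r\<^sub>2 * (r\<^sub>2\<^sup>2 + 1) + K"
  have M: "M > 0" using r K by (auto simp: M_def intro!: add_pos_pos mult_pos_pos)
  define \<epsilon>\<^sub>0 where "\<epsilon>\<^sub>0 = min 1 (r\<^sub>1 / (4 * K))"
  have \<epsilon>\<^sub>0: "\<epsilon>\<^sub>0 > 0" using r K by (simp add: \<epsilon>\<^sub>0_def)
  have fld: "norm (vfield a b \<epsilon> k z) \<le> 2 * M \<and> (r\<^sub>1 / 2 \<le> fst z \<longrightarrow> r\<^sub>1 / 4 \<le> snd (vfield a b \<epsilon> k z))"
    if \<epsilon>: "\<bar>\<epsilon>\<bar> < \<epsilon>\<^sub>0" and z: "norm z \<le> r\<^sub>2" and k: "k = 1 \<or> k = 2" for \<epsilon> k z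
  proof -
    have ab: "\<bar>fst z\<bar> \<le> r\<^sub>2" "\<bar>snd z\<bar> \<le> r\<^sub>2"
      using norm_fst_le[of "fst z" "snd z"] norm_snd_le[of "snd z" "fst z"] z by auto
    have cP: "\<bar>cubic (a k) (fst z) (snd z)\<bar> \<le> K" and cQ: "\<bar>cubic (b k) (fst z) (snd z)\<bar> \<le> K"
      using cubic_le_bound[OF z, of "a k"] cubic_le_bound[OF z, of "b k"] k nn[of "a 1"] nn[of "a 2"] nn[of "b 1"] nn[of "b 2"]
      by (auto simp: K_def)
    have e1: "\<bar>\<epsilon>\<bar> * K \<le> r\<^sub>1 / 4" and e2: "\<bar>\<epsilon>\<bar> \<le> 1" using \<epsilon> K by (auto simp: \<epsilon>\<^sub>0_def field_simps)
    have eP: "\<bar>\<epsilon> * cubic (a k) (fst z) (snd z)\<bar> \<le> K" and eQ: "\<bar>\<epsilon> * cubic (b k) (fst z) (snd z)\<bar> \<le> K"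
      using mult_mono[OF e2 cP] mult_mono[OF e2 cQ] K by (auto simp: abs_mult)
    have eQ': "\<bar>\<epsilon> * cubic (b k) (fst z) (snd z)\<bar> \<le> r\<^sub>1 / 4"
      using order_trans[OF mult_left_mono[OF cQ, of "\<bar>\<epsilon>\<bar>"] e1] by (simp add: abs_mult)
    have x2: "(fst z)\<^sup>2 + 1 \<le> r\<^sub>2\<^sup>2 + 1" using ab r by (simp add: abs_le_square_iff[symmetric])
    have m: "\<bar>u * ((fst z)\<^sup>2 + 1)\<bar> \<le> r\<^sub>2 * (r\<^sub>2\<^sup>2 + 1)" if "\<bar>u\<bar> \<le> r\<^sub>2" for u
    proof -
      have "\<bar>u * ((fst z)\<^sup>2 + 1)\<bar> = \<bar>u\<bar> * ((fst z)\<^sup>2 + 1)" by (simp add: abs_mult add_nonneg_nonneg)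
      also have "\<dots> \<le> r\<^sub>2 * (r\<^sub>2\<^sup>2 + 1)" using x2 that r by (intro mult_mono) auto
      finally show ?thesis .
    qed
    have v: "vfield a b \<epsilon> k z = (- snd z * ((fst z)\<^sup>2 + 1) + \<epsilon> * cubic (a k) (fst z) (snd z),
        fst z * ((fst z)\<^sup>2 + 1) + \<epsilon> * cubic (b k) (fst z) (snd z))"
      by (simp add: vfield_def case_prod_beta)
    have "\<bar>fst (vfield a b \<epsilon> k z)\<bar> \<le> M" "\<bar>snd (vfield a b \<epsilon> k z)\<bar> \<le> M"
      using m[of "- snd z"] m[of "fst z"] ab eP eQ unfolding v M_def by auto
    hence "norm (vfield a b \<epsilon> k z) \<le> 2 * M"
      using norm_Pair_le[of "fst (vfield a b \<epsilon> k z)" "snd (vfield a b \<epsilon> k z)"] by auto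
    moreover have "r\<^sub>1 / 4 \<le> snd (vfield a b \<epsilon> k z)" if x: "r\<^sub>1 / 2 \<le> fst z"
    proof -
      have "r\<^sub>1 / 2 * 1 \<le> fst z * ((fst z)\<^sup>2 + 1)" using x r by (intro mult_mono) auto
      thus ?thesis using eQ' unfolding v by simp
    qed
    ultimately show ?thesis by blast
  qed
  have "norm w \<le> 2 * M \<and> (r\<^sub>1 / 2 \<le> fst z \<longrightarrow> r\<^sub>1 / 4 \<le> snd w)"
    if \<epsilon>: "\<bar>\<epsilon>\<bar> < \<epsilon>\<^sub>0" and z: "norm z \<le> r\<^sub>2" and w: "w \<in> filippov_field a b \<epsilon> z" for \<epsilon> z w
  proof -
    have seg: "w \<in> closed_segment (vfield a b \<epsilon> 1 z) (vfield a b \<epsilon> 2 z)"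
      using w by (auto simp: filippov_field_def split: if_splits)
    have "closed_segment (vfield a b \<epsilon> 1 z) (vfield a b \<epsilon> 2 z) \<subseteq> cball 0 (2 * M)"
      using fld[OF \<epsilon> z] by (intro closed_segment_subset) auto
    moreover have "closed_segment (vfield a b \<epsilon> 1 z) (vfield a b \<epsilon> 2 z) \<subseteq> {w. snd w \<ge> r\<^sub>1 / 4}" if "r\<^sub>1 / 2 \<le> fst z"
    proof (rule closed_segment_subset)
      have "{w :: real \<times> real. snd w \<ge> r\<^sub>1 / 4} = {w. inner (0, 1) w \<ge> r\<^sub>1 / 4}" by (auto simp: inner_prod_def)
      thus "convex {w :: real \<times> real. snd w \<ge> r\<^sub>1 / 4}" using convex_halfspace_ge by metis
    qed (use fld[OF \<epsilon> z] that in auto)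
    ultimately show ?thesis using seg by auto
  qed
  thus ?thesis using \<epsilon>\<^sub>0 M by (intro exI[of _ \<epsilon>\<^sub>0] conjI exI[of _ "2 * M"]) auto
qed

lemma annulus_flow_exists:
  assumes r: "0 < r\<^sub>1" "r\<^sub>1 < r\<^sub>2"
  shows "\<exists>\<epsilon>\<^sub>0>0. \<exists>C V. \<forall>\<epsilon>. \<bar>\<epsilon>\<bar> < \<epsilon>\<^sub>0 \<longrightarrow> (\<exists>R. annulus_flow a b r\<^sub>1 r\<^sub>2 \<epsilon> C R V)"
proof -
  obtain \<epsilon>1 C where 1: "\<epsilon>1 > 0" "\<And>\<epsilon>. \<bar>\<epsilon>\<bar> < \<epsilon>1 \<Longrightarrow> \<exists>R. half_flow (a 1) (b 1) r\<^sub>1 r\<^sub>2 \<epsilon> C R"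
    using half_flow_exists[OF r] by blast
  obtain \<epsilon>2 V where 2: "\<epsilon>2 > 0" "V > 0" "\<And>\<epsilon> z w. \<bar>\<epsilon>\<bar> < \<epsilon>2 \<Longrightarrow> norm z \<le> r\<^sub>2 \<Longrightarrow> w \<in> filippov_field a b \<epsilon> z \<Longrightarrow>
      norm w \<le> V \<and> (r\<^sub>1 / 2 \<le> fst z \<longrightarrow> r\<^sub>1 / 4 \<le> snd w)"
    using filippov_field_bounds[OF r, of a b] by blast
  have "\<exists>R. annulus_flow a b r\<^sub>1 r\<^sub>2 \<epsilon> C R V" if \<epsilon>: "\<bar>\<epsilon>\<bar> < min \<epsilon>1 \<epsilon>2" for \<epsilon>
  proof -
    obtain R where "half_flow (a 1) (b 1) r\<^sub>1 r\<^sub>2 \<epsilon> C R" using 1 \<epsilon> by auto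
    hence "annulus_flow a b r\<^sub>1 r\<^sub>2 \<epsilon> C R V"
      using 2 \<epsilon> unfolding annulus_flow_def annulus_flow_axioms_def by auto
    thus ?thesis by blast
  qed
  thus ?thesis using 1(1) 2(1) by (intro exI[of _ "min \<epsilon>1 \<epsilon>2"]) auto
qed

lemma annulus_system_exists:
  assumes r: "0 < r\<^sub>1" "r\<^sub>1 < r\<^sub>2"
  shows "\<exists>\<epsilon>\<^sub>0>0. \<exists>C V C' V'. \<forall>\<epsilon>. \<bar>\<epsilon>\<bar> < \<epsilon>\<^sub>0 \<longrightarrow> (\<exists>R R'. annulus_system a b r\<^sub>1 r\<^sub>2 \<epsilon> C R V C' R' V')"
proof -
  obtain \<epsilon>1 C V where 1: "\<epsilon>1 > 0" "\<And>\<epsilon>. \<bar>\<epsilon>\<bar> < \<epsilon>1 \<Longrightarrow> \<exists>R. annulus_flow a b r\<^sub>1 r\<^sub>2 \<epsilon> C R V"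
    using annulus_flow_exists[OF r] by blast
  obtain \<epsilon>2 C' V' where 2: "\<epsilon>2 > 0" "\<And>\<epsilon>. \<bar>\<epsilon>\<bar> < \<epsilon>2 \<Longrightarrow> \<exists>R. annulus_flow (rotated a) (rotated b) r\<^sub>1 r\<^sub>2 \<epsilon> C' R V'"
    using annulus_flow_exists[OF r] by blast
  have "\<exists>R R'. annulus_system a b r\<^sub>1 r\<^sub>2 \<epsilon> C R V C' R' V'" if \<epsilon>: "\<bar>\<epsilon>\<bar> < min \<epsilon>1 \<epsilon>2" for \<epsilon>
    using 1(2)[of \<epsilon>] 2(2)[of \<epsilon>] \<epsilon> unfolding annulus_system_def by auto
  thus ?thesis using 1(1) 2(1) by (intro exI[of _ "min \<epsilon>1 \<epsilon>2"]) auto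
qed

definition averageC :: "coeffs \<Rightarrow> coeffs \<Rightarrow> complex \<Rightarrow> complex" where
  "averageC a b z = half_average (a 1) (b 1) z + half_average (rotated a 1) (rotated b 1) z"

lemma averageC_of_real: "r > 0 \<Longrightarrow> averageC a b (of_real r) = of_real (average_function a b r)"
  by (simp add: averageC_def half_average_of_real average_function_eq rotated_def)

section \<open>Analyticity and asymptotics of the displacement\<close>

context annulus_system begin

definition displacement :: "complex \<Rightarrow> complex" where
  "displacement z = (R' pi (R pi z) - z) / \<epsilon>"

abbreviation "nbhd k \<equiv> box_nbhd r\<^sub>1 r\<^sub>2 k"

lemma nbhd_subset: "nbhd (r\<^sub>1 / 16) \<subseteq> nbhd (r\<^sub>1 / 4)" "nbhd (3 * r\<^sub>1 / 16) \<subseteq> nbhd (r\<^sub>1 / 4)"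
  using upper.radii by (auto intro!: box_nbhd_mono)

text \<open>The upper flow shifts by at most \<open>r\<^sub>1 / 8\<close>, so width
  \<open>r\<^sub>1 / 16\<close> becomes \<open>3 * r\<^sub>1 / 16\<close>. The remaining
  \<open>r\<^sub>1 / 16\<close>, up to the width on which the lower flow is defined, serves a Cauchy
  estimate.\<close>

lemma R_in_nbhd:
  assumes "z \<in> nbhd (r\<^sub>1 / 16)" shows "R pi z \<in> nbhd (3 * r\<^sub>1 / 16)"
proof -
  have "norm (R pi z - z) \<le> r\<^sub>1 / 8"
    using upper.R_near[of pi z] assms nbhd_subset upper.C_small by auto
  from box_nbhd_step[OF assms this] show ?thesis by (simp add: algebra_simps)
qed

lemma displacement_holomorphic: "displacement holomorphic_on nbhd (r\<^sub>1 / 16)"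
proof -
  have "R' pi \<circ> R pi holomorphic_on nbhd (r\<^sub>1 / 16)"
    by (rule holomorphic_on_compose_gen[OF holomorphic_on_subset[OF upper.R_hol nbhd_subset(1)] lower.R_hol])
       (use R_in_nbhd nbhd_subset in auto)
  thus ?thesis unfolding displacement_def divide_inverse by (intro holomorphic_intros) (simp add: o_def)
qed

lemma averageC_holomorphic: "averageC a b holomorphic_on nbhd (r\<^sub>1 / 16)"
  unfolding averageC_def[abs_def]
  by (intro holomorphic_intros holomorphic_on_subset[OF upper.half_average_hol nbhd_subset(1)]
       holomorphic_on_subset[OF lower.half_average_hol nbhd_subset(1)])

text \<open>\<open>C\<close> and \<open>C'\<close> are the averaging errors of the two halves; the
  product term accounts for evaluating the lower half average at \<open>z\<close> instead of at the
  end of the upper arc, with Lipschitz constant \<open>16 * C' / r\<^sub>1\<close>.\<close>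

definition deviation where "deviation = C + C' + 16 * C' * C / r\<^sub>1"

lemma displacement_near_average:
  assumes \<epsilon>: "\<epsilon> \<noteq> 0" and z: "z \<in> nbhd (r\<^sub>1 / 16)"
  shows "norm (displacement z - averageC a b z) \<le> deviation * \<bar>\<epsilon>\<bar>"
proof -
  let ?w = "R pi z"
  let ?H1 = "half_average (a 1) (b 1)" and ?H2 = "half_average (rotated a 1) (rotated b 1)"
  have z4: "z \<in> nbhd (r\<^sub>1 / 4)" and w3: "?w \<in> nbhd (3 * r\<^sub>1 / 16)" and w4: "?w \<in> nbhd (r\<^sub>1 / 4)"
    using z R_in_nbhd[OF z] nbhd_subset by auto
  have z3: "z \<in> nbhd (3 * r\<^sub>1 / 16)" using z upper.radii box_nbhd_mono[of "r\<^sub>1 / 16" "3 * r\<^sub>1 / 16"] by auto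
  have 1: "norm (?w - z - \<epsilon> * ?H1 z) \<le> C * \<epsilon>\<^sup>2" by (rule upper.R_average[OF z4])
  have 2: "norm (R' pi ?w - ?w - \<epsilon> * ?H2 ?w) \<le> C' * \<epsilon>\<^sup>2" by (rule lower.R_average[OF w4])
  have "norm (?H2 ?w - ?H2 z) \<le> C' / (r\<^sub>1 / 16) * norm (?w - z)"
  proof (rule bounded_holomorphic_Lipschitz[OF lower.half_average_hol lower.half_average_bound convex_box_nbhd _ _ open_box_nbhd w3 z3])
    show "cball u (r\<^sub>1 / 16) \<subseteq> nbhd (r\<^sub>1 / 4)" if "u \<in> nbhd (3 * r\<^sub>1 / 16)" for u
      using box_nbhd_step[OF that, of _ "r\<^sub>1 / 16"] by (auto simp: dist_norm norm_minus_commute)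
  qed (use upper.radii in auto)
  also have "\<dots> \<le> C' / (r\<^sub>1 / 16) * (C * \<bar>\<epsilon>\<bar>)"
    using upper.R_near[OF _ z4, of pi] lower.C_small upper.radii by (intro mult_left_mono) auto
  finally have 3: "norm (\<epsilon> * (?H2 ?w - ?H2 z)) \<le> 16 * C' * C / r\<^sub>1 * \<epsilon>\<^sup>2"
    using mult_left_mono[of "norm (?H2 ?w - ?H2 z)" "C' / (r\<^sub>1 / 16) * (C * \<bar>\<epsilon>\<bar>)" "\<bar>\<epsilon>\<bar>"]
    by (simp add: norm_mult power2_eq_square mult_ac)
  have "\<epsilon> * (displacement z - averageC a b z) = (?w - z - \<epsilon> * ?H1 z) + (R' pi ?w - ?w - \<epsilon> * ?H2 ?w) + \<epsilon> * (?H2 ?w - ?H2 z)"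
  proof -
    have "\<epsilon> * displacement z = R' pi ?w - z" using \<epsilon> by (simp add: displacement_def)
    thus ?thesis by (simp add: averageC_def algebra_simps)
  qed
  hence "\<bar>\<epsilon>\<bar> * norm (displacement z - averageC a b z) = norm ((?w - z - \<epsilon> * ?H1 z) + (R' pi ?w - ?w - \<epsilon> * ?H2 ?w) + \<epsilon> * (?H2 ?w - ?H2 z))"
    by (metis norm_mult norm_of_real)
  also have "\<dots> \<le> C * \<epsilon>\<^sup>2 + C' * \<epsilon>\<^sup>2 + 16 * C' * C / r\<^sub>1 * \<epsilon>\<^sup>2"
    by (intro norm_triangle_mono 1 2 3)
  also have "\<dots> = deviation * \<epsilon>\<^sup>2" by (simp add: deviation_def algebra_simps)
  also have "\<dots> = \<bar>\<epsilon>\<bar> * (deviation * \<bar>\<epsilon>\<bar>)" by (simp add: power2_eq_square)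
  finally show ?thesis using \<epsilon> by simp
qed

lemma displacement_of_real:
  assumes "of_real x \<in> nbhd (r\<^sub>1 / 16)"
  shows "displacement (of_real x) = of_real ((return_map x - x) / \<epsilon>)"
proof -
  have x: "of_real x \<in> nbhd (r\<^sub>1 / 4)" using assms nbhd_subset by auto
  have u: "R pi (of_real x) = of_real (upper.rad pi x)"
    using upper.R_real[OF _ x, of pi] by (auto simp: upper.rad_def of_real_Re)
  hence "of_real (upper.rad pi x) \<in> nbhd (r\<^sub>1 / 4)" using R_in_nbhd[OF assms] nbhd_subset by auto
  hence "R' pi (of_real (upper.rad pi x)) = of_real (return_map x)"
    using lower.R_real[of pi "upper.rad pi x"] by (auto simp: return_map_def lower.rad_def of_real_Re)
  thus ?thesis by (simp add: displacement_def u)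
qed

lemma real_in_nbhd: "x \<in> {r\<^sub>1..r\<^sub>2} \<Longrightarrow> of_real x \<in> nbhd (r\<^sub>1 / 16)"
  using upper.radii by (auto simp: of_real_in_box_nbhd)

lemma return_map_fixed:
  assumes "\<epsilon> \<noteq> 0" "x \<in> {r\<^sub>1..r\<^sub>2}" shows "displacement (of_real x) = 0 \<longleftrightarrow> return_map x = x"
  using displacement_of_real[OF real_in_nbhd[OF assms(2)]] assms(1) by simp

text \<open>The return map is the identity plus \<open>\<epsilon>\<close> times the displacement.
  The latter is bounded on a complex neighbourhood, hence Lipschitz by Cauchy's estimate with margin
  \<open>r\<^sub>1 / 32\<close>, and the third hypothesis makes the perturbation of the identity a
  strict contraction.\<close>

lemma return_map_mono:
  assumes \<epsilon>: "\<epsilon> \<noteq> 0" "\<bar>\<epsilon>\<bar> \<le> 1" "\<bar>\<epsilon>\<bar> * (32 * (C + C' + deviation) / r\<^sub>1) < 1"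
    and xy: "r\<^sub>1 \<le> x" "x < y" "y \<le> r\<^sub>2"
  shows "return_map x < return_map y"
proof -
  have dev: "deviation \<ge> 0" using upper.C_small lower.C_small upper.radii by (simp add: deviation_def)
  have b: "norm (displacement z) \<le> C + C' + deviation" if z: "z \<in> nbhd (r\<^sub>1 / 16)" for z
  proof -
    have z4: "z \<in> nbhd (r\<^sub>1 / 4)" using z nbhd_subset by auto
    have "norm (averageC a b z) \<le> C + C'"
      unfolding averageC_def by (intro norm_triangle_mono upper.half_average_bound lower.half_average_bound z4)
    moreover have "norm (displacement z - averageC a b z) \<le> deviation"
      using displacement_near_average[OF \<epsilon>(1) z] mult_left_mono[OF \<epsilon>(2) dev] by simp
    ultimately show ?thesis using norm_triangle_sub[of "displacement z" "averageC a b z"] by simp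
  qed
  have "norm (displacement (of_real y) - displacement (of_real x)) \<le> (C + C' + deviation) / (r\<^sub>1 / 32) * norm (of_real y - of_real x :: complex)"
  proof (rule bounded_holomorphic_Lipschitz[OF displacement_holomorphic b convex_box_nbhd _ _ open_box_nbhd])
    show "cball u (r\<^sub>1 / 32) \<subseteq> nbhd (r\<^sub>1 / 16)" if "u \<in> nbhd (r\<^sub>1 / 32)" for u
      using box_nbhd_step[OF that, of _ "r\<^sub>1 / 32"] by (auto simp: dist_norm norm_minus_commute)
  qed (use xy upper.radii in \<open>auto simp: of_real_in_box_nbhd\<close>)
  moreover have "displacement (of_real y) - displacement (of_real x) = of_real ((return_map y - y) / \<epsilon> - (return_map x - x) / \<epsilon>)"
    using displacement_of_real[OF real_in_nbhd] xy by simp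
  moreover have "norm (of_real y - of_real x :: complex) = y - x" using xy by (simp flip: of_real_diff)
  ultimately have "\<bar>(return_map y - y) / \<epsilon> - (return_map x - x) / \<epsilon>\<bar> \<le> (32 * (C + C' + deviation) / r\<^sub>1) * (y - x)"
    by (simp only: norm_of_real) (simp add: mult.commute)
  hence "\<bar>(return_map y - y) - (return_map x - x)\<bar> \<le> \<bar>\<epsilon>\<bar> * ((32 * (C + C' + deviation) / r\<^sub>1) * (y - x))"
    using \<epsilon>(1) by (simp add: field_simps flip: diff_divide_distrib)
  also have "\<dots> < 1 * (y - x)" unfolding mult.assoc[symmetric] by (intro mult_strict_right_mono) (use \<epsilon>(3) xy in auto)
  finally show ?thesis by simp
qed

lemma orbit_near_circle:
  assumes r: "r \<in> {r\<^sub>1..r\<^sub>2}" and z: "z \<in> orbit r"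
  shows "\<bar>norm z - r\<bar> \<le> (C + C') * \<bar>\<epsilon>\<bar>"
proof -
  have n: "norm (\<rho> * cos \<theta>, \<rho> * sin \<theta>) = \<bar>\<rho>\<bar>" for \<rho> \<theta> :: real
    by (simp add: norm_Pair power_mult_distrib flip: distrib_left)
  have n': "norm (- (\<rho> * cos \<theta>), - (\<rho> * sin \<theta>)) = \<bar>\<rho>\<bar>" for \<rho> \<theta> :: real
    by (simp add: norm_Pair power_mult_distrib flip: distrib_left)
  have u: "\<bar>upper.rad \<theta> r - r\<bar> \<le> C * \<bar>\<epsilon>\<bar>" if "\<theta> \<in> {0..pi}" for \<theta>
    by (rule upper.rad_near[OF r that])
  have e: "0 \<le> C * \<bar>\<epsilon>\<bar>" "0 \<le> C' * \<bar>\<epsilon>\<bar>" using upper.C_small lower.C_small by auto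
  let ?r' = "upper.rad pi r"
  have "of_real ?r' \<in> nbhd (r\<^sub>1 / 4)"
    using upper.rad_range[OF r, of pi] upper.radii by (auto simp: of_real_in_box_nbhd)
  hence l: "\<bar>lower.rad \<theta> ?r' - ?r'\<bar> \<le> C' * \<bar>\<epsilon>\<bar>" if "\<theta> \<in> {0..pi}" for \<theta>
    using lower.R_near[OF that, of "of_real ?r'"] abs_Re_le_cmod[of "R' \<theta> (of_real ?r') - of_real ?r'"]
    by (simp add: lower.rad_def)
  from z consider \<theta> where "\<theta> \<in> {0..pi}" "norm z = \<bar>upper.rad \<theta> r\<bar>"
    | \<theta> where "\<theta> \<in> {0..pi}" "norm z = \<bar>lower.rad \<theta> ?r'\<bar>"
    unfolding orbit_def upper.half_arc_def lower.half_arc_def by (auto simp: n n')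
  thus ?thesis
  proof cases
    case 1
    have "r > 0" using r upper.radii by auto
    thus ?thesis using u[OF 1(1)] e unfolding 1(2) distrib_right by linarith
  next
    case 2
    have "r > 0" using r upper.radii by auto
    moreover have "\<bar>?r' - r\<bar> \<le> C * \<bar>\<epsilon>\<bar>" by (rule u) auto
    ultimately show ?thesis using l[OF 2(1)] e unfolding 2(2) distrib_right by linarith
  qed
qed
end

text \<open>\<open>D\<close> is the displacement divided by \<open>\<epsilon>\<close>, and \<open>Orb r\<close> is the orbit through \<open>(r, 0)\<close>.\<close>

definition displaces :: "coeffs \<Rightarrow> coeffs \<Rightarrow> real \<Rightarrow> real \<Rightarrow> real \<Rightarrow> real \<Rightarrow> bool" where
  "displaces a b r\<^sub>1 r\<^sub>2 K \<epsilon> \<longleftrightarrow> (\<exists>D Orb.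
      D holomorphic_on box_nbhd r\<^sub>1 r\<^sub>2 (r\<^sub>1 / 16) \<and>
      (\<forall>z\<in>box_nbhd r\<^sub>1 r\<^sub>2 (r\<^sub>1 / 16). norm (D z - averageC a b z) \<le> K * \<bar>\<epsilon>\<bar>) \<and>
      (\<forall>x. of_real x \<in> box_nbhd r\<^sub>1 r\<^sub>2 (r\<^sub>1 / 16) \<longrightarrow> D (of_real x) \<in> \<real>) \<and>
      (\<forall>S. periodic_orbit (filippov_field a b \<epsilon>) S \<and> S \<subseteq> {z. r\<^sub>1 \<le> norm z \<and> norm z \<le> r\<^sub>2} \<longrightarrow>
         (\<exists>r\<in>{r\<^sub>1..r\<^sub>2}. D (of_real r) = 0 \<and> S = Orb r)) \<and>
      (\<forall>r\<in>{r\<^sub>1..r\<^sub>2}. D (of_real r) = 0 \<longrightarrow> Orb r \<subseteq> {z. \<bar>norm z - r\<bar> \<le> K * \<bar>\<epsilon>\<bar>} \<and>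
         (Orb r \<subseteq> {z. r\<^sub>1 \<le> norm z \<and> norm z \<le> r\<^sub>2} \<longrightarrow> periodic_orbit (filippov_field a b \<epsilon>) (Orb r) \<and>
            (\<forall>x>0. (x, 0) \<in> Orb r \<longleftrightarrow> x = r))))"

theorem displacement_function:
  assumes r: "0 < r\<^sub>1" "r\<^sub>1 < r\<^sub>2"
  shows "averageC a b holomorphic_on box_nbhd r\<^sub>1 r\<^sub>2 (r\<^sub>1 / 16)" (is ?hol)
    and "\<exists>\<epsilon>\<^sub>0>0. \<exists>K. \<forall>\<epsilon>. 0 < \<bar>\<epsilon>\<bar> \<and> \<bar>\<epsilon>\<bar> < \<epsilon>\<^sub>0 \<longrightarrow> displaces a b r\<^sub>1 r\<^sub>2 K \<epsilon>" (is ?ex)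
proof -
  obtain \<epsilon>1 C V C' V' where 1: "\<epsilon>1 > 0" "\<And>\<epsilon>. \<bar>\<epsilon>\<bar> < \<epsilon>1 \<Longrightarrow> \<exists>R R'. annulus_system a b r\<^sub>1 r\<^sub>2 \<epsilon> C R V C' R' V'"
    using annulus_system_exists[OF r] by blast
  \<comment> \<open>The average function and the constants do not depend on
    \<open>\<epsilon>\<close>, so holomorphy and signs can be taken from the system at
    \<open>\<epsilon> = 0\<close>.\<close>
  obtain R0 R0' where "annulus_system a b r\<^sub>1 r\<^sub>2 0 C R0 V C' R0' V'" using 1(1) 1(2)[of 0] by auto
  then interpret zero: annulus_system a b r\<^sub>1 r\<^sub>2 0 C R0 V C' R0' V' .
  show ?hol by (rule zero.averageC_holomorphic)
  define K where "K = zero.deviation + C + C'"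
  have C: "C \<ge> 0" "C' \<ge> 0" using zero.upper.C_small zero.lower.C_small by auto
  have dev: "zero.deviation \<ge> 0" using C r by (simp add: zero.deviation_def)
  define L where "L = 32 * (C + C' + zero.deviation) / r\<^sub>1 + 1"
  have L: "L > 0" using C dev r by (simp add: L_def add_nonneg_pos)
  define \<epsilon>\<^sub>0 where "\<epsilon>\<^sub>0 = min \<epsilon>1 (min 1 (1 / L))"
  have \<epsilon>\<^sub>0: "\<epsilon>\<^sub>0 > 0" using 1(1) L by (simp add: \<epsilon>\<^sub>0_def)
  show ?ex
  proof (rule exI[of _ \<epsilon>\<^sub>0], rule conjI[OF \<epsilon>\<^sub>0], rule exI[of _ K], intro allI impI)
    fix \<epsilon> :: real assume "0 < \<bar>\<epsilon>\<bar> \<and> \<bar>\<epsilon>\<bar> < \<epsilon>\<^sub>0"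
    hence \<epsilon>: "\<epsilon> \<noteq> 0" "\<bar>\<epsilon>\<bar> < \<epsilon>1" "\<bar>\<epsilon>\<bar> \<le> 1" "\<bar>\<epsilon>\<bar> * L < 1" using L by (auto simp: \<epsilon>\<^sub>0_def field_simps)
    obtain R R' where "annulus_system a b r\<^sub>1 r\<^sub>2 \<epsilon> C R V C' R' V'" using 1(2)[OF \<epsilon>(2)] by blast
    then interpret annulus_system a b r\<^sub>1 r\<^sub>2 \<epsilon> C R V C' R' V' .
    have "\<bar>\<epsilon>\<bar> * (32 * (C + C' + deviation) / r\<^sub>1) \<le> \<bar>\<epsilon>\<bar> * L" by (intro mult_left_mono) (auto simp: L_def)
    hence mono: "return_map x < return_map y" if "r\<^sub>1 \<le> x" "x < y" "y \<le> r\<^sub>2" for x y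
      using return_map_mono[OF \<epsilon>(1,3)] \<epsilon>(4) that by simp
    have K: "deviation * \<bar>\<epsilon>\<bar> \<le> K * \<bar>\<epsilon>\<bar>" "(C + C') * \<bar>\<epsilon>\<bar> \<le> K * \<bar>\<epsilon>\<bar>"
      using C dev by (auto simp: K_def intro!: mult_right_mono)
    show "displaces a b r\<^sub>1 r\<^sub>2 K \<epsilon>"
      unfolding displaces_def
    proof (rule exI[of _ displacement], rule exI[of _ orbit], intro conjI ballI allI impI)
      show "displacement holomorphic_on box_nbhd r\<^sub>1 r\<^sub>2 (r\<^sub>1 / 16)" by (rule displacement_holomorphic)
      show "norm (displacement z - averageC a b z) \<le> K * \<bar>\<epsilon>\<bar>" if "z \<in> box_nbhd r\<^sub>1 r\<^sub>2 (r\<^sub>1 / 16)" for z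
        using displacement_near_average[OF \<epsilon>(1) that] K(1) by simp
      show "displacement (of_real x) \<in> \<real>" if "of_real x \<in> box_nbhd r\<^sub>1 r\<^sub>2 (r\<^sub>1 / 16)" for x
        using displacement_of_real[OF that] by simp
      show "\<exists>r\<in>{r\<^sub>1..r\<^sub>2}. displacement (of_real r) = 0 \<and> S = orbit r"
        if "periodic_orbit (filippov_field a b \<epsilon>) S \<and> S \<subseteq> {z. r\<^sub>1 \<le> norm z \<and> norm z \<le> r\<^sub>2}" for S
        using periodic_orbit_is_fixed_point[of S] mono that return_map_fixed[OF \<epsilon>(1)] by blast
      fix \<rho> assume \<rho>: "\<rho> \<in> {r\<^sub>1..r\<^sub>2}" and z: "displacement (of_real \<rho>) = 0"
      have fx: "return_map \<rho> = \<rho>" using return_map_fixed[OF \<epsilon>(1) \<rho>] z by simp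
      show "orbit \<rho> \<subseteq> {z. \<bar>norm z - \<rho>\<bar> \<le> K * \<bar>\<epsilon>\<bar>}"
        using orbit_near_circle[OF \<rho>] K(2) by force
      assume ann: "orbit \<rho> \<subseteq> {z. r\<^sub>1 \<le> norm z \<and> norm z \<le> r\<^sub>2}"
      have "(upper.rad pi \<rho> * cos pi, upper.rad pi \<rho> * sin pi) \<in> orbit \<rho>"
        unfolding orbit_def upper.half_arc_def by (intro UnI1 imageI) auto
      hence "r\<^sub>1 \<le> norm (- upper.rad pi \<rho>, 0 :: real) \<and> norm (- upper.rad pi \<rho>, 0 :: real) \<le> r\<^sub>2"
        using ann by auto
      hence u: "upper.rad pi \<rho> \<in> {r\<^sub>1..r\<^sub>2}" using upper.rad_pos[OF \<rho>, of pi] by simp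
      show "periodic_orbit (filippov_field a b \<epsilon>) (orbit \<rho>)"
        by (rule fixed_point_is_periodic_orbit[OF \<rho> u fx]) (use ann in auto)
      show "(x, 0) \<in> orbit \<rho> \<longleftrightarrow> x = \<rho>" if "x > 0" for x
        using orbit_axis_point[OF \<rho> u fx, of "(x, 0)"] axis_point_in_orbit[OF \<rho>] that by (auto simp: on_axis_def)
    qed
  qed
qed

section \<open>Zeros of perturbations\<close>

lemma zeros_at_least_mono: "zeros_at_least g I n \<Longrightarrow> I \<subseteq> J \<Longrightarrow> m \<le> n \<Longrightarrow> zeros_at_least g J m"
  unfolding zeros_at_least_def by (meson order_trans)

lemma zeros_at_least_distinct:
  assumes "finite S" "S \<subseteq> I" "\<And>s. s \<in> S \<Longrightarrow> g (of_real s) = 0" "n \<le> card S"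
  shows "zeros_at_least g I n"
  unfolding zeros_at_least_def using assms
  by (intro exI[of _ S] exI[of _ "\<lambda>_. 1"]) (auto simp: vanishes_def)

lemma zeros_at_least_higher_deriv:
  assumes "zeros_at_least g I (m + n)" "is_interval I" "open \<Omega>" "of_real ` I \<subseteq> \<Omega>" "g holomorphic_on \<Omega>"
    and real: "\<And>x. of_real x \<in> \<Omega> \<Longrightarrow> g (of_real x) \<in> \<real>"
  shows "zeros_at_least ((deriv ^^ m) g) I n"
  using assms(1,5,6)
proof (induction m arbitrary: g)
  case (Suc m)
  have d: "g field_differentiable at (of_real t)" if "of_real t \<in> \<Omega>" for t
    using Suc.prems(2) assms(3) that by (simp add: holomorphic_on_imp_differentiable_at)
  have "zeros_at_least (deriv g) I (m + n)"
    using Suc.prems assms(2,4) d by (intro zeros_at_least_deriv) auto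
  moreover have "deriv g holomorphic_on \<Omega>" by (intro holomorphic_deriv Suc.prems assms(3))
  moreover have "deriv g (of_real x) \<in> \<real>" if "of_real x \<in> \<Omega>" for x
  proof (rule deriv_real(2)[of "of_real -` \<Omega>" x g])
    show "open (complex_of_real -` \<Omega>)" by (intro open_vimage assms(3) continuous_intros)
    show "(g has_field_derivative deriv g (of_real x)) (at (of_real x))"
      using d[OF that] by (simp add: field_differentiable_derivI)
  qed (use that Suc.prems(3) in auto)
  ultimately have "zeros_at_least ((deriv ^^ m) (deriv g)) I n" by (rule Suc.IH)
  thus ?case by (simp add: funpow_swap1)
qed simp

text \<open>By Cauchy's estimate the \<open>m\<close>-th derivative of \<open>D\<close> stays
  nonzero on a real interval around \<open>s\<close>; more than \<open>m\<close> real zeros of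
  \<open>D\<close> there would produce a zero of it by Rolle's theorem.\<close>

lemma zeros_of_perturbation_near_point:
  assumes \<Omega>: "open \<Omega>" and F: "F holomorphic_on \<Omega>" and s: "of_real s \<in> \<Omega>" and m: "(deriv ^^ m) F (of_real s) \<noteq> 0"
  shows "\<exists>\<rho>>0. \<exists>\<eta>>0. \<forall>D. D holomorphic_on \<Omega> \<longrightarrow> (\<forall>z\<in>\<Omega>. norm (D z - F z) \<le> \<eta>) \<longrightarrow>
     (\<forall>x. of_real x \<in> \<Omega> \<longrightarrow> D (of_real x) \<in> \<real>) \<longrightarrow>
     finite {x \<in> ball s \<rho>. D (of_real x) = 0} \<and> card {x \<in> ball s \<rho>. D (of_real x) = 0} \<le> m"
proof -
  obtain d where d: "d > 0" "cball (of_real s) (2 * d) \<subseteq> \<Omega>"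
  proof -
    obtain e where "e > 0" "cball (of_real s :: complex) e \<subseteq> \<Omega>" using \<Omega> s open_contains_cball_eq by blast
    thus ?thesis using that[of "e / 2"] by simp
  qed
  define \<kappa> where "\<kappa> = norm ((deriv ^^ m) F (of_real s)) / 2"
  have \<kappa>: "\<kappa> > 0" using m by (simp add: \<kappa>_def)
  have "continuous_on \<Omega> ((deriv ^^ m) F)"
    by (intro holomorphic_on_imp_continuous_on holomorphic_higher_deriv F \<Omega>)
  then obtain d' where d': "d' > 0" "\<And>z. z \<in> \<Omega> \<Longrightarrow> dist z (of_real s) < d' \<Longrightarrow> dist ((deriv ^^ m) F z) ((deriv ^^ m) F (of_real s)) < \<kappa>"
    unfolding continuous_on_iff using s \<kappa> by blast
  define \<rho> where "\<rho> = min d d'"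
  have \<rho>: "\<rho> > 0" using d d' by (simp add: \<rho>_def)
  \<comment> \<open>With this \<open>\<eta>\<close> Cauchy's estimate contributes at most
    \<open>\<kappa> / 2\<close>, and staying within \<open>\<rho>\<close> of \<open>s\<close> less
    than \<open>\<kappa>\<close>; together this is below \<open>2 * \<kappa>\<close>, the size of
    the derivative at \<open>s\<close>.\<close>
  define \<eta> where "\<eta> = \<kappa> / 2 * d ^ m / fact m"
  have \<eta>: "\<eta> > 0" using \<kappa> d by (simp add: \<eta>_def)
  show ?thesis
  proof (rule exI[of _ \<rho>], rule conjI[OF \<rho>], rule exI[of _ \<eta>], rule conjI[OF \<eta>], intro allI impI)
    fix D assume D: "D holomorphic_on \<Omega>" "\<forall>z\<in>\<Omega>. norm (D z - F z) \<le> \<eta>"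
      and real: "\<forall>x. of_real x \<in> \<Omega> \<longrightarrow> D (of_real x) \<in> \<real>"
    have sub: "of_real ` ball s \<rho> \<subseteq> \<Omega>"
      using d by (auto simp: \<rho>_def dist_real_def dist_norm subset_iff simp flip: of_real_diff)
    have nz: "(deriv ^^ m) D (of_real x) \<noteq> 0" if x: "x \<in> ball s \<rho>" for x
    proof -
      have xs: "\<bar>x - s\<bar> < d" "\<bar>x - s\<bar> < d'" using x by (auto simp: \<rho>_def dist_real_def)
      have xO: "complex_of_real x \<in> \<Omega>" using sub x by auto
      have cb: "cball (of_real x) d \<subseteq> \<Omega>"
      proof
        fix w assume "w \<in> cball (complex_of_real x) d"
        hence "dist (of_real s) w \<le> dist (of_real s) (complex_of_real x) + d"
          using dist_triangle[of "of_real s" w "of_real x"] by simp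
        also have "dist (of_real s) (complex_of_real x) = \<bar>s - x\<bar>" by (simp add: dist_norm flip: of_real_diff)
        finally show "w \<in> \<Omega>" using d(2) xs(1) by auto
      qed
      have h: "(\<lambda>z. D z - F z) holomorphic_on \<Omega>" using D F by (intro holomorphic_intros)
      have "norm ((deriv ^^ m) (\<lambda>z. D z - F z) (of_real x)) \<le> fact m * \<eta> / d ^ m"
      proof (rule Cauchy_inequality)
        have h': "(\<lambda>z. D z - F z) holomorphic_on cball (of_real x) d" by (rule holomorphic_on_subset[OF h cb])
        show "(\<lambda>z. D z - F z) holomorphic_on ball (of_real x) d" by (rule holomorphic_on_subset[OF h' ball_subset_cball])
        show "continuous_on (cball (of_real x) d) (\<lambda>z. D z - F z)" by (rule holomorphic_on_imp_continuous_on[OF h'])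
        show "norm (D w - F w) \<le> \<eta>" if "norm (of_real x - w) = d" for w
          using D(2) cb that by (auto simp: dist_norm)
      qed (use d in auto)
      also have "fact m * \<eta> / d ^ m = \<kappa> / 2" using d by (simp add: \<eta>_def)
      also have "(deriv ^^ m) (\<lambda>z. D z - F z) (of_real x) = (deriv ^^ m) D (of_real x) - (deriv ^^ m) F (of_real x)"
        by (rule higher_deriv_diff[OF D(1) F \<Omega> xO])
      finally have 1: "norm ((deriv ^^ m) D (of_real x) - (deriv ^^ m) F (of_real x)) \<le> \<kappa> / 2" .
      have "dist (complex_of_real x) (of_real s) < d'" using xs(2) by (simp add: dist_norm flip: of_real_diff)
      hence 2: "norm ((deriv ^^ m) F (of_real x) - (deriv ^^ m) F (of_real s)) < \<kappa>"
        using d'(2)[OF xO] by (simp add: dist_norm)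
      show ?thesis
      proof
        assume z: "(deriv ^^ m) D (of_real x) = 0"
        have "2 * \<kappa> = norm ((deriv ^^ m) F (of_real s))" by (simp add: \<kappa>_def)
        also have "\<dots> \<le> norm ((deriv ^^ m) F (of_real x)) + norm ((deriv ^^ m) F (of_real x) - (deriv ^^ m) F (of_real s))"
          by (metis norm_minus_commute norm_triangle_sub)
        finally show False using 1 2 \<kappa> z by simp
      qed
    qed
    let ?Z = "{x \<in> ball s \<rho>. D (of_real x) = 0}"
    have small: "card T \<le> m" if T: "finite T" "T \<subseteq> ?Z" for T
    proof (rule ccontr)
      assume "\<not> card T \<le> m"
      hence "zeros_at_least D (ball s \<rho>) (m + 1)" using T by (intro zeros_at_least_distinct[of T]) auto
      hence "zeros_at_least ((deriv ^^ m) D) (ball s \<rho>) 1"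
        using \<Omega> sub D(1) real by (intro zeros_at_least_higher_deriv) (auto simp: is_interval_ball_real)
      thus False using zeros_at_least_exists nz by force
    qed
    have "finite ?Z"
    proof (rule ccontr)
      assume "infinite ?Z"
      then obtain T where "T \<subseteq> ?Z" "finite T" "card T = Suc m" using infinite_arbitrarily_large by blast
      thus False using small[of T] by simp
    qed
    thus "finite ?Z \<and> card ?Z \<le> m" using small[of ?Z] by simp
  qed
qed

text \<open>Compactness leaves finitely many local intervals. Each holds at most as many zeros of
  \<open>D\<close> as the order of \<open>F\<close> at its centre, and these orders add up to at
  most \<open>N\<close>.\<close>

lemma zeros_of_perturbation:
  assumes \<Omega>: "open \<Omega>" and F: "F holomorphic_on \<Omega>" and sub: "of_real ` {a..b} \<subseteq> \<Omega>"
    and N: "\<not> zeros_at_least F {a..b} (Suc N)"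
  shows "\<exists>\<eta>>0. \<forall>D. D holomorphic_on \<Omega> \<longrightarrow> (\<forall>z\<in>\<Omega>. norm (D z - F z) \<le> \<eta>) \<longrightarrow>
     (\<forall>x. of_real x \<in> \<Omega> \<longrightarrow> D (of_real x) \<in> \<real>) \<longrightarrow>
     finite {x \<in> {a..b}. D (of_real x) = 0} \<and> card {x \<in> {a..b}. D (of_real x) = 0} \<le> N"
proof -
  \<comment> \<open>A point where all derivatives vanish would by itself carry multiplicity
    \<open>Suc N\<close>.\<close>
  have ex: "\<exists>m. (deriv ^^ m) F (of_real s) \<noteq> 0" if "s \<in> {a..b}" for s
  proof (rule ccontr)
    assume "\<nexists>m. (deriv ^^ m) F (of_real s) \<noteq> 0"
    hence "zeros_at_least F {a..b} (Suc N)"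
      unfolding zeros_at_least_def vanishes_def using that
      by (intro exI[of _ "{s}"] exI[of _ "\<lambda>_. Suc N"]) auto
    thus False using N by blast
  qed
  define m where "m s = (LEAST m. (deriv ^^ m) F (of_real s) \<noteq> 0)" for s
  have m: "(deriv ^^ m s) F (of_real s) \<noteq> 0" if "s \<in> {a..b}" for s
    unfolding m_def by (rule LeastI_ex[OF ex[OF that]])
  have van: "vanishes (m s) F s" for s
    unfolding vanishes_def m_def using not_less_Least by blast
  define P where "P s \<rho> \<eta> \<longleftrightarrow> \<rho> > 0 \<and> \<eta> > 0 \<and> (\<forall>D. D holomorphic_on \<Omega> \<longrightarrow> (\<forall>z\<in>\<Omega>. norm (D z - F z) \<le> \<eta>) \<longrightarrow>
     (\<forall>x. of_real x \<in> \<Omega> \<longrightarrow> D (of_real x) \<in> \<real>) \<longrightarrow>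
     finite {x \<in> ball s \<rho>. D (of_real x) = 0} \<and> card {x \<in> ball s \<rho>. D (of_real x) = 0} \<le> m s)" for s \<rho> \<eta> :: real
  have "\<forall>s\<in>{a..b}. \<exists>\<rho> \<eta>. P s \<rho> \<eta>"
  proof
    fix s assume s: "s \<in> {a..b}"
    hence "of_real s \<in> \<Omega>" using sub by blast
    from zeros_of_perturbation_near_point[OF \<Omega> F this m[OF s]] show "\<exists>\<rho> \<eta>. P s \<rho> \<eta>"
      unfolding P_def by blast
  qed
  then obtain \<rho> \<eta> where P: "\<And>s. s \<in> {a..b} \<Longrightarrow> P s (\<rho> s) (\<eta> s)" by metis
  hence \<rho>\<eta>: "\<rho> s > 0" "\<eta> s > 0" if "s \<in> {a..b}" for s using that unfolding P_def by blast+
  obtain T where T: "T \<subseteq> {a..b}" "finite T" "{a..b} \<subseteq> (\<Union>s\<in>T. ball s (\<rho> s))"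
  proof (rule compactE_image[of "{a..b}" "{a..b}" "\<lambda>s. ball s (\<rho> s)"])
    show "{a..b} \<subseteq> (\<Union>s\<in>{a..b}. ball s (\<rho> s))"
    proof
      fix x assume x: "x \<in> {a..b}"
      hence "x \<in> ball x (\<rho> x)" using \<rho>\<eta>(1) by simp
      thus "x \<in> (\<Union>s\<in>{a..b}. ball s (\<rho> s))" using x by blast
    qed
  qed auto
  define \<eta>' where "\<eta>' = Min (insert 1 (\<eta> ` T))"
  have \<eta>': "\<eta>' > 0" "\<And>s. s \<in> T \<Longrightarrow> \<eta>' \<le> \<eta> s" using T \<rho>\<eta>(2) by (auto simp: \<eta>'_def)
  have sum: "sum m T \<le> N"
  proof (rule ccontr)
    assume "\<not> sum m T \<le> N"
    hence "zeros_at_least F {a..b} (Suc N)" unfolding zeros_at_least_def using T van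
      by (intro exI[of _ T] exI[of _ m]) auto
    thus False using N by blast
  qed
  show ?thesis
  proof (rule exI[of _ \<eta>'], rule conjI[OF \<eta>'(1)], intro allI impI)
    fix D assume D: "D holomorphic_on \<Omega>" "\<forall>z\<in>\<Omega>. norm (D z - F z) \<le> \<eta>'"
      and real: "\<forall>x. of_real x \<in> \<Omega> \<longrightarrow> D (of_real x) \<in> \<real>"
    let ?Z = "\<lambda>s. {x \<in> ball s (\<rho> s). D (of_real x) = 0}"
    have Z: "finite (?Z s) \<and> card (?Z s) \<le> m s" if "s \<in> T" for s
    proof -
      have "s \<in> {a..b}" using T that by auto
      moreover have "\<forall>z\<in>\<Omega>. norm (D z - F z) \<le> \<eta> s" using D(2) \<eta>'(2)[OF that] by force
      ultimately show ?thesis using P[of s] D(1) real unfolding P_def by blast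
    qed
    have subZ: "{x \<in> {a..b}. D (of_real x) = 0} \<subseteq> (\<Union>s\<in>T. ?Z s)" using T(3) by blast
    have fin: "finite (\<Union>s\<in>T. ?Z s)" using T(2) Z by auto
    have "card {x \<in> {a..b}. D (of_real x) = 0} \<le> card (\<Union>s\<in>T. ?Z s)" by (rule card_mono[OF fin subZ])
    also have "\<dots> \<le> (\<Sum>s\<in>T. card (?Z s))" by (rule card_UN_le[OF T(2)])
    also have "\<dots> \<le> sum m T" by (intro sum_mono) (use Z in auto)
    finally show "finite {x \<in> {a..b}. D (of_real x) = 0} \<and> card {x \<in> {a..b}. D (of_real x) = 0} \<le> N"
      using sum finite_subset[OF subZ fin] by simp
  qed
qed

section \<open>Multiplicity of the zeros of the average function\<close>

lemma box_nbhd_rhp: "d \<le> r\<^sub>1 \<Longrightarrow> box_nbhd r\<^sub>1 r\<^sub>2 d \<subseteq> rhp"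
  by (auto simp: box_nbhd_def rhp_def)

lemma holomorphic_ect: "ect c0 c1 c2 c3 e1 e2 e3 holomorphic_on slit"
  unfolding holomorphic_on_open[OF open_slit] by (intro ballI exI) (rule DERIV_ect)

text \<open>The formula is known at positive real radii; the identity theorem extends it to an open
  complex set, where equal functions have equal derivatives of all orders.\<close>

lemma averageC_ect:
  assumes r: "0 < r\<^sub>1" "r\<^sub>1 < r\<^sub>2" and c: "\<And>r. r > 0 \<Longrightarrow> r * average_function a b r = ectR c0 c1 c2 c3 e1 e2 e3 r"
    and z: "z \<in> box_nbhd r\<^sub>1 r\<^sub>2 (r\<^sub>1 / 16)"
  shows "averageC a b z * z = ect c0 c1 c2 c3 e1 e2 e3 z"
proof -
  let ?B = "box_nbhd r\<^sub>1 r\<^sub>2 (r\<^sub>1 / 16)"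
  have sub: "?B \<subseteq> slit" using box_nbhd_rhp[of "r\<^sub>1 / 16" r\<^sub>1 r\<^sub>2] rhp_slit r by auto
  have "averageC a b z * z - ect c0 c1 c2 c3 e1 e2 e3 z = 0"
  proof (rule analytic_continuation[where S = ?B and U = "of_real ` {r\<^sub>1..r\<^sub>2}" and \<xi> = "of_real r\<^sub>1" and w = z
      and f = "\<lambda>z. averageC a b z * z - ect c0 c1 c2 c3 e1 e2 e3 z"])
    show "(\<lambda>z. averageC a b z * z - ect c0 c1 c2 c3 e1 e2 e3 z) holomorphic_on ?B"
      using displacement_function(1)[OF r] holomorphic_on_subset[OF holomorphic_ect sub]
      by (intro holomorphic_intros)
    show "connected ?B" by (intro convex_connected convex_box_nbhd)
    show "of_real ` {r\<^sub>1..r\<^sub>2} \<subseteq> ?B" "of_real r\<^sub>1 \<in> ?B" using r by (auto simp: of_real_in_box_nbhd)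
    show "complex_of_real r\<^sub>1 islimpt of_real ` {r\<^sub>1..r\<^sub>2}"
    proof (rule connected_imp_perfect)
      show "connected (complex_of_real ` {r\<^sub>1..r\<^sub>2})" by (intro connected_continuous_image continuous_intros) auto
      show "complex_of_real ` {r\<^sub>1..r\<^sub>2} \<noteq> {u}" for u
      proof
        assume u: "complex_of_real ` {r\<^sub>1..r\<^sub>2} = {u}"
        have "complex_of_real r\<^sub>1 \<in> of_real ` {r\<^sub>1..r\<^sub>2}" "complex_of_real r\<^sub>2 \<in> of_real ` {r\<^sub>1..r\<^sub>2}" using r by auto
        thus False unfolding u using r by auto
      qed
    qed (use r in auto)
    show "averageC a b w * w - ect c0 c1 c2 c3 e1 e2 e3 w = 0" if w: "w \<in> of_real ` {r\<^sub>1..r\<^sub>2}" for w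
    proof -
      obtain x where x: "w = of_real x" "x > 0" using w r by force
      thus ?thesis using c[OF x(2)] by (simp add: averageC_of_real ect_of_real mult.commute flip: of_real_mult)
    qed
  qed (use z in \<open>auto intro: open_box_nbhd\<close>)
  thus ?thesis by simp
qed

lemma averageC_zeros:
  assumes r: "0 < r\<^sub>1" "r\<^sub>1 < r\<^sub>2" and nz: "average_nonzero a b"
  shows "\<not> zeros_at_least (averageC a b) {r\<^sub>1..r\<^sub>2} (Suc 6)"
proof
  assume z: "zeros_at_least (averageC a b) {r\<^sub>1..r\<^sub>2} (Suc 6)"
  obtain c0 c1 c2 c3 e1 e2 e3 where c: "\<And>r. r > 0 \<Longrightarrow> r * average_function a b r = ectR c0 c1 c2 c3 e1 e2 e3 r"
    using average_function_ectR[of a b] by blast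
  let ?B = "box_nbhd r\<^sub>1 r\<^sub>2 (r\<^sub>1 / 16)"
  have sub: "of_real ` {r\<^sub>1..r\<^sub>2} \<subseteq> ?B" using r by (auto simp: of_real_in_box_nbhd)
  have "zeros_at_least (\<lambda>z. averageC a b z * z) {r\<^sub>1..r\<^sub>2} (Suc 6)"
    by (rule zeros_at_least_mult[OF z open_box_nbhd sub displacement_function(1)[OF r]]) (rule holomorphic_on_ident)
  hence "zeros_at_least (ect c0 c1 c2 c3 e1 e2 e3) {r\<^sub>1..r\<^sub>2} (Suc 6)"
    by (rule zeros_at_least_cong[OF _ open_box_nbhd sub averageC_ect[OF r c]])
  hence "zeros_at_least (ect c0 c1 c2 c3 e1 e2 e3) {0<..} 7"
    by (rule zeros_at_least_mono) (use r in auto)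
  from ect_zeros[OF this] have "ectR c0 c1 c2 c3 e1 e2 e3 x = 0" for x by (simp add: ectR_def)
  thus False using nz c unfolding average_nonzero_def by (metis mult_eq_0_iff less_irrefl)
qed

section \<open>The number of limit cycles\<close>

text \<open>The estimate is made for all periodic orbits in the annulus: each is
  \<open>Orb r\<close> for a real zero \<open>r\<close> of the displacement, and limit cycles are
  among them.\<close>

theorem at_most_six_limit_cycles:
  assumes nz: "average_nonzero a b" and r: "0 < r\<^sub>1" "r\<^sub>1 < r\<^sub>2"
  shows "\<exists>\<epsilon>\<^sub>0>0. \<forall>\<epsilon>. 0 < \<bar>\<epsilon>\<bar> \<and> \<bar>\<epsilon>\<bar> < \<epsilon>\<^sub>0 \<longrightarrow>
          finite (limit_cycles_in_annulus a b \<epsilon> r\<^sub>1 r\<^sub>2) \<and> card (limit_cycles_in_annulus a b \<epsilon> r\<^sub>1 r\<^sub>2) \<le> 6"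
proof -
  let ?B = "box_nbhd r\<^sub>1 r\<^sub>2 (r\<^sub>1 / 16)"
  have sub: "of_real ` {r\<^sub>1..r\<^sub>2} \<subseteq> ?B" using r by (auto simp: of_real_in_box_nbhd)
  obtain \<eta> where \<eta>: "\<eta> > 0" "\<And>D. D holomorphic_on ?B \<Longrightarrow> \<forall>z\<in>?B. norm (D z - averageC a b z) \<le> \<eta> \<Longrightarrow>
     \<forall>x. of_real x \<in> ?B \<longrightarrow> D (of_real x) \<in> \<real> \<Longrightarrow>
     finite {x \<in> {r\<^sub>1..r\<^sub>2}. D (of_real x) = 0} \<and> card {x \<in> {r\<^sub>1..r\<^sub>2}. D (of_real x) = 0} \<le> 6"
    using zeros_of_perturbation[OF open_box_nbhd displacement_function(1)[OF r] sub averageC_zeros[OF r nz]] by blast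
  obtain \<epsilon>\<^sub>0 K where \<epsilon>\<^sub>0: "\<epsilon>\<^sub>0 > 0" and K: "\<And>\<epsilon>. 0 < \<bar>\<epsilon>\<bar> \<and> \<bar>\<epsilon>\<bar> < \<epsilon>\<^sub>0 \<Longrightarrow> displaces a b r\<^sub>1 r\<^sub>2 K \<epsilon>"
    using displacement_function(2)[OF r] by blast
  \<comment> \<open>The denominator \<open>\<bar>K\<bar> + 1\<close> is positive whatever the sign
    of \<open>K\<close>.\<close>
  define \<epsilon>1 where "\<epsilon>1 = min \<epsilon>\<^sub>0 (\<eta> / (\<bar>K\<bar> + 1))"
  have "\<epsilon>1 > 0" using \<epsilon>\<^sub>0 \<eta>(1) by (simp add: \<epsilon>1_def add_nonneg_pos)
  moreover have "finite (limit_cycles_in_annulus a b \<epsilon> r\<^sub>1 r\<^sub>2) \<and> card (limit_cycles_in_annulus a b \<epsilon> r\<^sub>1 r\<^sub>2) \<le> 6"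
    if \<epsilon>: "0 < \<bar>\<epsilon>\<bar> \<and> \<bar>\<epsilon>\<bar> < \<epsilon>1" for \<epsilon>
  proof -
    obtain D Orb where D: "D holomorphic_on ?B" "\<forall>z\<in>?B. norm (D z - averageC a b z) \<le> K * \<bar>\<epsilon>\<bar>"
      "\<forall>x. of_real x \<in> ?B \<longrightarrow> D (of_real x) \<in> \<real>"
      "\<forall>S. periodic_orbit (filippov_field a b \<epsilon>) S \<and> S \<subseteq> {z. r\<^sub>1 \<le> norm z \<and> norm z \<le> r\<^sub>2} \<longrightarrow>
         (\<exists>r\<in>{r\<^sub>1..r\<^sub>2}. D (of_real r) = 0 \<and> S = Orb r)"
      using K[of \<epsilon>] \<epsilon> unfolding displaces_def \<epsilon>1_def by auto
    have "\<bar>\<epsilon>\<bar> * (\<bar>K\<bar> + 1) \<le> \<eta>" using \<epsilon> by (simp add: \<epsilon>1_def pos_less_divide_eq add_nonneg_pos less_imp_le)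
    moreover have "K * \<bar>\<epsilon>\<bar> \<le> \<bar>\<epsilon>\<bar> * (\<bar>K\<bar> + 1)" using mult_right_mono[OF abs_ge_self[of K], of "\<bar>\<epsilon>\<bar>"] by (simp add: algebra_simps)
    ultimately have "\<forall>z\<in>?B. norm (D z - averageC a b z) \<le> \<eta>" using D(2) by force
    note Z = \<eta>(2)[OF D(1) this D(3)]
    let ?Z = "{x \<in> {r\<^sub>1..r\<^sub>2}. D (of_real x) = 0}"
    have sub: "limit_cycles_in_annulus a b \<epsilon> r\<^sub>1 r\<^sub>2 \<subseteq> Orb ` ?Z"
    proof
      fix S assume "S \<in> limit_cycles_in_annulus a b \<epsilon> r\<^sub>1 r\<^sub>2"
      hence "periodic_orbit (filippov_field a b \<epsilon>) S \<and> S \<subseteq> {z. r\<^sub>1 \<le> norm z \<and> norm z \<le> r\<^sub>2}"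
        by (simp add: limit_cycles_in_annulus_def limit_cycle_def)
      then obtain x where "x \<in> {r\<^sub>1..r\<^sub>2}" "D (of_real x) = 0" "S = Orb x" using D(4) by meson
      thus "S \<in> Orb ` ?Z" by simp
    qed
    have fin: "finite ?Z" and card: "card ?Z \<le> 6" using Z by auto
    have "card (limit_cycles_in_annulus a b \<epsilon> r\<^sub>1 r\<^sub>2) \<le> card (Orb ` ?Z)"
      by (rule card_mono[OF finite_imageI[OF fin] sub])
    also have "\<dots> \<le> 6" using card_image_le[OF fin, of Orb] card by simp
    finally show ?thesis using finite_subset[OF sub finite_imageI[OF fin]] by simp
  qed
  ultimately show ?thesis by blast
qed

section \<open>A perturbation with six limit cycles\<close>

lemma ectR_scale: "ectR (t * c0) (t * c1) (t * c2) (t * c3) (t * e1) (t * e2) (t * e3) r = t * ectR c0 c1 c2 c3 e1 e2 e3 r"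
  by (simp add: ectR_def algebra_simps)

text \<open>Six linear conditions on seven coefficients have a nontrivial solution.\<close>

lemma ectR_six_zeros:
  "\<exists>c0 c1 c2 c3 e1 e2 e3. (c0, c1, c2, c3, e1, e2, e3) \<noteq> 0 \<and> (\<forall>k\<in>{1, 2, 3, 4, 5, 6}. ectR c0 c1 c2 c3 e1 e2 e3 k = 0)"
proof -
  define f :: "real \<times> real \<times> real \<times> real \<times> real \<times> real \<times> real \<Rightarrow> real \<times> real \<times> real \<times> real \<times> real \<times> real" where
    "f = (\<lambda>(c0, c1, c2, c3, e1, e2, e3). (ectR c0 c1 c2 c3 e1 e2 e3 1, ectR c0 c1 c2 c3 e1 e2 e3 2,
        ectR c0 c1 c2 c3 e1 e2 e3 3, ectR c0 c1 c2 c3 e1 e2 e3 4, ectR c0 c1 c2 c3 e1 e2 e3 5, ectR c0 c1 c2 c3 e1 e2 e3 6))"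
  have lin: "linear f"
    by (rule linearI) (auto simp: f_def ectR_add ectR_scale)
  have "\<not> inj f"
  proof
    assume "inj f"
    hence "dim (f ` UNIV) = dim (UNIV :: (real \<times> real \<times> real \<times> real \<times> real \<times> real \<times> real) set)"
      by (intro dim_image_eq lin) (auto intro: inj_on_subset)
    thus False using dim_subset_UNIV[of "f ` UNIV"] by simp
  qed
  then obtain c where "f c = 0" "c \<noteq> 0" using linear_injective_0[OF lin] by blast
  moreover obtain c0 c1 c2 c3 e1 e2 e3 where "c = (c0, c1, c2, c3, e1, e2, e3)" by (cases c)
  ultimately show ?thesis
    by - (rule exI[of _ c0], rule exI[of _ c1], rule exI[of _ c2], rule exI[of _ c3],
          rule exI[of _ e1], rule exI[of _ e2], rule exI[of _ e3], simp add: f_def zero_prod_def)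
qed

lemma simple_zero_sign_change:
  fixes g :: "real \<Rightarrow> real"
  assumes "(g has_real_derivative d) (at k)" "d \<noteq> 0" "g k = 0" "\<delta> > 0"
  shows "\<exists>u v. k - \<delta> < u \<and> u < k \<and> k < v \<and> v < k + \<delta> \<and> g u * g v < 0"
proof -
  have pos: "\<exists>u v. k - \<delta> < u \<and> u < k \<and> k < v \<and> v < k + \<delta> \<and> h u < 0 \<and> h v > 0"
    if h: "(h has_real_derivative l) (at k)" "l > 0" "h k = 0" for h l
  proof -
    obtain d1 where d1: "d1 > 0" "\<forall>t>0. t < d1 \<longrightarrow> h k < h (k + t)" using DERIV_pos_inc_right[OF h(1,2)] by blast
    obtain d2 where d2: "d2 > 0" "\<forall>t>0. t < d2 \<longrightarrow> h (k - t) < h k" using DERIV_pos_inc_left[OF h(1,2)] by blast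
    define t where "t = min \<delta> (min d1 d2) / 2"
    have "t > 0" "t < \<delta>" "t < d1" "t < d2" using d1(1) d2(1) \<open>\<delta> > 0\<close> by (auto simp: t_def)
    thus ?thesis using d1(2) d2(2) h(3) by (intro exI[of _ "k - t"] exI[of _ "k + t"]) auto
  qed
  show ?thesis
  proof (cases "d > 0")
    case True thus ?thesis using pos[of g d] assms by (metis mult_neg_pos)
  next
    case False
    hence "-d > 0" using assms by simp
    from pos[of "\<lambda>t. - g t", OF DERIV_minus[OF assms(1)] this] assms(3) obtain u v where
      "k - \<delta> < u" "u < k" "k < v" "v < k + \<delta>" "- g u < 0" "- g v > 0" by auto
    thus ?thesis by (intro exI[of _ u] exI[of _ v]) (auto intro: mult_pos_neg)
  qed
qed

text \<open>Seven zeros with multiplicity are impossible for nonzero coefficients, so none of the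
  prescribed six can be double, and a simple zero is a sign change. Windows of half-width
  \<open>1/4\<close> around distinct integers are disjoint.\<close>

lemma average_with_six_sign_changes:
  "\<exists>a b. average_nonzero a b \<and> (\<forall>k\<in>{1, 2, 3, 4, 5, 6}. \<exists>u v. k - 1/4 < u \<and> u < k \<and> k < v \<and> v < k + 1/4
      \<and> average_function a b u * average_function a b v < 0)"
proof -
  obtain c0 c1 c2 c3 e1 e2 e3 where c: "(c0, c1, c2, c3, e1, e2, e3) \<noteq> (0 :: real \<times> real \<times> real \<times> real \<times> real \<times> real \<times> real)"
    and z: "\<And>k. k \<in> {1, 2, 3, 4, 5, 6} \<Longrightarrow> ectR c0 c1 c2 c3 e1 e2 e3 k = 0"
    using ectR_six_zeros by blast
  let ?g = "ectR c0 c1 c2 c3 e1 e2 e3" and ?G = "ect c0 c1 c2 c3 e1 e2 e3"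
  obtain a b where ab: "\<And>r. r > 0 \<Longrightarrow> r * average_function a b r = ?g r" using ectR_is_average by blast
  have no7: "\<not> zeros_at_least ?G {0<..} 7"
    using ect_zeros[of c0 c1 c2 c3 e1 e2 e3] c by (auto simp: zero_prod_def)
  have "average_nonzero a b"
  proof (rule ccontr)
    assume "\<not> average_nonzero a b"
    hence "?g x = 0" if "x > 0" for x using ab[OF that] that by (simp add: average_nonzero_def)
    hence "zeros_at_least ?G {0<..} 7"
      by (intro zeros_at_least_distinct[of "{1, 2, 3, 4, 5, 6, 7}"]) (auto simp: ect_of_real)
    thus False using no7 by blast
  qed
  moreover have "\<exists>u v. k - 1/4 < u \<and> u < k \<and> k < v \<and> v < k + 1/4 \<and> average_function a b u * average_function a b v < 0"
    if k: "k \<in> {1, 2, 3, 4, 5, 6}" for k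
  proof -
    have kpos: "k \<ge> 1" using k by auto
    let ?d = "deriv ?G (of_real k)"
    have dG: "(?G has_field_derivative ?d) (at (of_real k))"
      using DERIV_ect[OF of_real_pos_subset(3)] DERIV_imp_deriv by metis
    have "?d \<noteq> 0"
    proof
      assume d0: "?d = 0"
      have "zeros_at_least ?G {0<..} 7" unfolding zeros_at_least_def
      proof (intro exI[of _ "{1, 2, 3, 4, 5, 6}"] exI[of _ "\<lambda>x. if x = k then 2 else 1"] conjI ballI)
        fix s :: real assume s: "s \<in> {1, 2, 3, 4, 5, 6}"
        show "vanishes (if s = k then 2 else 1) ?G s"
          using z[OF s] d0 by (auto simp: vanishes_def ect_of_real less_2_cases_iff)
      next
        show "7 \<le> (\<Sum>x\<in>{1, 2, 3, 4, 5, 6}. if x = k then 2 else 1 :: nat)" using k by auto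
      qed auto
      thus False using no7 by blast
    qed
    moreover have rl: "((\<lambda>t. Re (?G (of_real t))) has_real_derivative Re ?d) (at k)" "?d \<in> \<real>"
      using deriv_real[OF open_UNIV _ dG] by (auto simp: ect_of_real)
    ultimately have "Re ?d \<noteq> 0" by (auto simp: complex_is_Real_iff complex_eq_iff)
    moreover have "(?g has_real_derivative Re ?d) (at k)" using rl(1) by (simp add: ect_of_real)
    ultimately obtain u v where uv: "k - 1/4 < u" "u < k" "k < v" "v < k + 1/4" "?g u * ?g v < 0"
      using simple_zero_sign_change[of ?g "Re ?d" k "1/4"] z[OF k] by auto
    have "u > 0" "v > 0" using uv kpos by auto
    have "(u * v) * (average_function a b u * average_function a b v) = ?g u * ?g v"
      unfolding ab[OF \<open>u > 0\<close>, symmetric] ab[OF \<open>v > 0\<close>, symmetric] by (simp add: mult_ac)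
    hence "(u * v) * (average_function a b u * average_function a b v) < 0" using uv(5) by simp
    hence "average_function a b u * average_function a b v < 0"
      using \<open>u > 0\<close> \<open>v > 0\<close> by (simp add: mult_less_0_iff zero_less_mult_iff)
    thus ?thesis using uv by blast
  qed
  ultimately show ?thesis by blast
qed

text \<open>A perturbation smaller than the endpoint values keeps their signs, so the intermediate
  value theorem applies to the real part; reality of \<open>D\<close> makes its zero a zero of
  \<open>D\<close>.\<close>

lemma real_zero_from_sign_change:
  assumes \<Omega>: "open \<Omega>" and D: "D holomorphic_on \<Omega>" and sub: "of_real ` {u..v} \<subseteq> \<Omega>" and uv: "u < v"
    and real: "\<And>x. of_real x \<in> \<Omega> \<Longrightarrow> D (of_real x) \<in> \<real>"
    and f: "f u * f v < 0" "norm (D (of_real u) - of_real (f u)) < \<bar>f u\<bar>" "norm (D (of_real v) - of_real (f v)) < \<bar>f v\<bar>"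
  shows "\<exists>x\<in>{u..v}. D (of_real x) = 0"
proof -
  let ?d = "\<lambda>x. Re (D (of_real x))"
  have c: "continuous_on {u..v} ?d"
    by (intro continuous_on_Re continuous_on_compose2[OF holomorphic_on_imp_continuous_on[OF D]] continuous_intros sub)
  have near: "\<bar>?d x - f x\<bar> \<le> norm (D (of_real x) - of_real (f x))" for x
    using abs_Re_le_cmod[of "D (of_real x) - of_real (f x)"] by simp
  have "\<exists>x. u \<le> x \<and> x \<le> v \<and> ?d x = 0"
  proof (cases "f u < 0")
    case True
    hence "f v > 0" using f(1) by (simp add: mult_less_0_iff)
    hence "?d u \<le> 0" "0 \<le> ?d v" using True near[of u] near[of v] f(2,3) by linarith+
    thus ?thesis using IVT'[of ?d u 0 v] c uv by auto
  next
    case False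
    hence "f u > 0" "f v < 0" using f(1) by (auto simp: mult_less_0_iff)
    hence "?d v \<le> 0" "0 \<le> ?d u" using near[of u] near[of v] f(2,3) by linarith+
    thus ?thesis using IVT2'[of ?d v 0 u] c uv by auto
  qed
  then obtain x where x: "x \<in> {u..v}" "?d x = 0" by auto
  moreover have "D (of_real x) \<in> \<real>" using real sub x(1) by blast
  ultimately show ?thesis by (auto simp: complex_is_Real_iff complex_eq_iff)
qed

theorem six_limit_cycles_attained:
  "\<exists>a b. average_nonzero a b \<and> (\<exists>r\<^sub>1 r\<^sub>2. 0 < r\<^sub>1 \<and> r\<^sub>1 < r\<^sub>2 \<and>
     (\<exists>\<epsilon>\<^sub>0>0. \<forall>\<epsilon>. 0 < \<bar>\<epsilon>\<bar> \<and> \<bar>\<epsilon>\<bar> < \<epsilon>\<^sub>0 \<longrightarrow> card (limit_cycles_in_annulus a b \<epsilon> r\<^sub>1 r\<^sub>2) = 6))"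
proof -
  define N :: "real set" where "N = {1, 2, 3, 4, 5, 6}"
  have N: "finite N" "card N = 6" "\<And>k. k \<in> N \<Longrightarrow> 1 \<le> k \<and> k \<le> 6" by (auto simp: N_def)
  have gap: "1 \<le> \<bar>k - l\<bar>" if "k \<in> N" "l \<in> N" "k \<noteq> l" for k l using that by (auto simp: N_def)
  obtain a b where nz: "average_nonzero a b"
    and "\<forall>k\<in>N. \<exists>u v. k - 1/4 < u \<and> u < k \<and> k < v \<and> v < k + 1/4 \<and> average_function a b u * average_function a b v < 0"
    using average_with_six_sign_changes unfolding N_def by blast
  then obtain u v where uv: "\<And>k. k \<in> N \<Longrightarrow> k - 1/4 < u k \<and> u k < k \<and> k < v k \<and> v k < k + 1/4 \<and>
      average_function a b (u k) * average_function a b (v k) < 0"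
    by metis
  \<comment> \<open>All zeros will lie between \<open>3/4\<close> and \<open>25/4\<close>, so orbits
    that deviate from their circles by at most \<open>1/8\<close> stay strictly inside this
    annulus.\<close>
  define r\<^sub>1 r\<^sub>2 :: real where r_def: "r\<^sub>1 = 1/4" "r\<^sub>2 = 8"
  have r: "0 < r\<^sub>1" "r\<^sub>1 < r\<^sub>2" by (auto simp: r_def)
  let ?B = "box_nbhd r\<^sub>1 r\<^sub>2 (r\<^sub>1 / 16)"
  define f where "f = average_function a b"
  define \<mu> where "\<mu> = Min ((\<lambda>k. min \<bar>f (u k)\<bar> \<bar>f (v k)\<bar>) ` N)"
  have f0: "f (u k) \<noteq> 0" "f (v k) \<noteq> 0" if "k \<in> N" for k using uv[OF that] by (auto simp: f_def)
  have "N \<noteq> {}" by (simp add: N_def)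
  hence \<mu>: "\<mu> > 0" "\<And>k. k \<in> N \<Longrightarrow> \<mu> \<le> \<bar>f (u k)\<bar>" "\<And>k. k \<in> N \<Longrightarrow> \<mu> \<le> \<bar>f (v k)\<bar>"
  proof -
    show "\<mu> > 0" using f0 N(1) \<open>N \<noteq> {}\<close> by (simp add: \<mu>_def)
    have "\<mu> \<le> min \<bar>f (u k)\<bar> \<bar>f (v k)\<bar>" if "k \<in> N" for k unfolding \<mu>_def using N(1) that by (intro Min_le) auto
    thus "\<And>k. k \<in> N \<Longrightarrow> \<mu> \<le> \<bar>f (u k)\<bar>" "\<And>k. k \<in> N \<Longrightarrow> \<mu> \<le> \<bar>f (v k)\<bar>" by force+
  qed
  have sub: "of_real ` {r\<^sub>1..r\<^sub>2} \<subseteq> ?B" using r by (auto simp: of_real_in_box_nbhd)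
  obtain \<eta> where \<eta>: "\<eta> > 0" "\<And>D. D holomorphic_on ?B \<Longrightarrow> \<forall>z\<in>?B. norm (D z - averageC a b z) \<le> \<eta> \<Longrightarrow>
     \<forall>x. of_real x \<in> ?B \<longrightarrow> D (of_real x) \<in> \<real> \<Longrightarrow>
     finite {x \<in> {r\<^sub>1..r\<^sub>2}. D (of_real x) = 0} \<and> card {x \<in> {r\<^sub>1..r\<^sub>2}. D (of_real x) = 0} \<le> 6"
    using zeros_of_perturbation[OF open_box_nbhd displacement_function(1)[OF r] sub averageC_zeros[OF r nz]] by blast
  obtain \<epsilon>\<^sub>0 K where \<epsilon>\<^sub>0: "\<epsilon>\<^sub>0 > 0" and K: "\<And>\<epsilon>. 0 < \<bar>\<epsilon>\<bar> \<and> \<bar>\<epsilon>\<bar> < \<epsilon>\<^sub>0 \<Longrightarrow> displaces a b r\<^sub>1 r\<^sub>2 K \<epsilon>"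
    using displacement_function(2)[OF r] by blast
  \<comment> \<open>The three bounds give at most six zeros, preserve the sign changes, and keep the
    orbits close to circles.\<close>
  define \<kappa> where "\<kappa> = min \<eta> (min (\<mu> / 2) (1/8))"
  have \<kappa>: "\<kappa> > 0" "\<kappa> \<le> \<eta>" "\<kappa> < \<mu>" "\<kappa> \<le> 1/8" using \<eta>(1) \<mu>(1) by (auto simp: \<kappa>_def)
  define \<epsilon>1 where "\<epsilon>1 = min \<epsilon>\<^sub>0 (\<kappa> / (\<bar>K\<bar> + 1))"
  have "\<epsilon>1 > 0" using \<epsilon>\<^sub>0 \<kappa>(1) by (simp add: \<epsilon>1_def add_nonneg_pos)
  moreover have "card (limit_cycles_in_annulus a b \<epsilon> r\<^sub>1 r\<^sub>2) = 6"
    if \<epsilon>: "0 < \<bar>\<epsilon>\<bar> \<and> \<bar>\<epsilon>\<bar> < \<epsilon>1" for \<epsilon>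
  proof -
    let ?Z = "filippov_field a b \<epsilon>" and ?ann = "{z :: real \<times> real. r\<^sub>1 \<le> norm z \<and> norm z \<le> r\<^sub>2}"
    have "displaces a b r\<^sub>1 r\<^sub>2 K \<epsilon>" using K[of \<epsilon>] \<epsilon> by (simp add: \<epsilon>1_def)
    then obtain D Orb where D: "D holomorphic_on ?B" "\<forall>z\<in>?B. norm (D z - averageC a b z) \<le> K * \<bar>\<epsilon>\<bar>"
      "\<forall>x. of_real x \<in> ?B \<longrightarrow> D (of_real x) \<in> \<real>"
      and P1: "\<forall>S. periodic_orbit ?Z S \<and> S \<subseteq> ?ann \<longrightarrow> (\<exists>r\<in>{r\<^sub>1..r\<^sub>2}. D (of_real r) = 0 \<and> S = Orb r)"
      and P2: "\<forall>r\<in>{r\<^sub>1..r\<^sub>2}. D (of_real r) = 0 \<longrightarrow> Orb r \<subseteq> {z. \<bar>norm z - r\<bar> \<le> K * \<bar>\<epsilon>\<bar>} \<and>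
         (Orb r \<subseteq> ?ann \<longrightarrow> periodic_orbit ?Z (Orb r) \<and> (\<forall>x>0. (x, 0) \<in> Orb r \<longleftrightarrow> x = r))"
      unfolding displaces_def by (elim exE conjE) (rule that; assumption)
    have "\<bar>\<epsilon>\<bar> * (\<bar>K\<bar> + 1) \<le> \<kappa>" using \<epsilon> by (simp add: \<epsilon>1_def pos_less_divide_eq add_nonneg_pos less_imp_le)
    moreover have "K * \<bar>\<epsilon>\<bar> \<le> \<bar>\<epsilon>\<bar> * (\<bar>K\<bar> + 1)" using mult_right_mono[OF abs_ge_self[of K], of "\<bar>\<epsilon>\<bar>"] by (simp add: algebra_simps)
    ultimately have K\<kappa>: "K * \<bar>\<epsilon>\<bar> \<le> \<kappa>" by simp
    hence "\<forall>z\<in>?B. norm (D z - averageC a b z) \<le> \<eta>" using D(2) \<kappa>(2) by force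
    note Zs = \<eta>(2)[OF D(1) this D(3)]
    define Zs where "Zs = {x \<in> {r\<^sub>1..r\<^sub>2}. D (of_real x) = 0}"
    have Zfin: "finite Zs" and Zcard: "card Zs \<le> 6" using Zs by (auto simp: Zs_def)
    have "\<exists>x\<in>{u k..v k}. D (of_real x) = 0" if k: "k \<in> N" for k
    proof (rule real_zero_from_sign_change[where f = f and \<Omega> = ?B])
      have pos: "r\<^sub>1 < u k" "v k < r\<^sub>2" "u k < v k" using uv[OF k] N(3)[OF k] by (auto simp: r_def)
      show "of_real ` {u k..v k} \<subseteq> ?B" using pos sub by auto
      have near: "norm (D (of_real x) - of_real (f x)) \<le> \<kappa>" if "x \<in> {r\<^sub>1..r\<^sub>2}" for x
      proof -
        have "of_real x \<in> ?B" "x > 0" using that sub r by auto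
        thus ?thesis using D(2) K\<kappa> by (force simp: f_def simp flip: averageC_of_real)
      qed
      show "norm (D (of_real (u k)) - of_real (f (u k))) < \<bar>f (u k)\<bar>"
        using near[of "u k"] \<mu>(2)[OF k] \<kappa>(3) pos by auto
      show "norm (D (of_real (v k)) - of_real (f (v k))) < \<bar>f (v k)\<bar>"
        using near[of "v k"] \<mu>(3)[OF k] \<kappa>(3) pos by auto
      show "u k < v k" by (rule pos)
      show "f (u k) * f (v k) < 0" using uv[OF k] by (simp add: f_def)
    qed (use D in \<open>auto intro: open_box_nbhd\<close>)
    then obtain z where z: "\<And>k. k \<in> N \<Longrightarrow> z k \<in> {u k..v k}" "\<And>k. k \<in> N \<Longrightarrow> D (of_real (z k)) = 0" by metis
    have zr: "k - 1/4 < z k \<and> z k < k + 1/4" if "k \<in> N" for k using z(1)[OF that] uv[OF that] by auto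
    have "inj_on z N"
    proof (rule inj_onI)
      fix k l assume kl: "k \<in> N" "l \<in> N" "z k = z l"
      show "k = l"
      proof (rule ccontr)
        assume "k \<noteq> l"
        thus False using gap[OF kl(1,2)] zr[OF kl(1)] zr[OF kl(2)] kl(3) by linarith
      qed
    qed
    hence cz: "card (z ` N) = 6" using N by (simp add: card_image)
    have "z ` N \<subseteq> Zs"
    proof
      fix x assume "x \<in> z ` N"
      then obtain k where "k \<in> N" "x = z k" by blast
      thus "x \<in> Zs" using z(2) zr[of k] N(3)[of k] by (auto simp: Zs_def r_def)
    qed
    \<comment> \<open>The upper bound six turns the inclusion into an equality, so every zero is now
      located near an integer.\<close>
    from card_seteq[OF Zfin this] have Zeq: "Zs = z ` N" using cz Zcard by simp
    have Zr: "3/4 < x \<and> x < 25/4" if x: "x \<in> Zs" for x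
    proof -
      obtain k where "k \<in> N" "x = z k" using x Zeq by blast
      thus ?thesis using zr[of k] N(3)[of k] by auto
    qed
    have Oann: "Orb x \<subseteq> {z. r\<^sub>1 < norm z \<and> norm z < r\<^sub>2}" if "x \<in> Zs" for x
    proof
      fix w assume "w \<in> Orb x"
      hence "\<bar>norm w - x\<bar> \<le> K * \<bar>\<epsilon>\<bar>" using P2 that unfolding Zs_def by blast
      hence "\<bar>norm w - x\<bar> \<le> 1/8" using K\<kappa> \<kappa>(4) by simp
      hence "r\<^sub>1 < norm w" "norm w < r\<^sub>2" using Zr[OF that] unfolding r_def by linarith+
      thus "w \<in> {z. r\<^sub>1 < norm z \<and> norm z < r\<^sub>2}" by simp
    qed
    have Oann': "Orb x \<subseteq> ?ann" if "x \<in> Zs" for x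
    proof
      fix w assume "w \<in> Orb x"
      thus "w \<in> ?ann" using subsetD[OF Oann[OF that], of w] by simp
    qed
    have P2': "periodic_orbit ?Z (Orb x) \<and> (\<forall>y>0. (y, 0) \<in> Orb x \<longleftrightarrow> y = x)" if x: "x \<in> Zs" for x
    proof -
      have 1: "x \<in> {r\<^sub>1..r\<^sub>2}" and 2: "D (of_real x) = 0" using x by (auto simp: Zs_def)
      show ?thesis by (rule mp[OF conjunct2[OF mp[OF bspec[OF P2 1] 2]] Oann'[OF x]])
    qed
    have per: "periodic_orbit ?Z (Orb x)" if "x \<in> Zs" for x by (rule conjunct1[OF P2'[OF that]])
    have axis: "(y, 0) \<in> Orb x \<longleftrightarrow> y = x" if "x \<in> Zs" "y > 0" for x y
      using conjunct2[OF P2'[OF that(1)]] that(2) by simp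
    have Zpos: "x > 0" if "x \<in> Zs" for x using Zr[OF that] by simp
    have lc: "limit_cycle ?Z (Orb x)" if x: "x \<in> Zs" for x
      unfolding limit_cycle_def
    proof (intro conjI per[OF x])
      \<comment> \<open>Removing the other zeros on the axis isolates the orbit, as every periodic orbit crosses the axis in a zero.\<close>
      let ?U = "{z :: real \<times> real. r\<^sub>1 < norm z \<and> norm z < r\<^sub>2} - (\<lambda>y. (y, 0)) ` (Zs - {x})"
      have "open {z :: real \<times> real. r\<^sub>1 < norm z \<and> norm z < r\<^sub>2}"
        by (intro open_Collect_conj open_Collect_less continuous_intros)
      hence "open ?U" using Zfin by (intro open_Diff finite_imp_closed) auto
      moreover have "Orb x \<subseteq> ?U" using Oann[OF x] axis[OF x] Zpos by auto
      moreover have "S = Orb x" if S: "periodic_orbit ?Z S" "S \<subseteq> ?U" for S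
      proof -
        have "S \<subseteq> ?ann" using S(2) by (auto intro: less_imp_le)
        then obtain y where y: "y \<in> Zs" "S = Orb y" using P1 S(1) unfolding Zs_def by blast
        have "(y, 0) \<in> ?U" using axis[OF y(1) Zpos[OF y(1)]] y(2) S(2) by blast
        hence "y = x" using y(1) by blast
        thus ?thesis using y(2) by simp
      qed
      ultimately show "\<exists>U. open U \<and> Orb x \<subseteq> U \<and> (\<forall>C'. periodic_orbit ?Z C' \<and> C' \<subseteq> U \<longrightarrow> C' = Orb x)" by blast
    qed
    have "limit_cycles_in_annulus a b \<epsilon> r\<^sub>1 r\<^sub>2 = Orb ` Zs"
    proof
      show "limit_cycles_in_annulus a b \<epsilon> r\<^sub>1 r\<^sub>2 \<subseteq> Orb ` Zs"
      proof
        fix S assume "S \<in> limit_cycles_in_annulus a b \<epsilon> r\<^sub>1 r\<^sub>2"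
        hence "periodic_orbit ?Z S \<and> S \<subseteq> ?ann" by (simp add: limit_cycles_in_annulus_def limit_cycle_def)
        then obtain x where "x \<in> {r\<^sub>1..r\<^sub>2}" "D (of_real x) = 0" "S = Orb x" using P1 by meson
        thus "S \<in> Orb ` Zs" by (simp add: Zs_def)
      qed
      show "Orb ` Zs \<subseteq> limit_cycles_in_annulus a b \<epsilon> r\<^sub>1 r\<^sub>2"
        using lc Oann' by (auto simp: limit_cycles_in_annulus_def)
    qed
    moreover have "inj_on Orb Zs"
    proof (rule inj_onI)
      fix x y assume "x \<in> Zs" "y \<in> Zs" "Orb x = Orb y"
      thus "x = y" using axis[of x x] axis[of y x] Zpos[of x] by simp
    qed
    ultimately show ?thesis using cz Zeq by (simp add: card_image)
  qed
  ultimately show ?thesis using nz r by blast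
qed

theorem theorem1p1:
  "(\<forall>a b. average_nonzero a b \<longrightarrow>
      (\<forall>r\<^sub>1 r\<^sub>2. 0 < r\<^sub>1 \<and> r\<^sub>1 < r\<^sub>2 \<longrightarrow>
        (\<exists>\<epsilon>\<^sub>0>0. \<forall>\<epsilon>. 0 < \<bar>\<epsilon>\<bar> \<and> \<bar>\<epsilon>\<bar> < \<epsilon>\<^sub>0 \<longrightarrow>
          finite (limit_cycles_in_annulus a b \<epsilon> r\<^sub>1 r\<^sub>2) \<and>
          card (limit_cycles_in_annulus a b \<epsilon> r\<^sub>1 r\<^sub>2) \<le> 6))) \<and>
   (\<exists>a b. average_nonzero a b \<and>
      (\<exists>r\<^sub>1 r\<^sub>2. 0 < r\<^sub>1 \<and> r\<^sub>1 < r\<^sub>2 \<and>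
        (\<exists>\<epsilon>\<^sub>0>0. \<forall>\<epsilon>. 0 < \<bar>\<epsilon>\<bar> \<and> \<bar>\<epsilon>\<bar> < \<epsilon>\<^sub>0 \<longrightarrow>
          card (limit_cycles_in_annulus a b \<epsilon> r\<^sub>1 r\<^sub>2) = 6)))"
  using at_most_six_limit_cycles six_limit_cycles_attained by blast

end
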